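(* Let $a,b$ be integers with $b\neq 0$, $d=a/b\neq 0$, $|a-b|\neq 1$ and $\gcd(a,b)=1$. Then for every compact set $K\subset D$ and every $\varepsilon>0$, we have \[ \liminf_{T\to\infty}\frac{1}{T}\,\mu\Bigl\{\tau\in[0,T] : \sup_{s\in K}\bigl|\zeta(s+i\tau)-\zeta(s+id\tau)\bigr|<\varepsilon\Bigr\}>0 . \]
   Context: $\zeta(s)$ is the Riemann zeta function. $D:=\{s\in\mathbb{C}: 1/2<\Re(s)<1\}$. $\mu\{A\}$ denotes the Lebesgue measure of a measurable set $A\subset\mathbb{R}$. *)

theory Defs
  imports "HOL-Complex_Analysis.Complex_Analysis"
begin

text \<open>
  \<open>is_zeta f\<close>: \<open>f\<close> is the analytic continuation to \<open>\<complex> - {1}\<close> of the Dirichlet series of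
  \<open>n\<close> to the power \<open>- s\<close>, \<open>n \<ge> 1\<close>. The value at the pole \<open>1\<close> is a dummy that makes \<open>f\<close>
  unique as a total function.
\<close>
definition is_zeta :: "(complex \<Rightarrow> complex) \<Rightarrow> bool" where
  "is_zeta f \<longleftrightarrow> f holomorphic_on (- {1}) \<and>
     (\<forall>s. Re s > 1 \<longrightarrow> (\<lambda>n. of_nat (Suc n) powr (- s)) sums f s) \<and> f 1 = 0"

definition riemann_zeta :: "complex \<Rightarrow> complex" where
  "riemann_zeta = (THE f. is_zeta f)"

definition strip_D :: "complex set" where
  "strip_D = {s. 1 / 2 < Re s \<and> Re s < 1}"

text \<open>
  The rest of this theory shows that the description of \<open>riemann_zeta\<close> is proper, by
  Euler--Maclaurin summation: integrating by parts \<open>k\<close> times against antiderivatives \<open>p\<close> of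
  mean zero on the unit interval extends the series to \<open>Re s > 1 - k\<close>.
\<close>

definition em_term :: "(real \<Rightarrow> complex) \<Rightarrow> nat \<Rightarrow> nat \<Rightarrow> complex \<Rightarrow> complex" where
  "em_term p k n s = integral {0..1} (\<lambda>t. p t * of_real (real (Suc n) + t) powr (- s - of_nat k))"

lemma of_nat_plus_nz: "0 \<le> t \<Longrightarrow> 1 + of_nat n + complex_of_real t \<noteq> 0"
  by (simp add: complex_eq_iff)

lemma em_cont:
  fixes p :: "real \<Rightarrow> complex"
  assumes "continuous_on {0..1} p"
  shows "continuous_on {0..1::real} (\<lambda>t. p t * of_real (real (Suc n) + t) powr z)"
  using assms by (auto intro!: continuous_intros simp: complex_nonpos_Reals_iff of_nat_plus_nz)

lemma em_term_holomorphic: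
  assumes p: "continuous_on {0..1} p"
  shows "em_term p k n holomorphic_on UNIV"
proof -
  have "(\<lambda>s. integral (cbox 0 1) (\<lambda>t. p t * of_real (real (Suc n) + t) powr (- s - of_nat k))) holomorphic_on UNIV"
  proof (rule leibniz_rule_holomorphic)
    fix s :: complex and t :: real assume t: "t \<in> cbox 0 1"
    hence "complex_of_real (real (Suc n) + t) \<noteq> 0" using of_nat_plus_nz[of t n] by simp
    thus "((\<lambda>s. p t * of_real (real (Suc n) + t) powr (- s - of_nat k)) has_field_derivative
        p t * (- (of_real (real (Suc n) + t) powr (- s - of_nat k) * Ln (of_real (real (Suc n) + t))))) (at s within UNIV)"
      by (auto intro!: derivative_eq_intros simp: powr_def)
  next
    fix s :: complex
    show "(\<lambda>t. p t * of_real (real (Suc n) + t) powr (- s - of_nat k)) integrable_on cbox 0 1"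
      using em_cont[OF p] by (auto intro!: integrable_continuous_real)
  next
    have "continuous_on (UNIV \<times> {0..1::real}) (\<lambda>x. p (snd x))"
      by (rule continuous_on_compose2[OF p]) (auto intro!: continuous_intros)
    thus "continuous_on (UNIV \<times> cbox 0 1) (\<lambda>(s, t). p t * (- (of_real (real (Suc n) + t) powr (- s - of_nat k) * Ln (of_real (real (Suc n) + t)))))"
      unfolding case_prod_unfold
      by (auto intro!: continuous_intros simp: complex_nonpos_Reals_iff of_nat_plus_nz)
  qed auto
  thus ?thesis unfolding em_term_def[abs_def] by simp
qed

lemma em_term_bound:
  assumes p: "continuous_on {0..1} p" and B: "\<And>t. t \<in> {0..1} \<Longrightarrow> norm (p t) \<le> B"
    and s: "Re s + real k \<ge> r" "r \<ge> 0"
  shows "norm (em_term p k n s) \<le> B * real (Suc n) powr (- r)"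
proof -
  have B0: "B \<ge> 0" using B[of 0] norm_ge_zero[of "p 0"] by (simp del: norm_ge_zero)
  have "norm (em_term p k n s) \<le> (B * real (Suc n) powr (- r)) * (1 - 0)"
    unfolding em_term_def
  proof (rule integral_bound)
    fix t :: real assume t: "t \<in> {0..1}"
    have "norm (of_real (real (Suc n) + t) powr (- s - of_nat k) :: complex) = (real (Suc n) + t) powr (- (Re s + real k))"
      using t by (subst norm_powr_real_powr) auto
    also have "\<dots> \<le> real (Suc n) powr (- (Re s + real k))"
      using t s by (intro powr_mono2') auto
    also have "\<dots> \<le> real (Suc n) powr (- r)" using s by (intro powr_mono) auto
    finally show "norm (p t * of_real (real (Suc n) + t) powr (- s - of_nat k)) \<le> B * real (Suc n) powr (- r)"
      unfolding norm_mult using B[OF t] B0 by (intro mult_mono) auto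
  qed (use em_cont[OF p] in auto)
  thus ?thesis by simp
qed

lemma summable_Suc_powr: "r > 1 \<Longrightarrow> summable (\<lambda>n. B * real (Suc n) powr (- r))"
  by (intro summable_mult, subst summable_Suc_iff[where f = "\<lambda>n. real n powr (- r)"]) (simp add: summable_real_powr_iff)

lemma em_bounded:
  assumes "continuous_on {0..1::real} (p :: real \<Rightarrow> complex)"
  obtains B where "\<And>t. t \<in> {0..1} \<Longrightarrow> norm (p t) \<le> B"
  using compact_imp_bounded[OF compact_continuous_image[OF assms]] unfolding bounded_iff by blast

lemma em_summable:
  assumes p: "continuous_on {0..1} p" and s: "Re s + real k > 1"
  shows "summable (\<lambda>n. em_term p k n s)"
proof -
  obtain B where B: "\<And>t. t \<in> {0..1} \<Longrightarrow> norm (p t) \<le> B" using em_bounded[OF p] by metis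
  show ?thesis
    by (rule summable_comparison_test'[OF summable_Suc_powr[OF s, of B]])
       (rule em_term_bound[OF p B], use s in auto)
qed

lemma em_holomorphic:
  assumes p: "continuous_on {0..1} p"
  shows "(\<lambda>s. \<Sum>n. em_term p k n s) holomorphic_on {s. Re s > 1 - real k}"
proof (rule holomorphic_uniform_sequence)
  show "open {s. Re s > 1 - real k}" by (rule open_halfspace_Re_gt)
  show "(\<lambda>s. \<Sum>n<N. em_term p k n s) holomorphic_on {s. Re s > 1 - real k}" for N
    by (intro holomorphic_on_sum holomorphic_on_subset[OF em_term_holomorphic[OF p]]) auto
  fix s assume "s \<in> {s. Re s > 1 - real k}"
  hence s: "Re s + real k > 1" by auto
  obtain B where B: "\<And>t. t \<in> {0..1} \<Longrightarrow> norm (p t) \<le> B" using em_bounded[OF p] by metis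
  define e where "e = (Re s + real k - 1) / 2"
  have e: "e > 0" using s by (simp add: e_def)
  have *: "Re z + real k \<ge> 1 + e" if "z \<in> cball s e" for z
    using abs_Re_le_cmod[of "s - z"] that by (auto simp: dist_norm e_def field_simps)
  have "cball s e \<subseteq> {s. Re s > 1 - real k}" using * e by fastforce
  moreover have "uniform_limit (cball s e) (\<lambda>N s. \<Sum>n<N. em_term p k n s) (\<lambda>s. \<Sum>n. em_term p k n s) sequentially"
    by (rule Weierstrass_m_test[OF _ summable_Suc_powr[of "1 + e" B]])
       (use em_term_bound[OF p B *] e in auto)
  ultimately show "\<exists>d>0. cball s d \<subseteq> {s. Re s > 1 - real k} \<and>
     uniform_limit (cball s d) (\<lambda>N s. \<Sum>n<N. em_term p k n s) (\<lambda>s. \<Sum>n. em_term p k n s) sequentially"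
    using e by blast
qed

lemma em_by_parts:
  assumes p: "continuous_on {0..1} p"
    and q: "\<And>t. t \<in> {0..1} \<Longrightarrow> (q has_vector_derivative p t) (at t within {0..1})"
  shows "em_term p k n s = q 1 * of_nat (Suc (Suc n)) powr (- s - of_nat k)
     - q 0 * of_nat (Suc n) powr (- s - of_nat k) + (s + of_nat k) * em_term q (Suc k) n s"
proof -
  let ?z = "- s - of_nat k"
  let ?g = "\<lambda>t. complex_of_real (real (Suc n) + t) powr ?z"
  let ?g' = "\<lambda>t. ?z * complex_of_real (real (Suc n) + t) powr (?z - 1)"
  have cq: "continuous_on {0..1} q" by (rule continuous_on_vector_derivative) (rule q)
  have g: "(?g has_vector_derivative ?g' t) (at t within {0..1})" if "t \<in> {0..1}" for t
  proof -
    have "((\<lambda>w. (of_nat (Suc n) + w) powr ?z) has_field_derivative ?z * (of_nat (Suc n) + of_real t) powr (?z - 1)) (at (complex_of_real t))"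
      using that by (auto intro!: derivative_eq_intros simp: complex_nonpos_Reals_iff)
    from has_vector_derivative_real_field[OF this] show ?thesis
      by (simp add: has_vector_derivative_at_within)
  qed
  have "((\<lambda>t. q t * ?g' t + p t * ?g t) has_integral (q 1 * ?g 1 - q 0 * ?g 0)) {0..1}"
    by (rule fundamental_theorem_of_calculus)
       (use has_vector_derivative_mult[OF q g] in \<open>auto simp del: of_nat_Suc of_real_add\<close>)
  moreover have "((\<lambda>t. - (s + of_nat k) * (q t * complex_of_real (real (Suc n) + t) powr (- s - of_nat (Suc k)))) has_integral
      (- (s + of_nat k) * em_term q (Suc k) n s)) {0..1}"
    unfolding em_term_def
    by (intro has_integral_mult_right integrable_integral integrable_continuous_real em_cont cq)
  hence "((\<lambda>t. q t * ?g' t) has_integral (- (s + of_nat k) * em_term q (Suc k) n s)) {0..1}"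
    by (simp add: algebra_simps)
  ultimately have "((\<lambda>t. q t * ?g' t + p t * ?g t - q t * ?g' t) has_integral
      (q 1 * ?g 1 - q 0 * ?g 0 - (- (s + of_nat k) * em_term q (Suc k) n s))) {0..1}"
    by (rule has_integral_diff)
  hence "((\<lambda>t. p t * ?g t) has_integral
      (q 1 * ?g 1 - q 0 * ?g 0 + (s + of_nat k) * em_term q (Suc k) n s)) {0..1}"
    by (simp only: add_diff_cancel_left' mult_minus_left diff_minus_eq_add)
  from integral_unique[OF this] show ?thesis unfolding em_term_def[of p] by (simp add: add_ac)
qed

lemma Suc_powr_tendsto_0:
  assumes "Re z < 0"
  shows "(\<lambda>n. complex_of_nat (Suc n) powr z) \<longlonglongrightarrow> 0"
proof (rule tendsto_norm_zero_cancel)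
  have "(\<lambda>n. real (Suc n) powr Re z) \<longlonglongrightarrow> 0"
    using assms by (intro tendsto_neg_powr filterlim_compose[OF filterlim_real_sequentially filterlim_Suc]) auto
  moreover have "norm (complex_of_nat (Suc n) powr z) = real (Suc n) powr Re z" for n
    by (subst norm_powr_real_powr) (auto simp del: of_nat_Suc)
  ultimately show "(\<lambda>n. norm (complex_of_nat (Suc n) powr z)) \<longlonglongrightarrow> 0" by simp
qed

lemma Suc_powr_telescope:
  assumes "Re z < 0"
  shows "(\<lambda>n. complex_of_nat (Suc (Suc n)) powr z - of_nat (Suc n) powr z) sums (- 1)"
  using telescope_sums[OF Suc_powr_tendsto_0[OF assms]] by simp

lemma em_step:
  assumes p: "continuous_on {0..1} p"
    and q: "\<And>t. t \<in> {0..1} \<Longrightarrow> (q has_vector_derivative p t) (at t within {0..1})"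
    and "q 1 = q 0" and s: "Re s > 1"
  shows "(\<Sum>n. em_term p k n s) = - q 0 + (s + of_nat k) * (\<Sum>n. em_term q (Suc k) n s)"
proof -
  have cq: "continuous_on {0..1} q" by (rule continuous_on_vector_derivative) (rule q)
  have "(\<lambda>n. q 0 * (complex_of_nat (Suc (Suc n)) powr (- s - of_nat k) - of_nat (Suc n) powr (- s - of_nat k))
      + (s + of_nat k) * em_term q (Suc k) n s) sums (q 0 * (- 1) + (s + of_nat k) * (\<Sum>n. em_term q (Suc k) n s))"
    using s by (intro sums_add sums_mult Suc_powr_telescope summable_sums em_summable cq) auto
  moreover have "em_term p k n s = q 0 * (complex_of_nat (Suc (Suc n)) powr (- s - of_nat k) - of_nat (Suc n) powr (- s - of_nat k))
      + (s + of_nat k) * em_term q (Suc k) n s" for n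
    by (subst em_by_parts[OF p q]) (use assms(3) in \<open>auto simp: algebra_simps\<close>)
  ultimately show ?thesis by (simp add: sums_iff)
qed

lemma em_base:
  assumes s: "Re s > 1"
  shows "(\<lambda>n. complex_of_nat (Suc n) powr (- s)) sums
           (1 / (s - 1) + 1 / 2 + (- s) * (\<Sum>n. em_term (\<lambda>t. of_real t - 1 / 2) 1 n s))"
proof -
  let ?q = "\<lambda>t::real. complex_of_real t - 1 / 2"
  have s1: "s \<noteq> 1" using s by auto
  have 1: "em_term (\<lambda>_. 1) 0 n s = 1 / 2 * (of_nat (Suc (Suc n)) powr (- s) + of_nat (Suc n) powr (- s))
     + s * em_term ?q 1 n s" for n
  proof -
    have "(?q has_vector_derivative 1) (at t within {0..1})" for t
      by (auto intro!: derivative_eq_intros)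
    from em_by_parts[of "\<lambda>_. 1" ?q 0 n s, OF _ this] show ?thesis by (simp add: algebra_simps)
  qed
  have 2: "em_term (\<lambda>_. 1) 0 n s = (of_nat (Suc (Suc n)) powr (1 - s) - of_nat (Suc n) powr (1 - s)) / (1 - s)" for n
  proof -
    have "em_term (\<lambda>_. 0) 0 n (s - 1) = of_nat (Suc (Suc n)) powr (1 - s) - of_nat (Suc n) powr (1 - s) + (s - 1) * em_term (\<lambda>_. 1) 1 n (s - 1)"
      using em_by_parts[of "\<lambda>_. 0" "\<lambda>_. 1" 0 n "s - 1"] by simp
    moreover have "em_term (\<lambda>_. 0) 0 n (s - 1) = 0" "em_term (\<lambda>_. 1) 1 n (s - 1) = em_term (\<lambda>_. 1) 0 n s"
      by (simp_all add: em_term_def)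
    ultimately have "(1 - s) * em_term (\<lambda>_. 1) 0 n s = of_nat (Suc (Suc n)) powr (1 - s) - of_nat (Suc n) powr (1 - s)"
      by (simp add: algebra_simps)
    thus ?thesis using s1 by (simp add: field_simps)
  qed
  have A: "(\<lambda>n. em_term (\<lambda>_. 1) 0 n s) sums (- 1 / (1 - s))"
    unfolding 2 by (intro sums_divide Suc_powr_telescope) (use s in auto)
  have B: "(\<lambda>n. em_term ?q 1 n s) sums (\<Sum>n. em_term ?q 1 n s)"
    by (intro summable_sums em_summable) (use s in \<open>auto intro!: continuous_intros\<close>)
  have "(\<lambda>n. em_term (\<lambda>_. 1) 0 n s - s * em_term ?q 1 n s
      - 1 / 2 * (of_nat (Suc (Suc n)) powr (- s) - of_nat (Suc n) powr (- s)))
     sums (- 1 / (1 - s) - s * (\<Sum>n. em_term ?q 1 n s) - 1 / 2 * (- 1))"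
    by (intro sums_diff A B sums_mult Suc_powr_telescope) (use s in auto)
  moreover have "em_term (\<lambda>_. 1) 0 n s - s * em_term ?q 1 n s
      - 1 / 2 * (of_nat (Suc (Suc n)) powr (- s) - of_nat (Suc n) powr (- s)) = of_nat (Suc n) powr (- s)" for n
    unfolding 1 by (simp add: algebra_simps)
  moreover have "- 1 / (1 - s) = 1 / (s - 1)" using s1 by (simp add: divide_simps)
  ultimately have "(\<lambda>n. complex_of_nat (Suc n) powr (- s)) sums
      (1 / (s - 1) - s * (\<Sum>n. em_term ?q 1 n s) - 1 / 2 * (- 1))" by (simp only:)
  also have "1 / (s - 1) - s * (\<Sum>n. em_term ?q 1 n s) - 1 / 2 * (- 1) =
      1 / (s - 1) + 1 / 2 + (- s) * (\<Sum>n. em_term ?q 1 n s)" by simp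
  finally show ?thesis .
qed

lemma em_exists:
  "\<exists>p E c. continuous_on {0..1::real} p \<and> integral {0..1} p = (0::complex) \<and>
     E holomorphic_on (- {1}) \<and> c holomorphic_on UNIV \<and>
     (\<forall>s. Re s > 1 \<longrightarrow> (\<lambda>n. complex_of_nat (Suc n) powr (- s)) sums
        (E s + c s * (\<Sum>n. em_term p (Suc k) n s)))"
proof (induction k)
  case 0
  have "((\<lambda>t. complex_of_real t - 1 / 2) has_integral
      ((\<lambda>t. (complex_of_real t)\<^sup>2 / 2 - complex_of_real t / 2) 1 - (\<lambda>t. (complex_of_real t)\<^sup>2 / 2 - complex_of_real t / 2) 0)) {0..1::real}"
    by (rule fundamental_theorem_of_calculus)
       (auto intro!: derivative_eq_intros has_vector_derivative_real_field)
  hence "integral {0..1} (\<lambda>t. complex_of_real t - 1 / 2) = 0"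
    by (simp add: integral_unique)
  thus ?case using em_base
    by (intro exI[of _ "\<lambda>t. complex_of_real t - 1 / 2"] exI[of _ "\<lambda>s. 1 / (s - 1) + 1 / 2"] exI[of _ "\<lambda>s. - s"])
       (auto intro!: continuous_intros holomorphic_intros)
next
  case (Suc k)
  then obtain p E c where p: "continuous_on {0..1::real} p" "integral {0..1} p = (0::complex)"
     and E: "E holomorphic_on (- {1})" and c: "c holomorphic_on UNIV" and
     sums: "\<And>s. Re s > 1 \<Longrightarrow> (\<lambda>n. complex_of_nat (Suc n) powr (- s)) sums
        (E s + c s * (\<Sum>n. em_term p (Suc k) n s))" by auto
  define r where "r = (\<lambda>t. integral {0..t} p)"
  define q where "q = (\<lambda>t. r t - integral {0..1} r)"
  have r: "(r has_vector_derivative p t) (at t within {0..1})" if "t \<in> {0..1}" for t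
    unfolding r_def using p that by (intro integral_has_vector_derivative)
  hence q: "(q has_vector_derivative p t) (at t within {0..1})" if "t \<in> {0..1}" for t
    unfolding q_def using that by (auto intro!: derivative_eq_intros)
  have cr: "continuous_on {0..1} r" by (rule continuous_on_vector_derivative) (rule r)
  have cq: "continuous_on {0..1} q" unfolding q_def by (intro continuous_intros cr)
  have iq: "integral {0..1} q = 0"
    unfolding q_def by (subst integral_diff) (auto intro!: integrable_continuous_real cr)
  have q01: "q 1 = q 0" using p by (simp add: q_def r_def)
  show ?case
  proof (rule exI[of _ q], rule exI[of _ "\<lambda>s. E s - c s * q 0"],
      rule exI[of _ "\<lambda>s. c s * (s + of_nat (Suc k))"], intro conjI allI impI)
    fix s :: complex assume s: "Re s > 1"
    have "E s + c s * (\<Sum>n. em_term p (Suc k) n s) =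
        E s - c s * q 0 + c s * (s + of_nat (Suc k)) * (\<Sum>n. em_term q (Suc (Suc k)) n s)"
      by (subst em_step[OF p(1) q q01 s]) (auto simp: algebra_simps)
    with sums[OF s] show "(\<lambda>n. complex_of_nat (Suc n) powr (- s)) sums
        (E s - c s * q 0 + c s * (s + of_nat (Suc k)) * (\<Sum>n. em_term q (Suc (Suc k)) n s))"
      by (simp only:)
  qed (auto intro!: holomorphic_on_diff holomorphic_on_mult holomorphic_on_add holomorphic_on_const
         holomorphic_on_ident E c holomorphic_on_subset[OF c] iq cq)
qed

lemma zeta_half_plane_exists:
  "\<exists>f. f holomorphic_on ({s. Re s > - real k} - {1}) \<and>
     (\<forall>s. Re s > 1 \<longrightarrow> (\<lambda>n. complex_of_nat (Suc n) powr (- s)) sums f s)"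
proof -
  obtain p E c where p: "continuous_on {0..1::real} p"
     and E: "E holomorphic_on (- {1})" and c: "c holomorphic_on UNIV" and
     sums: "\<forall>s. Re s > 1 \<longrightarrow> (\<lambda>n. complex_of_nat (Suc n) powr (- s)) sums
        (E s + c s * (\<Sum>n. em_term p (Suc k) n s))" using em_exists[of k] by metis
  have "(\<lambda>s. E s + c s * (\<Sum>n. em_term p (Suc k) n s)) holomorphic_on ({s. Re s > - real k} - {1})"
    by (intro holomorphic_intros holomorphic_on_subset[OF E] holomorphic_on_subset[OF c]
         holomorphic_on_subset[OF em_holomorphic[OF p]]) auto
  with sums show ?thesis by blast
qed

theorem ex1_is_zeta: "\<exists>!f. is_zeta f"
proof (rule ex_ex1I)
  let ?H = "\<lambda>k. {s. Re s > - real k} - {1::complex}"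
  obtain F where F: "\<And>k. F k holomorphic_on ?H k"
    and Fs: "\<And>k s. Re s > 1 \<Longrightarrow> (\<lambda>n. complex_of_nat (Suc n) powr (- s)) sums F k s"
    using zeta_half_plane_exists by metis
  have op: "open (?H k)" for k by (intro open_Diff open_halfspace_Re_gt) auto
  have conn: "connected (?H k)" for k
    by (intro connected_open_delete) (auto intro: convex_connected convex_halfspace_Re_gt open_halfspace_Re_gt)
  have F_eq: "F j s = F k s" if "j \<le> k" "s \<in> ?H j" for j k s
  proof (rule analytic_continuation_open[where s = "{s. Re s > 1}" and s' = "?H j" and f = "F j" and g = "F k"])
    show "{s. Re s > 1} \<noteq> {}" by (auto intro!: exI[of _ 2])
    show "F k holomorphic_on ?H j" using that(1) by (intro holomorphic_on_subset[OF F[of k]]) auto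
    show "F j z = F k z" if "z \<in> {s. Re s > 1}" for z using Fs[of z] that sums_unique2 by blast
  qed (use that op conn F open_halfspace_Re_gt in auto)
  define f where "f = (\<lambda>s. if s = 1 then 0 else F (nat \<lceil>\<bar>Re s\<bar>\<rceil> + 1) s)"
  have f_eq: "f s = F k s" if "s \<in> ?H k" for k s
  proof -
    have "s \<in> ?H (nat \<lceil>\<bar>Re s\<bar>\<rceil> + 1)" using that by (auto; linarith)
    thus ?thesis using that F_eq[of _ _ s] unfolding f_def by (metis DiffD2 insertI1 nle_le)
  qed
  have "f holomorphic_on (\<Union>k. ?H k)"
    by (intro holomorphic_on_UN_open op holomorphic_transform[OF F]) (rule f_eq[symmetric])
  moreover have "(\<Union>k. ?H k) = - {1}"
    by (auto, metis reals_Archimedean2 minus_less_iff)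
  moreover have "(\<lambda>n. of_nat (Suc n) powr (- s)) sums f s" if "Re s > 1" for s
    using Fs[OF that, of 0] f_eq[of s 0] that by (cases "s = 1") auto
  ultimately show "\<exists>f. is_zeta f" unfolding is_zeta_def by (intro exI[of _ f]) (auto simp: f_def)
next
  fix f g assume f: "is_zeta f" and g: "is_zeta g"
  have "f s = g s" if "s \<noteq> 1" for s
  proof (rule analytic_continuation_open[where s = "{s. Re s > 1}" and s' = "- {1}" and f = f and g = g])
    show "{s. Re s > 1} \<noteq> {}" by (auto intro!: exI[of _ 2])
    show "connected (- {1::complex})" by (rule connected_punctured_universe) simp
    show "f z = g z" if "z \<in> {s. Re s > 1}" for z
      using f g that sums_unique2 unfolding is_zeta_def by blast
  qed (use f g that open_halfspace_Re_gt in \<open>auto simp: is_zeta_def\<close>)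
  thus "f = g" using f g unfolding is_zeta_def by (metis ext)
qed

lemma is_zeta_riemann_zeta: "is_zeta riemann_zeta"
  unfolding riemann_zeta_def by (rule theI'[OF ex1_is_zeta])

lemma riemann_zeta_holomorphic: "riemann_zeta holomorphic_on (- {1})"
  and riemann_zeta_sums: "Re s > 1 \<Longrightarrow> (\<lambda>n. of_nat (Suc n) powr (- s)) sums riemann_zeta s"
  using is_zeta_riemann_zeta unfolding is_zeta_def by blast+

end

theory Submission
  imports Defs "HOL-Real_Asymp.Real_Asymp"
begin

text \<open>
  Put \<open>\<tau> = b t\<close> and compare \<open>\<zeta>(s + i b t)\<close> with \<open>\<zeta>(s + i a t)\<close>. Let \<open>m = |a - b| \<ge> 2\<close> (for \<open>a = b\<close>
  there is nothing to prove). If \<open>p\<close> to the power \<open>i t\<close> is close to an \<open>m\<close>-th root of unity \<open>\<xi>\<^sub>p\<close> for every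
  prime \<open>p \<le> y\<close>, then the Euler factors at \<open>p \<le> y\<close> of both functions nearly agree. Letting \<open>\<xi>\<^sub>p\<close> run
  cyclically through the \<open>m\<close>-th roots of unity along the primes makes the partial Euler products at
  these phases bounded in \<open>y\<close> for \<open>Re s > 1/2\<close>: since \<open>b\<close> is coprime to \<open>m\<close>, the \<open>b\<close>-th powers of the
  \<open>\<xi>\<^sub>p\<close> have bounded partial sums. This is where \<open>m \<noteq> 1\<close> is needed.

  Instead of restricting \<open>t\<close> to a set, average against a product \<open>W(t)\<close> of Fejer kernels, one for each
  \<open>p \<le> y\<close>, centred at \<open>\<xi>\<^sub>p\<close>. By unique factorisation the mean value of \<open>W\<close> is 1 and the primes
  beyond \<open>y\<close> remain independent of \<open>W\<close>, so they contribute a tail of the series of \<open>n\<close> to the power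
  \<open>- 2 Re s\<close> to the \<open>W\<close>-weighted mean square of the difference. As \<open>W\<close> is bounded, replacing \<open>\<zeta>\<close> by a long
  Dirichlet polynomial costs little in mean square, by Euler--Maclaurin summation. Hence the
  \<open>W\<close>-weighted mean square of the difference is small on finitely many circles around \<open>K\<close>;
  Cauchy's formula and Chebyshev's inequality conclude, again because \<open>W\<close> is bounded.
\<close>

section \<open>Trigonometric polynomials with parameters\<close>

text \<open>The parameters have to be chosen in a definite order. The tail over integers free of
  primes up to \<open>y\<close> is multiplied by the mean square of the Euler product over these
  primes, so a bound \<open>C\<close> for that product which does not depend on \<open>y\<close>
  must come before \<open>y\<close>. For \<open>m = 1\<close> the only phase is 1, and on the strip
  no such bound exists. The Lipschitz constant of the product in its phases grows exponentially with
  the number of primes, so the order \<open>K\<close> of the kernels is chosen after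
  \<open>y\<close>. This makes the bound \<open>B\<close> of the weight huge, and the mean square
  error in replacing zeta must be a small multiple of \<open>1 / B\<close>. Hence that replacement
  is proved for every finite set of integers containing some \<open>{1..M}\<close>, and the set is
  fitted to the weight afterwards.

  Dirichlet polynomials of length \<open>T\<close> to the power \<open>1 + 1 / i\<close> are short
  enough: the off-diagonal part of their mean square grows like a power of \<open>T\<close> with
  exponent close to \<open>2 - 2 * r < 1\<close>. The circles contain a continuum of points
  \<open>s\<close>, so all means must converge uniformly in \<open>s\<close>.\<close>

text \<open>
  \<open>trigpoly X L f m\<close>: on the parameter set \<open>X\<close>, \<open>f x\<close> is a trigonometric polynomial in \<open>t\<close> with
  frequencies in \<open>L\<close> and coefficients bounded in \<open>x\<close>, so that its means over \<open>[0, T]\<close> converge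
  to \<open>m x\<close> uniformly in \<open>x\<close>.
\<close>

inductive trigpoly :: "'x set \<Rightarrow> real set \<Rightarrow> ('x \<Rightarrow> real \<Rightarrow> complex) \<Rightarrow> ('x \<Rightarrow> complex) \<Rightarrow> bool"
  for X L where
  const: "bounded (c ` X) \<Longrightarrow> trigpoly X L (\<lambda>x t. c x) c"
| cis: "bounded (c ` X) \<Longrightarrow> l \<in> L \<Longrightarrow> l \<noteq> 0 \<Longrightarrow> trigpoly X L (\<lambda>x t. c x * cis (l * t)) (\<lambda>x. 0)"
| add: "trigpoly X L f m \<Longrightarrow> trigpoly X L g n \<Longrightarrow> trigpoly X L (\<lambda>x t. f x t + g x t) (\<lambda>x. m x + n x)"

lemma trigpoly_continuous: "trigpoly X L f m \<Longrightarrow> continuous_on A (f x)"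
  by (induction rule: trigpoly.induct) (auto intro!: continuous_intros)

lemma trigpoly_mono: "trigpoly X L f m \<Longrightarrow> L \<subseteq> L' \<Longrightarrow> trigpoly X L' f m"
  by (induction rule: trigpoly.induct) (auto intro: trigpoly.intros)

lemma bounded_image_mult:
  fixes c d :: "'x \<Rightarrow> complex"
  assumes "bounded (c ` X)" "bounded (d ` X)"
  shows "bounded ((\<lambda>x. c x * d x) ` X)"
proof -
  obtain B1 B2 where "\<forall>x\<in>X. norm (c x) \<le> B1" "\<forall>x\<in>X. norm (d x) \<le> B2"
    using assms unfolding bounded_iff by auto
  hence "norm (c x * d x) \<le> \<bar>B1\<bar> * \<bar>B2\<bar>" if "x \<in> X" for x
    unfolding norm_mult using that by (intro mult_mono) (auto intro: order_trans)
  thus ?thesis unfolding bounded_iff by blast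
qed

lemma bounded_image_const: "bounded ((\<lambda>x. c) ` X)"
  by (rule bounded_subset[of "{c}"]) auto

lemma trigpoly_cis:
  assumes "bounded (c ` X)" "l \<in> L"
  shows "trigpoly X L (\<lambda>x t. c x * cis (l * t)) (\<lambda>x. if l = 0 then c x else 0)"
  using trigpoly.const[OF assms(1)] trigpoly.cis[OF assms] by (cases "l = 0") auto

lemma trigpoly_scale:
  assumes "trigpoly X L f m" "bounded (c ` X)"
  shows "trigpoly X L (\<lambda>x t. c x * f x t) (\<lambda>x. c x * m x)"
  using assms(1)
proof (induction rule: trigpoly.induct)
  case (const d)
  show ?case by (intro trigpoly.const bounded_image_mult const assms)
next
  case (cis d l)
  from trigpoly.cis[OF bounded_image_mult[OF assms(2) cis(1)] cis(2,3)] show ?case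
    by (simp add: mult.assoc)
next
  case (add f m g n)
  from trigpoly.add[OF add.IH] show ?case by (simp add: algebra_simps)
qed

lemma trigpoly_sum:
  assumes "finite J" "\<And>j. j \<in> J \<Longrightarrow> trigpoly X L (f j) (m j)"
  shows "trigpoly X L (\<lambda>x t. \<Sum>j\<in>J. f j x t) (\<lambda>x. \<Sum>j\<in>J. m j x)"
  using assms
proof (induction J rule: finite_induct)
  case empty
  from trigpoly.const[OF bounded_image_const[of 0 X]] show ?case by simp
next
  case (insert j J)
  have "trigpoly X L (\<lambda>x t. f j x t + (\<Sum>j\<in>J. f j x t)) (\<lambda>x. m j x + (\<Sum>j\<in>J. m j x))"
    by (intro trigpoly.add insert) auto
  with insert(1,2) show ?case by simp
qed

lemma trigpoly_cnj:
  assumes "trigpoly X L f m" "\<And>l. l \<in> L \<Longrightarrow> - l \<in> L"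
  shows "trigpoly X L (\<lambda>x t. cnj (f x t)) (\<lambda>x. cnj (m x))"
  using assms(1)
proof (induction rule: trigpoly.induct)
  have *: "bounded ((\<lambda>x. cnj (c x)) ` X)" if "bounded (c ` X)" for c
    using that by (auto simp: bounded_iff)
  case (const d)
  thus ?case by (intro trigpoly.const *)
next
  have *: "bounded ((\<lambda>x. cnj (c x)) ` X)" if "bounded (c ` X)" for c
    using that by (auto simp: bounded_iff)
  case (cis d l)
  from trigpoly.cis[OF *[OF cis(1)] assms(2)[OF cis(2)]] cis(3) show ?case
    by (simp add: cis_cnj)
next
  case (add f m g n)
  from trigpoly.add[OF add.IH] show ?case by simp
qed

text \<open>If \<open>l + k = 0\<close> with \<open>k\<close> in \<open>L\<close>, then
  \<open>k = - l\<close> lies in both frequency sets and hence is 0. So a nonzero frequency of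
  \<open>L'\<close> is never cancelled and the product has no constant term.\<close>

lemma trigpoly_mult_cis_indep:
  assumes "trigpoly X L g n" "bounded (c ` X)" "l \<in> L'" "l \<noteq> 0" "L \<inter> L' \<subseteq> {0}"
    and "L \<subseteq> L0" "L' \<subseteq> L0" "\<And>l m. l \<in> L0 \<Longrightarrow> m \<in> L0 \<Longrightarrow> l + m \<in> L0"
    and "\<And>l. l \<in> L' \<Longrightarrow> - l \<in> L'"
  shows "trigpoly X L0 (\<lambda>x t. c x * cis (l * t) * g x t) (\<lambda>x. 0)"
  using assms(1)
proof (induction rule: trigpoly.induct)
  case (const d)
  from trigpoly.cis[OF bounded_image_mult[OF assms(2) const(1)], of l L0] assms show ?case
    by (simp add: mult_ac subset_iff)
next
  case (cis d k)
  have "l + k \<noteq> 0" using cis assms(3-5,9) by (metis Int_iff add_eq_0_iff empty_iff insert_iff subset_iff)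
  with trigpoly.cis[OF bounded_image_mult[OF assms(2) cis(1)], of "l + k" L0] assms(3,6-8) cis(2)
  show ?case by (simp add: cis_mult[symmetric] ring_distribs mult_ac subset_iff)
next
  case (add f m g n)
  from trigpoly.add[OF add.IH] show ?case by (simp add: algebra_simps)
qed

text \<open>Only the two constant terms can combine to a constant term. This is the form in which
  disjoint sets of primes behave like independent random variables.\<close>

lemma trigpoly_mult_indep:
  assumes "trigpoly X L f m" "trigpoly X L' g n" "L \<inter> L' \<subseteq> {0}"
    and "L \<subseteq> L0" "L' \<subseteq> L0" "\<And>l m. l \<in> L0 \<Longrightarrow> m \<in> L0 \<Longrightarrow> l + m \<in> L0"
    and "\<And>l. l \<in> L \<Longrightarrow> - l \<in> L"
  shows "trigpoly X L0 (\<lambda>x t. f x t * g x t) (\<lambda>x. m x * n x)"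
  using assms(1)
proof (induction rule: trigpoly.induct)
  case (const c)
  from trigpoly_scale[OF trigpoly_mono[OF assms(2,5)] this] show ?case .
next
  case (cis c l)
  show ?case using trigpoly_mult_cis_indep[OF assms(2) cis] assms(3-7) by (simp add: Int_commute)
next
  case (add f m f' m')
  from trigpoly.add[OF add.IH] show ?case by (simp add: algebra_simps)
qed

text \<open>Frequencies of the two factors may cancel here, so the means of the factors do not
  determine that of the product. Its existence is recorded, and its size is later controlled by
  comparison.\<close>

lemma trigpoly_mult:
  assumes "trigpoly X L f m" "trigpoly X L g n" "\<And>l m. l \<in> L \<Longrightarrow> m \<in> L \<Longrightarrow> l + m \<in> L"
  shows "\<exists>k. trigpoly X L (\<lambda>x t. f x t * g x t) k"
  using assms(1)
proof (induction rule: trigpoly.induct)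
  case (const c)
  from trigpoly_scale[OF assms(2) this] show ?case by blast
next
  case (cis c l)
  note c = this
  show ?case using assms(2)
  proof (induction rule: trigpoly.induct)
    case (const d)
    from trigpoly_scale[OF trigpoly.cis[OF c] const] show ?case by (auto simp: mult_ac)
  next
    case (cis d k)
    from trigpoly_cis[OF bounded_image_mult[OF c(1) cis(1)], of "l + k" L] assms(3)[OF c(2) cis(2)]
    show ?case by (intro exI) (simp add: cis_mult[symmetric] ring_distribs mult_ac)
  next
    case (add f m g n)
    then obtain k1 k2 where "trigpoly X L (\<lambda>x t. c x * cis (l * t) * f x t) k1"
       "trigpoly X L (\<lambda>x t. c x * cis (l * t) * g x t) k2" by blast
    from trigpoly.add[OF this] show ?case by (auto simp: algebra_simps)
  qed
next
  case (add f m f' m')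
  then obtain k1 k2 where "trigpoly X L (\<lambda>x t. f x t * g x t) k1"
       "trigpoly X L (\<lambda>x t. f' x t * g x t) k2" by blast
  from trigpoly.add[OF this] show ?case by (auto simp: algebra_simps)
qed

text \<open>Parseval's identity for finite sums: as the frequencies are distinct, only the diagonal
  \<open>j = k\<close> contributes to the mean.\<close>

lemma trigpoly_norm_square:
  assumes "finite J" "inj_on lam J" "\<And>j. j \<in> J \<Longrightarrow> bounded (c j ` X)"
    and "\<And>j k. j \<in> J \<Longrightarrow> k \<in> J \<Longrightarrow> lam j - lam k \<in> L"
  shows "trigpoly X L (\<lambda>x t. of_real ((norm (\<Sum>j\<in>J. c j x * cis (lam j * t)))\<^sup>2))
           (\<lambda>x. of_real (\<Sum>j\<in>J. (norm (c j x))\<^sup>2))"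
proof -
  let ?f = "\<lambda>(j, k) x t. (c j x * cnj (c k x)) * cis ((lam j - lam k) * t)"
  let ?m = "\<lambda>(j, k) x. if lam j - lam k = 0 then c j x * cnj (c k x) else 0"
  have bc: "bounded ((\<lambda>x. cnj (c j x)) ` X)" if "j \<in> J" for j
    using assms(3)[OF that] by (auto simp: bounded_iff)
  have "trigpoly X L (\<lambda>x t. \<Sum>jk\<in>J\<times>J. ?f jk x t) (\<lambda>x. \<Sum>jk\<in>J\<times>J. ?m jk x)"
  proof (rule trigpoly_sum)
    fix jk assume "jk \<in> J \<times> J"
    then obtain j k where jk: "jk = (j, k)" "j \<in> J" "k \<in> J" by auto
    show "trigpoly X L (?f jk) (?m jk)" unfolding jk case_prod_conv
      by (intro trigpoly_cis bounded_image_mult assms bc jk)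
  qed (use assms in auto)
  moreover have "(\<Sum>jk\<in>J\<times>J. ?f jk x t) = of_real ((norm (\<Sum>j\<in>J. c j x * cis (lam j * t)))\<^sup>2)" for x t
  proof -
    have "of_real ((norm (\<Sum>j\<in>J. c j x * cis (lam j * t)))\<^sup>2)
        = (\<Sum>j\<in>J. c j x * cis (lam j * t)) * cnj (\<Sum>j\<in>J. c j x * cis (lam j * t))"
      by (metis complex_norm_square)
    also have "\<dots> = (\<Sum>(j,k)\<in>J\<times>J. (c j x * cis (lam j * t)) * cnj (c k x * cis (lam k * t)))"
      by (simp add: sum_product sum.cartesian_product)
    also have "\<dots> = (\<Sum>jk\<in>J\<times>J. ?f jk x t)"
      by (intro sum.cong) (auto simp: cis_cnj cis_mult[symmetric] ring_distribs mult_ac diff_conv_add_uminus simp del: add_uminus_conv_diff)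
    finally show ?thesis by simp
  qed
  moreover have "(\<Sum>jk\<in>J\<times>J. ?m jk x) = of_real (\<Sum>j\<in>J. (norm (c j x))\<^sup>2)" for x
  proof -
    have "(\<Sum>jk\<in>J\<times>J. ?m jk x) = (\<Sum>j\<in>J. \<Sum>k\<in>J. ?m (j, k) x)"
      unfolding sum.cartesian_product by (intro sum.cong) auto
    also have "\<dots> = (\<Sum>j\<in>J. \<Sum>k\<in>J. if k = j then c j x * cnj (c j x) else 0)"
      using assms(2) by (intro sum.cong) (auto simp: inj_on_def)
    also have "\<dots> = (\<Sum>j\<in>J. c j x * cnj (c j x))" using assms(1) by simp
    also have "\<dots> = of_real (\<Sum>j\<in>J. (norm (c j x))\<^sup>2)"
      by (simp only: of_real_sum complex_norm_square)
    finally show ?thesis .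
  qed
  ultimately show ?thesis by (simp only:)
qed

section \<open>Means over long intervals\<close>

lemma integral_cis_bound:
  assumes "l \<noteq> 0" "a \<le> b"
  shows "norm (integral {a..b} (\<lambda>t. cis (l * t))) \<le> 2 / \<bar>l\<bar>"
proof -
  have "((\<lambda>t. cis (l * t)) has_integral (cis (l * b) / (\<i> * l) - cis (l * a) / (\<i> * l))) {a..b}"
  proof (rule fundamental_theorem_of_calculus)
    fix t assume "t \<in> {a..b}"
    have "((\<lambda>z. exp (\<i> * l * z) / (\<i> * l)) has_field_derivative exp (\<i> * l * of_real t)) (at (of_real t))"
      using assms by (auto intro!: derivative_eq_intros)
    from has_vector_derivative_real_field[OF this]
    have "((\<lambda>t. exp (\<i> * l * of_real t) / (\<i> * l)) has_vector_derivative exp (\<i> * l * of_real t)) (at t within {a..b})"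
      by (rule has_vector_derivative_at_within)
    thus "((\<lambda>t. cis (l * t) / (\<i> * l)) has_vector_derivative cis (l * t)) (at t within {a..b})"
      by (simp add: cis_conv_exp mult_ac)
  qed (use assms in auto)
  hence "integral {a..b} (\<lambda>t. cis (l * t)) = cis (l * b) / (\<i> * l) - cis (l * a) / (\<i> * l)"
    by (rule integral_unique)
  also have "norm \<dots> \<le> norm (cis (l * b) / (\<i> * l)) + norm (cis (l * a) / (\<i> * l))" by (rule norm_triangle_ineq4)
  also have "\<dots> = 2 / \<bar>l\<bar>" by (simp add: norm_divide norm_mult)
  finally show ?thesis .
qed

text \<open>The integral of an oscillating term is at most \<open>2 / \<bar>l\<bar>\<close> times a
  bound for its coefficient, whatever \<open>T\<close> and \<open>x\<close> are. This is where
  bounded coefficients give uniformity.\<close>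

lemma trigpoly_mean:
  assumes "trigpoly X L f m" "e > 0"
  shows "\<forall>\<^sub>F T in at_top. \<forall>x\<in>X. norm (integral {0..T} (f x) - of_real T * m x) \<le> e * T"
  using assms
proof (induction arbitrary: e rule: trigpoly.induct)
  case (const c)
  show ?case using eventually_ge_at_top[of 0]
    by eventually_elim (use const in \<open>auto simp: scaleR_conv_of_real\<close>)
next
  case (cis c l)
  obtain B where B: "\<forall>x\<in>X. norm (c x) \<le> B" using cis(1) unfolding bounded_iff by auto
  show ?case using eventually_ge_at_top[of "max 0 (\<bar>B\<bar> * (2 / \<bar>l\<bar>) / e)"]
  proof eventually_elim
    case (elim T)
    have T: "T \<ge> 0" using elim by (meson max.boundedE)
    show ?case
    proof
      fix x assume x: "x \<in> X"
      have "norm (integral {0..T} (\<lambda>t. c x * cis (l * t))) = norm (c x) * norm (integral {0..T} (\<lambda>t. cis (l * t)))"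
        by (simp add: norm_mult)
      also have "\<dots> \<le> \<bar>B\<bar> * (2 / \<bar>l\<bar>)"
        by (intro mult_mono integral_cis_bound) (use B x cis T in \<open>auto intro: order_trans\<close>)
      also have "\<dots> = \<bar>B\<bar> * (2 / \<bar>l\<bar>) / e * e" using cis(4) by simp
      also have "\<dots> \<le> T * e" by (rule mult_right_mono) (use elim cis(4) in linarith)+
      also have "T * e = e * T" by (rule mult.commute)
      finally show "norm (integral {0..T} (\<lambda>t. c x * cis (l * t)) - of_real T * 0) \<le> e * T" by simp
    qed
  qed
next
  case (add f m g n)
  have e2: "e / 2 > 0" using add by simp
  show ?case using add.IH(1)[OF e2] add.IH(2)[OF e2]
  proof eventually_elim
    case (elim T)
    show ?case
    proof
      fix x assume x: "x \<in> X"
      have "integral {0..T} (\<lambda>t. f x t + g x t) = integral {0..T} (f x) + integral {0..T} (g x)"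
        by (intro integral_add integrable_continuous_real trigpoly_continuous[OF add(1)] trigpoly_continuous[OF add(2)])
      hence "norm (integral {0..T} (\<lambda>t. f x t + g x t) - of_real T * (m x + n x)) =
         norm ((integral {0..T} (f x) - of_real T * m x) + (integral {0..T} (g x) - of_real T * n x))"
        by (simp add: algebra_simps)
      also have "\<dots> \<le> e / 2 * T + e / 2 * T" by (rule norm_triangle_le, rule add_mono) (use elim x in blast)+
      finally show "norm (integral {0..T} (\<lambda>t. f x t + g x t) - of_real T * (m x + n x)) \<le> e * T" by (simp add: mult.commute)
    qed
  qed
qed

lemma integral_of_real_continuous:
  fixes f :: "real \<Rightarrow> real"
  assumes "continuous_on {a..b} (\<lambda>t. complex_of_real (f t))"
  shows "integral {a..b} (\<lambda>t. complex_of_real (f t)) = of_real (integral {a..b} f)"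
proof -
  have "continuous_on {a..b} (\<lambda>t. Re (complex_of_real (f t)))" by (intro continuous_intros assms)
  hence "f integrable_on {a..b}" by (intro integrable_continuous_real) simp
  from has_integral_of_real[OF integrable_integral[OF this]] show ?thesis by (rule integral_unique)
qed

lemma trigpoly_mean_real:
  fixes f :: "'x \<Rightarrow> real \<Rightarrow> real"
  assumes "trigpoly X L (\<lambda>x t. of_real (f x t)) m" "e > 0"
  shows "\<forall>\<^sub>F T in at_top. \<forall>x\<in>X. \<bar>integral {0..T} (f x) - T * Re (m x)\<bar> \<le> e * T"
  using trigpoly_mean[OF assms]
proof eventually_elim
  case (elim T)
  show ?case
  proof
    fix x assume x: "x \<in> X"
    have "integral {0..T} (\<lambda>t. complex_of_real (f x t)) = of_real (integral {0..T} (f x))"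
      by (rule integral_of_real_continuous[OF trigpoly_continuous[OF assms(1)]])
    hence "Re (integral {0..T} (\<lambda>t. complex_of_real (f x t)) - of_real T * m x) = integral {0..T} (f x) - T * Re (m x)"
      by simp
    with elim x show "\<bar>integral {0..T} (f x) - T * Re (m x)\<bar> \<le> e * T"
      by (metis abs_Re_le_cmod order_trans)
  qed
qed

text \<open>Meant for means that are known only to exist: a pointwise majorant with a known mean
  bounds them.\<close>

lemma trigpoly_mean_mono:
  fixes f g :: "'x \<Rightarrow> real \<Rightarrow> real"
  assumes f: "trigpoly X L (\<lambda>x t. of_real (f x t)) m"
    and g: "trigpoly X L' (\<lambda>x t. of_real (g x t)) n"
    and "x \<in> X" and le: "\<And>t. f x t \<le> g x t"
  shows "Re (m x) \<le> Re (n x)"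
proof (rule field_le_epsilon)
  fix e :: real assume "e > 0"
  hence e2: "e / 2 > 0" by simp
  have "\<forall>\<^sub>F T in at_top. T > 0 \<and> (\<forall>x\<in>X. \<bar>integral {0..T} (f x) - T * Re (m x)\<bar> \<le> e / 2 * T)
      \<and> (\<forall>x\<in>X. \<bar>integral {0..T} (g x) - T * Re (n x)\<bar> \<le> e / 2 * T)"
    using trigpoly_mean_real[OF f e2] trigpoly_mean_real[OF g e2] eventually_gt_at_top[of 0]
    by eventually_elim auto
  then obtain T where T: "T > 0" "\<bar>integral {0..T} (f x) - T * Re (m x)\<bar> \<le> e / 2 * T"
     "\<bar>integral {0..T} (g x) - T * Re (n x)\<bar> \<le> e / 2 * T"
    using assms(3) by (auto dest!: eventually_happens)
  have "continuous_on {0..T} (\<lambda>t. Re (of_real (f x t)))" "continuous_on {0..T} (\<lambda>t. Re (of_real (g x t)))"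
    by (intro continuous_intros trigpoly_continuous[OF f] trigpoly_continuous[OF g])+
  hence "integral {0..T} (f x) \<le> integral {0..T} (g x)"
    by (intro integral_le integrable_continuous_real le) simp_all
  with T have "T * Re (m x) \<le> T * Re (n x) + e * T" by linarith
  hence "T * Re (m x) \<le> T * (Re (n x) + e)" by (simp add: algebra_simps)
  thus "Re (m x) \<le> Re (n x) + e" using T(1) by simp
qed

section \<open>Fejer weights on the logarithms of primes\<close>

text \<open>The logarithms of the positive rationals built from primes in \<open>A\<close>, a
  subgroup of the reals. Squared moduli of Dirichlet polynomials on vertical lines have their
  frequencies here.\<close>

definition log_span :: "nat set \<Rightarrow> real set" where
  "log_span A = {ln (real u) - ln (real v) | u v. u > 0 \<and> v > 0 \<and>
     prime_factors u \<subseteq> A \<and> prime_factors v \<subseteq> A}"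

lemma log_spanI:
  assumes "u > 0" "v > 0" "prime_factors u \<subseteq> A" "prime_factors v \<subseteq> A" "l = ln (real u) - ln (real v)"
  shows "l \<in> log_span A"
  using assms unfolding log_span_def by blast

lemma log_span_ln: "u > 0 \<Longrightarrow> prime_factors u \<subseteq> A \<Longrightarrow> ln (real u) \<in> log_span A"
  by (rule log_spanI[of u 1]) auto

lemma log_span_uminus: "l \<in> log_span A \<Longrightarrow> - l \<in> log_span A"
  unfolding log_span_def by force

lemma log_span_add:
  assumes "l \<in> log_span A" "m \<in> log_span A"
  shows "l + m \<in> log_span A"
proof -
  obtain u v where uv: "u > 0" "v > 0" "prime_factors u \<subseteq> A" "prime_factors v \<subseteq> A" "l = ln (real u) - ln (real v)"
    using assms(1) unfolding log_span_def by blast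
  obtain u' v' where uv': "u' > 0" "v' > 0" "prime_factors u' \<subseteq> A" "prime_factors v' \<subseteq> A" "m = ln (real u') - ln (real v')"
    using assms(2) unfolding log_span_def by blast
  show ?thesis
    by (rule log_spanI[of "u * u'" "v * v'"]) (use uv uv' in \<open>auto simp: prime_factors_product ln_mult\<close>)
qed

lemma log_span_diff: "l \<in> log_span A \<Longrightarrow> m \<in> log_span A \<Longrightarrow> l - m \<in> log_span A"
  using log_span_add[of l A "- m"] log_span_uminus by simp

lemma log_span_int_mult:
  assumes "l \<in> log_span A"
  shows "of_int n * l \<in> log_span A"
proof -
  have nat: "real k * l \<in> log_span A" for k
  proof (induction k)
    case 0
    show ?case using log_span_ln[of 1 A] by simp
  next
    case (Suc k)
    from log_span_add[OF this assms] show ?case by (simp add: algebra_simps)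
  qed
  show ?thesis
    by (cases n rule: int_cases2) (use nat log_span_uminus[OF nat] in auto)
qed

lemma log_span_mono: "A \<subseteq> B \<Longrightarrow> log_span A \<subseteq> log_span B"
  unfolding log_span_def by blast

text \<open>Unique factorisation: equal logarithms give \<open>u * v' = u' * v\<close>. Since
  \<open>u\<close> is coprime to \<open>u'\<close> and \<open>v\<close> to \<open>v'\<close>, the
  numbers \<open>u\<close> and \<open>v\<close> divide each other.\<close>

lemma log_span_disjoint:
  assumes "A \<inter> B = {}"
  shows "log_span A \<inter> log_span B \<subseteq> {0}"
proof
  fix l assume l: "l \<in> log_span A \<inter> log_span B"
  obtain u v where uv: "u > 0" "v > 0" "prime_factors u \<subseteq> A" "prime_factors v \<subseteq> A" "l = ln (real u) - ln (real v)"
    using l unfolding log_span_def by blast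
  obtain u' v' where uv': "u' > 0" "v' > 0" "prime_factors u' \<subseteq> B" "prime_factors v' \<subseteq> B" "l = ln (real u') - ln (real v')"
    using l unfolding log_span_def by blast
  have cop: "coprime x y" if "x > 0" "y > 0" "prime_factors x \<subseteq> A" "prime_factors y \<subseteq> B" for x y :: nat
  proof (rule ccontr)
    assume "\<not> coprime x y"
    then obtain q where "prime q" "q dvd x" "q dvd y"
      by (metis coprime_iff_gcd_eq_1 gcd_dvd1 gcd_dvd2 dvd_trans prime_factor_nat)
    hence "q \<in> prime_factors x" "q \<in> prime_factors y" using that by (auto simp: prime_factors_dvd)
    thus False using that assms by blast
  qed
  have "ln (real u) + ln (real v') = ln (real u') + ln (real v)" using uv uv' by simp
  hence "ln (real (u * v')) = ln (real (u' * v))" using uv uv' by (simp add: ln_mult)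
  hence "real (u * v') = real (u' * v)" using uv uv' by (subst (asm) ln_inj_iff) auto
  hence eq: "u * v' = u' * v" by linarith
  have "u dvd v" using eq cop[OF uv(1) uv'(1) uv(3) uv'(3)] by (metis coprime_dvd_mult_right_iff dvd_triv_left)
  moreover have "v dvd u" using eq cop[OF uv(2) uv'(2) uv(4) uv'(4)] by (metis coprime_dvd_mult_left_iff dvd_triv_right)
  ultimately show "l \<in> {0}" using uv by (simp add: dvd_antisym)
qed

text \<open>The Fejer kernel of order \<open>K\<close>, moved to the point \<open>w\<close> of the
  unit circle. Dividing by \<open>K\<close> makes its mean 1 and its maximum
  \<open>K\<close>.\<close>

definition fejer_factor :: "nat \<Rightarrow> complex \<Rightarrow> real \<Rightarrow> real" where
  "fejer_factor K w u = (norm (\<Sum>k<K. (cnj w * cis u) ^ k))\<^sup>2 / real K"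

lemma cnj_cis_power: "(cnj w * cis (l * t)) ^ k = cnj w ^ k * cis ((real k * l) * t)"
  by (simp add: power_mult_distrib Complex.DeMoivre mult_ac)

lemma fejer_factor_trigpoly:
  assumes "norm w = 1" "K > 0" "p > 1" "prime_factors p \<subseteq> A"
  shows "trigpoly X (log_span A) (\<lambda>x t. of_real (fejer_factor K w (ln (real p) * t))) (\<lambda>x. 1)"
proof -
  have "inj_on (\<lambda>k. real k * ln (real p)) {..<K}" using assms by (auto simp: inj_on_def)
  moreover have "real j * ln (real p) - real k * ln (real p) \<in> log_span A" for j k
    using log_span_diff[OF log_span_int_mult[of "ln (real p)" A "int j"] log_span_int_mult[of "ln (real p)" A "int k"]]
      log_span_ln[of p A] assms by simp
  moreover have "bounded ((\<lambda>_. cnj w ^ k) ` X)" for k by (rule bounded_image_const)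
  ultimately have "trigpoly X (log_span A)
      (\<lambda>x t. of_real ((norm (\<Sum>k<K. cnj w ^ k * cis ((real k * ln (real p)) * t)))\<^sup>2))
      (\<lambda>x. of_real (\<Sum>k<K. (norm (cnj w ^ k))\<^sup>2))"
    by (intro trigpoly_norm_square) (assumption | simp)+
  from trigpoly_scale[OF this, of "\<lambda>_. of_real (1 / real K)"]
  have "trigpoly X (log_span A)
      (\<lambda>x t. of_real (1 / real K) * of_real ((norm (\<Sum>k<K. cnj w ^ k * cis ((real k * ln (real p)) * t)))\<^sup>2))
      (\<lambda>x. of_real (1 / real K) * of_real (\<Sum>k<K. (norm (cnj w ^ k))\<^sup>2))"
    by (simp only: bounded_image_const)
  thus ?thesis using assms(1,2) by (simp add: fejer_factor_def cnj_cis_power norm_power)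
qed

text \<open>With \<open>z = cnj w * cis u\<close>, the factor \<open>z - 1\<close> turns the
  geometric sum into \<open>z ^ K - 1\<close>, two unit terms with mean square 2. So the mean square
  distance to \<open>w\<close> under the kernel is exactly \<open>2 / K\<close>, and this is all the
  concentration that the argument draws on.\<close>

lemma fejer_factor_dist_trigpoly:
  assumes w: "norm w = 1" and "K > 0" "p > 1" "prime_factors p \<subseteq> A"
  shows "trigpoly (X :: 'x set) (log_span A)
     (\<lambda>x t. of_real (fejer_factor K w (ln (real p) * t) * (norm (cis (ln (real p) * t) - w))\<^sup>2)) (\<lambda>x. of_real (2 / real K))"
proof -
  \<comment> \<open>The coefficients of \<open>z ^ K - 1\<close> as a trigonometric polynomial with
    terms of index 0 and \<open>K\<close>.\<close>
  let ?c = "\<lambda>k (x::'x). if k = 0 then - 1 else cnj w ^ K :: complex"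
  have "inj_on (\<lambda>k. real k * ln (real p)) {0,K}" using assms by (auto simp: inj_on_def)
  moreover have "real j * ln (real p) - real k * ln (real p) \<in> log_span A" for j k
    using log_span_diff[OF log_span_int_mult[of "ln (real p)" A "int j"] log_span_int_mult[of "ln (real p)" A "int k"]]
      log_span_ln[of p A] assms by simp
  moreover have "bounded (?c k ` X)" for k by (rule bounded_image_const)
  ultimately have "trigpoly X (log_span A)
      (\<lambda>x t. of_real ((norm (\<Sum>k\<in>{0,K}. ?c k x * cis ((real k * ln (real p)) * t)))\<^sup>2))
      (\<lambda>x. of_real (\<Sum>k\<in>{0,K}. (norm (?c k x))\<^sup>2))"
    by (intro trigpoly_norm_square) (assumption | simp)+
  from trigpoly_scale[OF this, of "\<lambda>_. of_real (1 / real K)"]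
  have *: "trigpoly X (log_span A)
      (\<lambda>x t. of_real (1 / real K) * of_real ((norm (\<Sum>k\<in>{0,K}. ?c k x * cis ((real k * ln (real p)) * t)))\<^sup>2))
      (\<lambda>x. of_real (1 / real K) * of_real (\<Sum>k\<in>{0,K}. (norm (?c k x))\<^sup>2))"
    by (simp only: bounded_image_const)
  have m: "of_real (1 / real K) * of_real (\<Sum>k\<in>{0,K}. (norm (?c k x))\<^sup>2) = (of_real (2 / real K) :: complex)" for x
    using assms(1,2) by (simp add: norm_power)
  have f: "of_real (1 / real K) * of_real ((norm (\<Sum>k\<in>{0,K}. ?c k x * cis ((real k * ln (real p)) * t)))\<^sup>2)
      = complex_of_real (fejer_factor K w (ln (real p) * t) * (norm (cis (ln (real p) * t) - w))\<^sup>2)" for x :: "'x" and t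
  proof -
    define z where "z = cnj w * cis (ln (real p) * t)"
    have "cnj w * w = 1" using w by (metis complex_cnj_mult complex_norm_square mult.commute of_real_1 one_power2)
    hence "norm (cis (ln (real p) * t) - w) = norm (z - 1)"
      using w by (metis complex_mod_cnj mult_1 norm_mult right_diff_distrib z_def)
    hence "(norm (\<Sum>k<K. z ^ k))\<^sup>2 * (norm (cis (ln (real p) * t) - w))\<^sup>2 = (norm ((z - 1) * (\<Sum>k<K. z ^ k)))\<^sup>2"
      by (simp add: norm_mult power_mult_distrib)
    also have "(z - 1) * (\<Sum>k<K. z ^ k) = z ^ K - 1" by (simp add: power_diff_1_eq)
    also have "\<dots> = (\<Sum>k\<in>{0,K}. ?c k x * cis ((real k * ln (real p)) * t))"
      using \<open>K > 0\<close> by (simp add: z_def cnj_cis_power)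
    finally show ?thesis by (simp add: fejer_factor_def z_def)
  qed
  show ?thesis using * unfolding m f .
qed

lemma fejer_factor_nonneg: "fejer_factor K w u \<ge> 0"
  by (simp add: fejer_factor_def)

lemma fejer_factor_le:
  assumes "norm w = 1"
  shows "fejer_factor K w u \<le> real K"
proof -
  have "norm (\<Sum>k<K. (cnj w * cis u) ^ k) \<le> (\<Sum>k<K. norm ((cnj w * cis u) ^ k))" by (rule norm_sum)
  also have "\<dots> = real K" using assms by (simp add: norm_power norm_mult)
  finally have "(norm (\<Sum>k<K. (cnj w * cis u) ^ k))\<^sup>2 \<le> (real K)\<^sup>2" by (intro power_mono) auto
  thus ?thesis by (cases "K = 0") (auto simp: fejer_factor_def power2_eq_square field_simps)
qed

definition fejer_weight :: "nat \<Rightarrow> (nat \<Rightarrow> complex) \<Rightarrow> nat set \<Rightarrow> real \<Rightarrow> real" where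
  "fejer_weight K w A t = (\<Prod>p\<in>A. fejer_factor K (w p) (ln (real p) * t))"

lemma fejer_weight_nonneg: "fejer_weight K w A t \<ge> 0"
  unfolding fejer_weight_def by (intro prod_nonneg ballI fejer_factor_nonneg)

lemma fejer_weight_le:
  assumes "\<And>p. norm (w p) = 1"
  shows "fejer_weight K w A t \<le> real K ^ card A"
  unfolding fejer_weight_def
  using prod_mono[of A "\<lambda>p. fejer_factor K (w p) (ln (real p) * t)" "\<lambda>_. real K"]
    fejer_factor_nonneg fejer_factor_le[OF assms] by simp

lemma prime_factors_le_singleton: "prime p \<Longrightarrow> prime_factors p \<subseteq> {p :: nat}"
  by (simp add: prime_prime_factors)

lemma fejer_weight_trigpoly:
  assumes w: "\<And>p. norm (w p) = 1" and "K > 0" "finite A" "\<And>p. p \<in> A \<Longrightarrow> prime p"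
  shows "trigpoly X (log_span A) (\<lambda>x t. of_real (fejer_weight K w A t)) (\<lambda>x. 1)"
  using assms(3,4)
proof (induction A rule: finite_induct)
  case empty
  from trigpoly.const[OF bounded_image_const[of 1 X]] show ?case by (simp add: fejer_weight_def)
next
  case (insert p A)
  have "trigpoly X (log_span {p}) (\<lambda>x t. of_real (fejer_factor K (w p) (ln (real p) * t))) (\<lambda>x. 1)"
    by (rule fejer_factor_trigpoly) (use insert w \<open>K > 0\<close> prime_gt_1_nat prime_factors_le_singleton in auto)
  moreover have "trigpoly X (log_span A) (\<lambda>x t. of_real (fejer_weight K w A t)) (\<lambda>x. 1)"
    using insert by simp
  ultimately have "trigpoly X (log_span (insert p A))
      (\<lambda>x t. of_real (fejer_factor K (w p) (ln (real p) * t)) * of_real (fejer_weight K w A t)) (\<lambda>x. 1 * 1)"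
    by (rule trigpoly_mult_indep[OF _ _ log_span_disjoint log_span_mono log_span_mono log_span_add log_span_uminus])
       (use insert in auto)
  with insert show ?case by (simp add: fejer_weight_def)
qed

text \<open>The kernels at the other primes are independent of the one at \<open>p\<close> and have
  mean 1, so the product is as concentrated at \<open>p\<close> as the single kernel.\<close>

lemma fejer_weight_dist_trigpoly:
  assumes w: "\<And>p. norm (w p) = 1" and "K > 0" "finite A" and A: "\<And>p. p \<in> A \<Longrightarrow> prime p" and p: "p \<in> A"
  shows "trigpoly X (log_span A)
     (\<lambda>x t. of_real (fejer_weight K w A t * (norm (cis (ln (real p) * t) - w p))\<^sup>2)) (\<lambda>x. of_real (2 / real K))"
proof -
  have "trigpoly X (log_span {p})
     (\<lambda>x t. of_real (fejer_factor K (w p) (ln (real p) * t) * (norm (cis (ln (real p) * t) - w p))\<^sup>2)) (\<lambda>x. of_real (2 / real K))"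
    by (rule fejer_factor_dist_trigpoly) (use A p w \<open>K > 0\<close> prime_gt_1_nat prime_factors_le_singleton in auto)
  moreover have "trigpoly X (log_span (A - {p})) (\<lambda>x t. of_real (fejer_weight K w (A - {p}) t)) (\<lambda>x. 1)"
    by (rule fejer_weight_trigpoly) (use assms in auto)
  ultimately have "trigpoly X (log_span A)
      (\<lambda>x t. of_real (fejer_factor K (w p) (ln (real p) * t) * (norm (cis (ln (real p) * t) - w p))\<^sup>2)
         * of_real (fejer_weight K w (A - {p}) t)) (\<lambda>x. of_real (2 / real K) * 1)"
    by (rule trigpoly_mult_indep[OF _ _ log_span_disjoint log_span_mono log_span_mono log_span_add log_span_uminus])
       (use p in auto)
  moreover have "fejer_weight K w A t = fejer_factor K (w p) (ln (real p) * t) * fejer_weight K w (A - {p}) t" for t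
    unfolding fejer_weight_def by (rule prod.remove) (use assms in auto)
  ultimately show ?thesis by (simp add: mult_ac)
qed

section \<open>Euler products at prescribed phases\<close>

text \<open>On a prime this is its rank among the primes, starting at 1. The phases follow the
  powers of a root of unity in this order.\<close>

definition prime_index :: "nat \<Rightarrow> nat" where
  "prime_index n = card {q. prime q \<and> q \<le> n}"

lemma prime_index_Suc: "prime_index (Suc n) = prime_index n + (if prime (Suc n) then 1 else 0)"
proof -
  have fin: "finite {q. prime q \<and> q \<le> n}" by (rule finite_subset[of _ "{..n}"]) auto
  have "{q. prime q \<and> q \<le> Suc n} = (if prime (Suc n) then insert (Suc n) {q. prime q \<and> q \<le> n} else {q. prime q \<and> q \<le> n})"
    by (auto simp: le_Suc_eq)
  thus ?thesis unfolding prime_index_def using fin by auto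
qed

text \<open>Every prime raises the exponent by one and other integers contribute nothing, so the sum
  is a geometric progression, bounded whatever its length.\<close>

lemma prime_root_partial_sums:
  fixes w :: complex
  assumes "w \<noteq> 1" "norm w = 1"
  shows "norm (\<Sum>n=1..N. if prime n then w ^ prime_index n else 0) \<le> 2 / norm (1 - w)"
proof -
  have "(1 - w) * (\<Sum>n=1..N. if prime n then w ^ prime_index n else 0) = w - w ^ Suc (prime_index N)"
  proof (induction N)
    case 0
    have no0: "{q::nat. prime q \<and> q = 0} = {}" by auto
    show ?case by (simp add: prime_index_def no0)
  next
    case (Suc N)
    have "(1 - w) * (\<Sum>n=1..Suc N. if prime n then w ^ prime_index n else 0) =
        (w - w ^ Suc (prime_index N)) + (1 - w) * (if prime (Suc N) then w ^ prime_index (Suc N) else 0)"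
      using Suc by (simp add: ring_distribs)
    also have "\<dots> = w - w ^ Suc (prime_index (Suc N))"
      by (auto simp: prime_index_Suc algebra_simps)
    finally show ?case .
  qed
  moreover have "norm (w - w ^ Suc (prime_index N)) \<le> 2"
    using norm_triangle_ineq4[of w "w ^ Suc (prime_index N)"] assms by (simp add: norm_power norm_mult)
  ultimately have "norm (1 - w) * norm (\<Sum>n=1..N. if prime n then w ^ prime_index n else 0) \<le> 2"
    by (metis norm_mult)
  thus ?thesis using assms by (simp add: field_simps)
qed

text \<open>The difference is the integral of a derivative. Integration by parts with the functions
  0 and 1 delivers this identity.\<close>

lemma powr_Suc_diff_bound:
  assumes "Re s \<ge> r" "r \<ge> 0"
  shows "norm (complex_of_nat (Suc n) powr (- s) - of_nat (Suc (Suc n)) powr (- s)) \<le> norm s * real (Suc n) powr (- (1 + r))"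
proof -
  have "em_term (\<lambda>_. 0) 0 n s = of_nat (Suc (Suc n)) powr (- s) - of_nat (Suc n) powr (- s) + s * em_term (\<lambda>_. 1) 1 n s"
    using em_by_parts[of "\<lambda>_. 0" "\<lambda>_. 1" 0 n s] by simp
  moreover have "em_term (\<lambda>_. 0) 0 n s = 0" by (simp add: em_term_def)
  ultimately have "complex_of_nat (Suc n) powr (- s) - of_nat (Suc (Suc n)) powr (- s) = s * em_term (\<lambda>_. 1) 1 n s"
    by (simp add: algebra_simps)
  moreover have "norm (em_term (\<lambda>_. 1) 1 n s) \<le> 1 * real (Suc n) powr (- (1 + r))"
    by (rule em_term_bound) (use assms in auto)
  ultimately show ?thesis by (simp only: norm_mult mult_1) (intro mult_left_mono, auto)
qed

lemma abel_summation:
  fixes a f :: "nat \<Rightarrow> complex"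
  shows "(\<Sum>n=1..N. a n * f n) = (\<Sum>n=1..N. a n) * f (Suc N) + (\<Sum>n=1..N. (\<Sum>k=1..n. a k) * (f n - f (Suc n)))"
  by (induction N) (auto simp: algebra_simps)

text \<open>Abel summation: the coefficients have bounded partial sums, and the differences of
  consecutive \<open>n powr (- s)\<close> are summable, uniformly for bounded \<open>s\<close> with
  \<open>Re s \<ge> r > 0\<close>.\<close>

lemma prime_sum_bounded:
  fixes w :: complex
  assumes "w \<noteq> 1" "norm w = 1" "r > 0"
  shows "\<exists>C. \<forall>s N. Re s \<ge> r \<longrightarrow> norm s \<le> H \<longrightarrow>
     norm (\<Sum>n=1..N. (if prime n then w ^ prime_index n else 0) * of_nat n powr (- s)) \<le> C"
proof (intro exI allI impI)
  fix s N assume s: "Re s \<ge> r" "norm s \<le> H"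
  let ?a = "\<lambda>n. if prime n then w ^ prime_index n else 0 :: complex"
  let ?f = "\<lambda>n. complex_of_nat n powr (- s)"
  let ?B = "2 / norm (1 - w)"
  let ?g = "\<lambda>n. H * real (Suc n) powr (- (1 + r))"
  have B0: "?B \<ge> 0" by simp
  have H: "H \<ge> 0" using s(2) norm_ge_zero[of s] by linarith
  have f1: "norm (?f (Suc N)) \<le> 1"
  proof -
    have "norm (?f (Suc N)) = real (Suc N) powr (- Re s)" by (subst norm_powr_real_powr) auto
    also have "\<dots> \<le> 1" using powr_mono[of "- Re s" 0 "real (Suc N)"] s assms by simp
    finally show ?thesis .
  qed
  have "norm (\<Sum>n=1..N. (\<Sum>k=1..n. ?a k) * (?f n - ?f (Suc n))) \<le> (\<Sum>n=1..N. ?B * ?g (n - 1))"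
  proof (rule sum_norm_le)
    fix n assume n: "n \<in> {1..N}"
    then obtain k where k: "n = Suc k" by (cases n) auto
    have "norm (?f n - ?f (Suc n)) \<le> norm s * real (Suc k) powr (- (1 + r))"
      unfolding k by (rule powr_Suc_diff_bound) (use s assms in auto)
    also have "\<dots> \<le> ?g (n - 1)" unfolding k using s H by (intro mult_mono) auto
    finally show "norm ((\<Sum>k=1..n. ?a k) * (?f n - ?f (Suc n))) \<le> ?B * ?g (n - 1)"
      unfolding norm_mult using prime_root_partial_sums[OF assms(1,2), of n] B0 by (intro mult_mono) auto
  qed
  also have "\<dots> = ?B * (\<Sum>n<N. ?g n)"
    by (subst sum_distrib_left, rule sum.reindex_bij_witness[of _ Suc "\<lambda>n. n - 1"]) auto
  also have "\<dots> \<le> ?B * suminf ?g"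
    by (rule mult_left_mono[OF sum_le_suminf B0]) (use summable_Suc_powr[of "1 + r" H] assms H in auto)
  finally have 2: "norm (\<Sum>n=1..N. (\<Sum>k=1..n. ?a k) * (?f n - ?f (Suc n))) \<le> ?B * suminf ?g" .
  have 1: "norm ((\<Sum>n=1..N. ?a n) * ?f (Suc N)) \<le> ?B * 1"
    unfolding norm_mult using prime_root_partial_sums[OF assms(1,2), of N] B0 f1 by (intro mult_mono) auto
  show "norm (\<Sum>n=1..N. ?a n * ?f n) \<le> ?B * 1 + ?B * suminf ?g"
    unfolding abel_summation[of ?a ?f N] by (rule norm_triangle_le) (use 1 2 in linarith)
qed

text \<open>A truncated Euler factor against \<open>exp z\<close>. For
  \<open>norm z \<le> 3 / 4\<close> the logarithm of \<open>1 - z\<close> differs from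
  \<open>- z\<close> by at most \<open>4 * (norm z) ^ 2\<close>. Truncation at
  \<open>L \<ge> 1\<close> costs at most one more \<open>(norm z) ^ 2\<close>, which makes
  5.\<close>

lemma norm_geometric_le_exp:
  fixes z :: complex
  assumes "norm z \<le> 3 / 4" "L \<ge> 1"
  shows "norm (\<Sum>j\<le>L. z ^ j) \<le> exp (Re z + 5 * (norm z)\<^sup>2)"
proof -
  have z1: "1 - z \<noteq> 0" using assms by auto
  have "(1 - z) * (\<Sum>j\<le>L. z ^ j) = 1 - z ^ Suc L"
    using sum_gp_basic[of z L] by simp
  hence eq: "(\<Sum>j\<le>L. z ^ j) = (1 - z ^ Suc L) / (1 - z)" using z1 by (simp add: field_simps)
  have "norm (Ln (1 + - z) - - z) \<le> (norm (- z))\<^sup>2 / (1 - norm (- z))"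
    by (rule Ln_approx_linear) (use assms in simp)
  also have "\<dots> \<le> (norm z)\<^sup>2 / (1 / 4)"
    using assms by (simp, intro divide_left_mono[of "1/4" _ "(norm z)\<^sup>2", simplified]) auto
  finally have "norm (Ln (1 - z) + z) \<le> 4 * (norm z)\<^sup>2" by simp
  hence "- Re (Ln (1 - z)) - Re z \<le> 4 * (norm z)\<^sup>2"
    using abs_Re_le_cmod[of "Ln (1 - z) + z"] by simp
  hence "exp (- Re (Ln (1 - z))) \<le> exp (Re z + 4 * (norm z)\<^sup>2)" by simp
  moreover have "norm (1 - z) = exp (Re (Ln (1 - z)))" using z1 by (metis exp_Ln norm_exp_eq_Re)
  ultimately have a: "inverse (norm (1 - z)) \<le> exp (Re z + 4 * (norm z)\<^sup>2)" by (simp add: exp_minus)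
  have "norm (1 - z ^ Suc L) \<le> 1 + norm z ^ Suc L"
    using norm_triangle_ineq4[of 1 "z ^ Suc L"] by (simp add: norm_power norm_mult)
  also have "norm z ^ Suc L \<le> norm z ^ 2" using assms by (intro power_decreasing) auto
  also have "1 + norm z ^ 2 \<le> exp ((norm z)\<^sup>2)" by (rule exp_ge_add_one_self)
  finally have b: "norm (1 - z ^ Suc L) \<le> exp ((norm z)\<^sup>2)" by simp
  have "norm (\<Sum>j\<le>L. z ^ j) = norm (1 - z ^ Suc L) * inverse (norm (1 - z))"
    unfolding eq by (simp add: norm_divide field_simps)
  also have "\<dots> \<le> exp ((norm z)\<^sup>2) * exp (Re z + 4 * (norm z)\<^sup>2)"
    using a b by (intro mult_mono) auto
  also have "\<dots> = exp (Re z + 5 * (norm z)\<^sup>2)" by (simp add: exp_add[symmetric])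
  finally show ?thesis .
qed

text \<open>The extreme case is \<open>n = 2\<close> on the line \<open>Re s = 1 / 2\<close>, with
  value \<open>1 / sqrt 2\<close>. The slightly larger \<open>3 / 4\<close> serves as the common
  ratio in the estimates of Euler factors.\<close>

lemma norm_powr_minus_le:
  assumes "n \<ge> 2" "Re s \<ge> 1 / 2"
  shows "norm (complex_of_nat n powr (- s)) \<le> 3 / 4"
proof -
  have "norm (complex_of_nat n powr (- s)) = real n powr (- Re s)" using assms by (subst norm_powr_real_powr) auto
  also have "\<dots> \<le> real n powr (- (1 / 2))" using assms by (intro powr_mono) auto
  also have "\<dots> \<le> 2 powr (- (1 / 2))" using assms by (intro powr_mono2') auto
  also have "\<dots> = inverse (sqrt 2)" by (simp only: powr_minus powr_half_sqrt)
  also have "\<dots> \<le> inverse (4 / 3)"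
    by (intro le_imp_inverse_le real_le_rsqrt) (auto simp: power2_eq_square)
  finally show ?thesis by simp
qed

text \<open>The Euler product over \<open>A\<close>, with each factor truncated after exponent
  \<open>L\<close> so that it is a Dirichlet polynomial. The phases are free, so that the true
  phases of the shift can be exchanged for prescribed roots of unity.\<close>

definition euler_prod :: "nat set \<Rightarrow> nat \<Rightarrow> complex \<Rightarrow> (nat \<Rightarrow> real) \<Rightarrow> complex" where
  "euler_prod A L s \<theta> = (\<Prod>p\<in>A. \<Sum>j\<le>L. (of_nat p powr (- s) * cis (\<theta> p)) ^ j)"

text \<open>The logarithm of the modulus is at most a twisted sum over primes, bounded by
  cancellation among the phases, plus a multiple of the sum of \<open>p powr (- 2 * r)\<close>,
  which converges since \<open>2 * r > 1\<close>. Nothing depends on \<open>y\<close> or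
  \<open>L\<close>.\<close>

lemma euler_prod_bounded:
  assumes "cis u \<noteq> 1" "r > 1 / 2"
  shows "\<exists>C. \<forall>s (y::nat) (L::nat). Re s \<ge> r \<longrightarrow> norm s \<le> H \<longrightarrow> L \<ge> 1 \<longrightarrow>
     norm (euler_prod {p. prime p \<and> p \<le> y} L s (\<lambda>p. real (prime_index p) * u)) \<le> C"
proof -
  obtain C where C: "\<And>s N. Re s \<ge> r \<Longrightarrow> norm s \<le> H \<Longrightarrow>
     norm (\<Sum>n=1..N. (if prime n then cis u ^ prime_index n else 0) * of_nat n powr (- s)) \<le> C"
    using prime_sum_bounded[OF assms(1), of r H] assms(2) by auto
  let ?g = "\<lambda>n. 5 * real (Suc n) powr (- (2 * r))"
  show ?thesis
  proof (intro exI allI impI)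
    fix s and y L :: nat assume s: "Re s \<ge> r" "norm s \<le> H" and L: "L \<ge> 1"
    let ?A = "{p. prime p \<and> p \<le> y}"
    let ?z = "\<lambda>p. of_nat p powr (- s) * cis (real (prime_index p) * u)"
    have fin: "finite ?A" by (rule finite_subset[of _ "{..y}"]) auto
    have "norm (euler_prod ?A L s (\<lambda>p. real (prime_index p) * u)) = (\<Prod>p\<in>?A. norm (\<Sum>j\<le>L. ?z p ^ j))"
      by (simp add: euler_prod_def prod_norm)
    also have "\<dots> \<le> (\<Prod>p\<in>?A. exp (Re (?z p) + 5 * (norm (?z p))\<^sup>2))"
    proof (intro prod_mono conjI norm_geometric_le_exp L)
      fix p assume "p \<in> ?A"
      hence "norm (complex_of_nat p powr (- s)) \<le> 3 / 4"
        using s assms prime_ge_2_nat by (intro norm_powr_minus_le) auto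
      thus "norm (?z p) \<le> 3 / 4" by (simp add: norm_mult)
    qed auto
    also have "\<dots> = exp (\<Sum>p\<in>?A. Re (?z p) + 5 * (norm (?z p))\<^sup>2)" using fin by (simp add: exp_sum)
    also have "\<dots> \<le> exp (C + suminf ?g)"
    proof -
      have "(\<Sum>p\<in>?A. Re (?z p)) = Re (\<Sum>p\<in>?A. ?z p)" by simp
      also have "(\<Sum>p\<in>?A. ?z p) = (\<Sum>n=1..y. (if prime n then cis u ^ prime_index n else 0) * of_nat n powr (- s))"
        by (rule sum.mono_neutral_cong_left) (auto simp: Complex.DeMoivre mult.commute dest: prime_gt_0_nat)
      also have "Re \<dots> \<le> norm \<dots>" by (rule complex_Re_le_cmod)
      also have "\<dots> \<le> C" by (rule C[OF s])
      finally have 1: "(\<Sum>p\<in>?A. Re (?z p)) \<le> C" .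
      have "(\<Sum>p\<in>?A. 5 * (norm (?z p))\<^sup>2) \<le> (\<Sum>p\<in>?A. ?g (p - 1))"
      proof (rule sum_mono)
        fix p assume "p \<in> ?A"
        hence p: "p \<ge> 1" using prime_ge_1_nat by auto
        have "norm (?z p) = real p powr (- Re s)" using p by (simp add: norm_mult norm_powr_real_powr)
        also have "\<dots> \<le> real p powr (- r)" using p s by (intro powr_mono) auto
        finally have "(norm (?z p))\<^sup>2 \<le> (real p powr (- r))\<^sup>2" by (intro power_mono) auto
        also have "\<dots> = real p powr (- (2 * r))" using p by (simp add: powr_power)
        finally show "5 * (norm (?z p))\<^sup>2 \<le> ?g (p - 1)" using p by simp
      qed
      also have "\<dots> = (\<Sum>n\<in>(\<lambda>p. p - 1) ` ?A. ?g n)"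
        by (subst sum.reindex) (auto simp: inj_on_def dest!: prime_gt_1_nat)
      also have "\<dots> \<le> suminf ?g"
        by (rule sum_le_suminf) (use summable_Suc_powr[of "2 * r" 5] assms fin in auto)
      finally show ?thesis using 1 by (simp add: sum.distrib)
    qed
    finally show "norm (euler_prod ?A L s (\<lambda>p. real (prime_index p) * u)) \<le> exp (C + suminf ?g)" .
  qed
qed

text \<open>Here it matters that \<open>a\<close> and \<open>b\<close> are integers: integer powers
  are Lipschitz on the unit circle, so closeness of \<open>p\<close> to the power \<open>i t\<close>
  to a root of unity passes to its \<open>a\<close>-th and \<open>b\<close>-th powers. Conjugation
  handles negative exponents.\<close>

lemma norm_cis_int_mult_diff: "norm (cis (of_int a * u) - cis (of_int a * v)) \<le> \<bar>of_int a\<bar> * norm (cis u - cis v)"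
proof -
  have nat: "norm (cis (real k * u) - cis (real k * v)) \<le> real k * norm (cis u - cis v)" for k
    using norm_power_diff[of "cis u" "cis v" k] by (simp add: Complex.DeMoivre)
  show ?thesis
  proof (cases a rule: int_cases2)
    case (nonneg k)
    thus ?thesis using nat[of k] by simp
  next
    case (nonpos k)
    have "norm (cis (real k * u) - cis (real k * v)) = norm (cnj (cis (real k * u) - cis (real k * v)))"
      by (rule complex_mod_cnj[symmetric])
    also have "\<dots> = norm (cis (- (real k * u)) - cis (- (real k * v)))" by (simp add: cis_cnj)
    finally show ?thesis using nat[of k] nonpos by simp
  qed
qed

text \<open>Termwise comparison with ratio \<open>3 / 4\<close>: the series of
  \<open>(3/4) ^ j\<close> has sum 4 and that of \<open>j * (3/4) ^ j\<close> has sum 12. The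
  inductions use the closed forms of the partial sums.\<close>

lemma geometric_sum_bounds:
  fixes u :: complex
  assumes u: "norm u \<le> 3 / 4" and x: "norm x = 1" and y: "norm y = 1"
  shows "norm (\<Sum>j\<le>L. (u * x) ^ j) \<le> 4"
    and "norm ((\<Sum>j\<le>L. (u * x) ^ j) - (\<Sum>j\<le>L. (u * y) ^ j)) \<le> 12 * norm (x - y)"
proof -
  have "(\<Sum>j\<le>L. (3/4::real) ^ j) \<le> 4 - 3 * (3/4) ^ L"
    by (induction L) auto
  moreover have "3 * (3/4::real) ^ L \<ge> 0" by simp
  ultimately have g: "(\<Sum>j\<le>L. (3/4::real) ^ j) \<le> 4" by linarith
  have "norm (\<Sum>j\<le>L. (u * x) ^ j) \<le> (\<Sum>j\<le>L. (3/4) ^ j)"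
    by (rule sum_norm_le) (use u x in \<open>auto simp: norm_power norm_mult intro: power_mono\<close>)
  thus "norm (\<Sum>j\<le>L. (u * x) ^ j) \<le> 4" using g by linarith
  have "(\<Sum>j\<le>L. real j * (3/4::real) ^ j) \<le> 12 - (3 * real L + 12) * (3/4) ^ L"
  proof (induction L)
    case (Suc L)
    have "(\<Sum>j\<le>Suc L. real j * (3/4::real) ^ j) \<le> 12 - (3 * real L + 12) * (3/4) ^ L + real (Suc L) * (3/4) ^ Suc L"
      using Suc by simp
    also have "\<dots> = 12 - (3 * real (Suc L) + 12) * (3/4) ^ Suc L"
      by (simp only: power_Suc of_nat_Suc) algebra
    finally show ?case .
  qed simp
  moreover have "(3 * real L + 12) * (3/4) ^ L \<ge> 0" by simp
  ultimately have g: "(\<Sum>j\<le>L. real j * (3/4::real) ^ j) \<le> 12" by linarith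
  have "norm ((\<Sum>j\<le>L. (u * x) ^ j) - (\<Sum>j\<le>L. (u * y) ^ j)) \<le> (\<Sum>j\<le>L. real j * (3/4) ^ j * norm (x - y))"
    unfolding sum_subtractf[symmetric]
  proof (rule sum_norm_le)
    fix j
    have "norm ((u * x) ^ j - (u * y) ^ j) = norm u ^ j * norm (x ^ j - y ^ j)"
      by (simp add: power_mult_distrib norm_mult norm_power right_diff_distrib[symmetric])
    also have "\<dots> \<le> (3/4) ^ j * (real j * norm (x - y))"
      using norm_power_diff[of x y j] u x y by (intro mult_mono power_mono) auto
    finally show "norm ((u * x) ^ j - (u * y) ^ j) \<le> real j * (3/4) ^ j * norm (x - y)" by (simp add: mult_ac)
  qed
  also have "\<dots> = (\<Sum>j\<le>L. real j * (3/4) ^ j) * norm (x - y)" by (simp only: sum_distrib_right)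
  also have "\<dots> \<le> 12 * norm (x - y)" using g by (intro mult_right_mono) auto
  finally show "norm ((\<Sum>j\<le>L. (u * x) ^ j) - (\<Sum>j\<le>L. (u * y) ^ j)) \<le> 12 * norm (x - y)" .
qed

text \<open>Divided by 4, every factor lies in the unit disc, where the difference of two products
  is at most the sum of the differences of the factors; 3 is \<open>12 / 4\<close>. The exponential
  constant is harmless because the kernel order is chosen after \<open>A\<close>.\<close>

lemma euler_prod_lipschitz:
  assumes A: "finite A" "\<And>p. p \<in> A \<Longrightarrow> prime p" and s: "Re s \<ge> 1 / 2"
  shows "norm (euler_prod A L s \<theta> - euler_prod A L s \<phi>) \<le> 3 * 4 ^ card A * (\<Sum>p\<in>A. norm (cis (\<theta> p) - cis (\<phi> p)))"
proof -
  let ?f = "\<lambda>\<theta> p. (\<Sum>j\<le>L. (of_nat p powr (- s) * cis (\<theta> p)) ^ j) / (4::complex)"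
  have u: "norm (complex_of_nat p powr (- s)) \<le> 3 / 4" if "p \<in> A" for p
    using A(2)[OF that] s prime_ge_2_nat by (intro norm_powr_minus_le) auto
  have eq: "euler_prod A L s \<theta> = 4 ^ card A * (\<Prod>p\<in>A. ?f \<theta> p)" for \<theta>
    unfolding euler_prod_def by (simp add: prod_dividef)
  have "norm ((\<Prod>p\<in>A. ?f \<theta> p) - (\<Prod>p\<in>A. ?f \<phi> p)) \<le> (\<Sum>p\<in>A. norm (?f \<theta> p - ?f \<phi> p))"
    by (rule norm_prod_diff)
       (use geometric_sum_bounds(1)[OF u norm_cis norm_cis] in \<open>simp_all add: norm_divide\<close>)
  also have "\<dots> \<le> (\<Sum>p\<in>A. 3 * norm (cis (\<theta> p) - cis (\<phi> p)))"
  proof (rule sum_mono)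
    fix p assume "p \<in> A"
    from geometric_sum_bounds(2)[OF u[OF this], of "cis (\<theta> p)" "cis (\<phi> p)" L]
    show "norm (?f \<theta> p - ?f \<phi> p) \<le> 3 * norm (cis (\<theta> p) - cis (\<phi> p))"
      by (simp add: diff_divide_distrib[symmetric] norm_divide)
  qed
  finally have "norm ((\<Prod>p\<in>A. ?f \<theta> p) - (\<Prod>p\<in>A. ?f \<phi> p)) \<le> 3 * (\<Sum>p\<in>A. norm (cis (\<theta> p) - cis (\<phi> p)))"
    by (simp add: sum_distrib_left)
  moreover have "norm (euler_prod A L s \<theta> - euler_prod A L s \<phi>) = 4 ^ card A * norm ((\<Prod>p\<in>A. ?f \<theta> p) - (\<Prod>p\<in>A. ?f \<phi> p))"
    unfolding eq by (simp only: right_diff_distrib[symmetric] norm_mult norm_power norm_numeral)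
  ultimately show ?thesis by simp
qed

lemma euler_prod_lipschitz_square:
  assumes A: "finite A" "\<And>p. p \<in> A \<Longrightarrow> prime p" and s: "Re s \<ge> 1 / 2"
  shows "(norm (euler_prod A L s \<theta> - euler_prod A L s \<phi>))\<^sup>2 \<le>
     (3 * 4 ^ card A)\<^sup>2 * real (card A) * (\<Sum>p\<in>A. (norm (cis (\<theta> p) - cis (\<phi> p)))\<^sup>2)"
proof -
  have "(norm (euler_prod A L s \<theta> - euler_prod A L s \<phi>))\<^sup>2 \<le>
      (3 * 4 ^ card A * (\<Sum>p\<in>A. norm (cis (\<theta> p) - cis (\<phi> p))))\<^sup>2"
    by (intro power_mono euler_prod_lipschitz assms) auto
  also have "\<dots> = (3 * 4 ^ card A)\<^sup>2 * (\<Sum>p\<in>A. norm (cis (\<theta> p) - cis (\<phi> p)))\<^sup>2" by (rule power_mult_distrib)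
  also have "\<dots> \<le> (3 * 4 ^ card A)\<^sup>2 * (real (card A) * (\<Sum>p\<in>A. (norm (cis (\<theta> p) - cis (\<phi> p)))\<^sup>2))"
    using sum_squared_le_sum_of_squares[of "\<lambda>p. norm (cis (\<theta> p) - cis (\<phi> p))" A]
    by (intro mult_left_mono) (auto simp: mult.commute)
  finally show ?thesis by (simp add: mult_ac)
qed

section \<open>Smooth and rough parts\<close>

lemma of_nat_mult_powr:
  assumes "m > 0" "n > 0"
  shows "complex_of_nat (m * n) powr z = of_nat m powr z * of_nat n powr z"
  using powr_times_real[of "of_nat m" "of_nat n" z] assms by simp

lemma of_nat_power_powr:
  assumes "m > 0"
  shows "complex_of_nat (m ^ k) powr z = (of_nat m powr z) ^ k"
proof (induction k)
  case (Suc k)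
  thus ?case using of_nat_mult_powr[of m "m ^ k" z] assms by simp
qed simp

lemma coprime_smooth_rough:
  fixes k l :: nat
  assumes "k > 0" "prime_factors k \<subseteq> A" "\<And>p. p \<in> A \<Longrightarrow> \<not> p dvd l"
  shows "coprime k l"
proof (rule ccontr)
  assume "\<not> coprime k l"
  then obtain q where "prime q" "q dvd k" "q dvd l"
    by (metis coprime_iff_gcd_eq_1 gcd_dvd1 gcd_dvd2 dvd_trans prime_factor_nat)
  thus False using assms by (auto simp: prime_factors_dvd subset_iff)
qed

lemma smooth_rough_unique:
  fixes k l :: nat
  assumes "k > 0" "prime_factors k \<subseteq> A" "k' > 0" "prime_factors k' \<subseteq> A"
    and "\<And>p. p \<in> A \<Longrightarrow> \<not> p dvd l" "\<And>p. p \<in> A \<Longrightarrow> \<not> p dvd l'" and eq: "k * l = k' * l'"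
  shows "k = k' \<and> l = l'"
proof -
  have "k dvd k'" using coprime_smooth_rough[OF assms(1,2), of l'] assms(6) eq
    by (metis coprime_dvd_mult_left_iff dvd_triv_left)
  moreover have "k' dvd k" using coprime_smooth_rough[OF assms(3,4), of l] assms(5) eq
    by (metis coprime_dvd_mult_left_iff dvd_triv_left)
  ultimately have "k = k'" by (rule dvd_antisym)
  thus ?thesis using eq assms by simp
qed

text \<open>Expanding the product yields every integer with primes in \<open>A\<close> and exponents
  at most \<open>L\<close> exactly once. Because of \<open>M \<le> L\<close> these include the
  \<open>A\<close>-part of every \<open>n \<le> M\<close>.\<close>

lemma smooth_sum_eq_prod:
  assumes "finite A" "\<And>p. p \<in> A \<Longrightarrow> prime p" "M \<le> L"
  shows "\<exists>S. finite S \<and> (\<forall>k\<in>S. k > 0 \<and> prime_factors k \<subseteq> A) \<and>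
     (\<forall>n\<in>{1..M}. \<exists>k\<in>S. \<exists>l. n = k * l \<and> (\<forall>p\<in>A. \<not> p dvd l)) \<and>
     (\<forall>z. (\<Sum>k\<in>S. complex_of_nat k powr z) = (\<Prod>p\<in>A. \<Sum>j\<le>L. (of_nat p powr z) ^ j))"
  using assms(1,2)
proof (induction A rule: finite_induct)
  case empty
  show ?case by (rule exI[of _ "{1}"]) auto
next
  case (insert p A)
  then obtain S where S: "finite S" "\<And>k. k \<in> S \<Longrightarrow> k > 0" "\<And>k. k \<in> S \<Longrightarrow> prime_factors k \<subseteq> A"
    "\<And>n. n \<in> {1..M} \<Longrightarrow> \<exists>k\<in>S. \<exists>l. n = k * l \<and> (\<forall>p\<in>A. \<not> p dvd l)"
    "\<And>z. (\<Sum>k\<in>S. complex_of_nat k powr z) = (\<Prod>p\<in>A. \<Sum>j\<le>L. (of_nat p powr z) ^ j)"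
    by (auto simp: Ball_def)
  have p: "prime p" using insert by simp
  hence p0: "p > 0" by (rule prime_gt_0_nat)
  have ndvd: "\<not> p dvd k" if "k \<in> S" for k
    using S(2,3)[OF that] p insert(2) by (auto simp: prime_factors_dvd subset_iff)
  have pf: "prime_factors (p ^ j) \<subseteq> {p}" for j
    using p by (auto simp: prime_factors_dvd dest: prime_dvd_power primes_dvd_imp_eq)
  let ?h = "\<lambda>(j, k). p ^ j * k"
  have inj: "inj_on ?h ({..L} \<times> S)"
  proof (rule inj_onI, clarify)
    fix j k j' k' assume kk: "k \<in> S" "k' \<in> S" and eq: "p ^ j * k = p ^ j' * k'"
    have "p ^ j = p ^ j' \<and> k = k'"
      by (rule smooth_rough_unique[where A = "{p}"]) (use p0 ndvd kk eq pf in auto)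
    thus "j = j' \<and> k = k'" using prime_gt_1_nat[OF p] power_inject_exp by blast
  qed
  show ?case
  proof (rule exI[of _ "?h ` ({..L} \<times> S)"], intro conjI ballI allI)
    show "finite (?h ` ({..L} \<times> S))" using S(1) by auto
  next
    fix n assume "n \<in> ?h ` ({..L} \<times> S)"
    then obtain j k where n: "n = p ^ j * k" "k \<in> S" by auto
    show "n > 0" using n p0 S(2) by simp
    show "prime_factors n \<subseteq> insert p A"
    proof
      fix q assume "q \<in> prime_factors n"
      hence "prime q" "q dvd p ^ j * k" using n by (auto simp: prime_factors_dvd)
      hence "q = p \<or> q dvd k" using p by (metis prime_dvd_mult_iff prime_dvd_power primes_dvd_imp_eq)
      thus "q \<in> insert p A" using S(2,3)[OF n(2)] \<open>prime q\<close> by (auto simp: prime_factors_dvd)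
    qed
  next
    fix n assume n: "n \<in> {1..M}"
    then obtain k l where kl: "k \<in> S" "n = k * l" "\<And>q. q \<in> A \<Longrightarrow> \<not> q dvd l" using S(4) by blast
    have l: "l > 0" "l \<le> M" using kl n S(2)[OF kl(1)] by (auto intro!: Nat.gr0I elim: order_trans[rotated])
    obtain l' where l': "l = p ^ multiplicity p l * l'" "\<not> p dvd l'"
      using multiplicity_decompose'[of l p] l p by (metis not_prime_unit less_irrefl)
    \<comment> \<open>An exponent is smaller than the corresponding power of 2, hence smaller than
      \<open>l \<le> M \<le> L\<close>.\<close>
    have "multiplicity p l < 2 ^ multiplicity p l" by simp
    also have "\<dots> \<le> p ^ multiplicity p l" using prime_ge_2_nat[OF p] by (rule power_mono) simp
    also have "\<dots> \<le> l" using l(1) multiplicity_dvd by (metis dvd_imp_le)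
    finally have "multiplicity p l \<le> L" using l(2) assms(3) by simp
    hence "p ^ multiplicity p l * k \<in> ?h ` ({..L} \<times> S)" using kl(1) by auto
    moreover have "n = (p ^ multiplicity p l * k) * l'" using kl(2) l'(1) by simp
    moreover have "\<forall>q\<in>insert p A. \<not> q dvd l'" using l' kl(3) by (metis dvd_mult insert_iff)
    ultimately show "\<exists>k\<in>?h ` ({..L} \<times> S). \<exists>l. n = k * l \<and> (\<forall>p\<in>insert p A. \<not> p dvd l)" by blast
  next
    fix z
    have "(\<Sum>k\<in>?h ` ({..L} \<times> S). complex_of_nat k powr z) = (\<Sum>(j,k)\<in>{..L} \<times> S. complex_of_nat (p ^ j * k) powr z)"
      by (subst sum.reindex[OF inj]) (simp add: case_prod_unfold)
    also have "\<dots> = (\<Sum>(j,k)\<in>{..L} \<times> S. (of_nat p powr z) ^ j * of_nat k powr z)"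
    proof (intro sum.cong refl, clarify)
      fix j k assume "k \<in> S"
      show "complex_of_nat (p ^ j * k) powr z = (of_nat p powr z) ^ j * of_nat k powr z"
        by (subst of_nat_mult_powr) (use p0 S(2)[OF \<open>k \<in> S\<close>] in \<open>simp_all only: of_nat_power_powr, simp_all\<close>)
    qed
    also have "\<dots> = (\<Sum>j\<le>L. (of_nat p powr z) ^ j) * (\<Sum>k\<in>S. of_nat k powr z)"
      by (simp add: sum_product sum.cartesian_product)
    also have "\<dots> = (\<Prod>p\<in>insert p A. \<Sum>j\<le>L. (of_nat p powr z) ^ j)"
      using insert(1,2) S(5) by simp
    finally show "(\<Sum>k\<in>?h ` ({..L} \<times> S). complex_of_nat k powr z) = (\<Prod>p\<in>insert p A. \<Sum>j\<le>L. (of_nat p powr z) ^ j)" .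
  qed
qed

text \<open>The factorisation into a part over \<open>A\<close> and a part free of \<open>A\<close>
  is unique, so the product is a Dirichlet polynomial with all coefficients 1. Its support
  \<open>S\<close> contains \<open>{1..M}\<close> but is in general not an interval.\<close>

lemma smooth_rough_sum:
  assumes A: "finite A" "\<And>p. p \<in> A \<Longrightarrow> prime p" and "M \<le> L"
  shows "\<exists>S. finite S \<and> 0 \<notin> S \<and> {1..M} \<subseteq> S \<and>
     (\<forall>z. (\<Sum>n\<in>S. complex_of_nat n powr z) =
        (\<Prod>p\<in>A. \<Sum>j\<le>L. (of_nat p powr z) ^ j) * (\<Sum>l\<in>{l\<in>{1..M}. \<forall>p\<in>A. \<not> p dvd l}. of_nat l powr z))"
proof -
  obtain S where S: "finite S" "\<And>k. k \<in> S \<Longrightarrow> k > 0" "\<And>k. k \<in> S \<Longrightarrow> prime_factors k \<subseteq> A"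
    "\<And>n. n \<in> {1..M} \<Longrightarrow> \<exists>k\<in>S. \<exists>l. n = k * l \<and> (\<forall>p\<in>A. \<not> p dvd l)"
    "\<And>z. (\<Sum>k\<in>S. complex_of_nat k powr z) = (\<Prod>p\<in>A. \<Sum>j\<le>L. (of_nat p powr z) ^ j)"
    using smooth_sum_eq_prod[OF assms] by (auto simp: Ball_def)
  define R where "R = {l\<in>{1..M}. \<forall>p\<in>A. \<not> p dvd l}"
  let ?h = "\<lambda>(k, l). k * l :: nat"
  have inj: "inj_on ?h (S \<times> R)"
  proof (rule inj_onI, clarify)
    fix k l k' l' assume kl: "k \<in> S" "l \<in> R" "k' \<in> S" "l' \<in> R" and eq: "k * l = k' * l'"
    show "k = k' \<and> l = l'"
      by (rule smooth_rough_unique[where A = A]) (use kl eq S(2,3) in \<open>auto simp: R_def\<close>)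
  qed
  show ?thesis
  proof (rule exI[of _ "?h ` (S \<times> R)"], intro conjI allI, unfold R_def[symmetric])
    show "finite (?h ` (S \<times> R))" using S(1) by (auto simp: R_def)
    show "0 \<notin> ?h ` (S \<times> R)" using S(2) by (force simp: R_def)
    show "{1..M} \<subseteq> ?h ` (S \<times> R)"
    proof
      fix n assume n: "n \<in> {1..M}"
      then obtain k l where kl: "k \<in> S" "n = k * l" "\<forall>q\<in>A. \<not> q dvd l" using S(4) by blast
      have l: "l > 0" using kl n by (auto intro!: Nat.gr0I)
      have "l \<le> n" using kl S(2)[OF kl(1)] by simp
      hence "l \<in> R" using l kl(3) n by (auto simp: R_def)
      thus "n \<in> ?h ` (S \<times> R)" using kl by force
    qed
  next
    fix z
    have "(\<Sum>n\<in>?h ` (S \<times> R). complex_of_nat n powr z) = (\<Sum>(k,l)\<in>S \<times> R. complex_of_nat (k * l) powr z)"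
      by (subst sum.reindex[OF inj]) (simp add: case_prod_unfold)
    also have "\<dots> = (\<Sum>(k,l)\<in>S \<times> R. of_nat k powr z * of_nat l powr z)"
    proof (intro sum.cong refl, clarify)
      fix k l assume "k \<in> S" "l \<in> R"
      thus "complex_of_nat (k * l) powr z = of_nat k powr z * of_nat l powr z"
        by (intro of_nat_mult_powr) (use S(2) in \<open>auto simp: R_def\<close>)
    qed
    also have "\<dots> = (\<Sum>k\<in>S. of_nat k powr z) * (\<Sum>l\<in>R. of_nat l powr z)"
      by (simp add: sum_product sum.cartesian_product)
    finally show "(\<Sum>n\<in>?h ` (S \<times> R). complex_of_nat n powr z) =
       (\<Prod>p\<in>A. \<Sum>j\<le>L. (of_nat p powr z) ^ j) * (\<Sum>l\<in>R. of_nat l powr z)" by (simp only: S(5))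
  qed
qed

section \<open>The weighted mean square of Euler products\<close>

lemma power2_norm_add_le:
  fixes x y :: complex
  shows "(norm (x + y))\<^sup>2 \<le> 2 * (norm x)\<^sup>2 + 2 * (norm y)\<^sup>2"
proof -
  have "(norm (x + y))\<^sup>2 \<le> (norm x + norm y)\<^sup>2" by (intro power_mono norm_triangle_ineq) auto
  also have "\<dots> \<le> 2 * (norm x)\<^sup>2 + 2 * (norm y)\<^sup>2"
    using sum_squares_bound[of "norm x" "norm y"] by (simp add: power2_sum)
  finally show ?thesis .
qed

lemma power2_add3_le:
  fixes x y z :: real
  shows "(x + y + z)\<^sup>2 \<le> 3 * (x\<^sup>2 + y\<^sup>2 + z\<^sup>2)"
  using sum_squares_bound[of x y] sum_squares_bound[of x z] sum_squares_bound[of y z]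
  by (simp add: power2_eq_square algebra_simps)

lemma power2_norm_add3_le:
  fixes x y z :: complex
  shows "(norm (x + y + z))\<^sup>2 \<le> 3 * ((norm x)\<^sup>2 + (norm y)\<^sup>2 + (norm z)\<^sup>2)"
proof -
  have "norm (x + y + z) \<le> norm x + norm y + norm z" by (meson norm_triangle_le norm_triangle_ineq add_right_mono order_trans)
  hence "(norm (x + y + z))\<^sup>2 \<le> (norm x + norm y + norm z)\<^sup>2" by (intro power_mono) auto
  thus ?thesis using power2_add3_le order_trans by blast
qed

lemma powr_tail_small:
  assumes "r > 1" "e > 0"
  shows "\<exists>y. \<forall>J. finite J \<longrightarrow> (\<forall>n\<in>J. n > y) \<longrightarrow> (\<Sum>n\<in>J. real n powr (- r)) \<le> e"
proof -
  let ?g = "\<lambda>n. 1 * real (Suc n) powr (- r)"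
  have sg: "summable ?g" by (rule summable_Suc_powr) (use assms in simp)
  obtain y where y: "\<And>n. n \<ge> y \<Longrightarrow> norm (\<Sum>i. ?g (i + n)) < e"
    using suminf_exist_split[OF assms(2) sg] by blast
  show ?thesis
  proof (rule exI[of _ y], intro allI impI)
    fix J assume J: "finite J" and gt: "\<forall>n\<in>J. n > y"
    have "(\<Sum>l\<in>J. real l powr (- r)) = (\<Sum>n\<in>(\<lambda>l. l - Suc y) ` J. ?g (n + y))"
    proof (subst sum.reindex)
      show "inj_on (\<lambda>l. l - Suc y) J" using gt by (intro inj_on_diff_nat Suc_leI) auto
      have "Suc (l - Suc y + y) = l" if "l \<in> J" for l using gt that by auto
      thus "(\<Sum>l\<in>J. real l powr (- r)) = sum ((\<lambda>n. ?g (n + y)) \<circ> (\<lambda>l. l - Suc y)) J"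
        by (intro sum.cong) (simp_all del: of_nat_Suc)
    qed
    also have "\<dots> \<le> (\<Sum>n. ?g (n + y))"
      by (rule sum_le_suminf) (use summable_ignore_initial_segment[OF sg, of y] J in auto)
    also have "\<dots> \<le> e" using y[of y] by (simp add: abs_less_iff)
    finally show "(\<Sum>l\<in>J. real l powr (- r)) \<le> e" .
  qed
qed

lemma of_nat_powr_shift:
  assumes "n > 0"
  shows "complex_of_nat n powr (- (s + \<i> * of_real (c * t))) = of_nat n powr (- s) * cis (- c * (ln (real n) * t))"
proof -
  have "complex_of_nat n powr (- (s + \<i> * of_real (c * t))) = exp (- s * of_real (ln (real n)) + \<i> * of_real (- c * (ln (real n) * t)))"
    using assms by (simp add: powr_def Ln_of_nat algebra_simps)
  also have "\<dots> = exp (- s * of_real (ln (real n))) * cis (- c * (ln (real n) * t))"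
    by (simp only: exp_add cis_conv_exp)
  also have "exp (- s * of_real (ln (real n))) = of_nat n powr (- s)" using assms by (simp add: powr_def Ln_of_nat)
  finally show ?thesis .
qed

lemma norm_of_nat_powr_le:
  assumes "n > 0" "Re s \<ge> r"
  shows "norm (complex_of_nat n powr (- s)) \<le> real n powr (- r)"
proof -
  have "norm (complex_of_nat n powr (- s)) = real n powr (- Re s)" using assms by (subst norm_powr_real_powr) auto
  also have "\<dots> \<le> real n powr (- r)" using assms by (intro powr_mono) auto
  finally show ?thesis .
qed

lemma bounded_of_nat_powr_power:
  assumes "n > 0" "\<And>s. s \<in> X \<Longrightarrow> Re s \<ge> 0"
  shows "bounded ((\<lambda>s. (complex_of_nat n powr (- s)) ^ j) ` X)"
proof -
  have "norm ((complex_of_nat n powr (- s)) ^ j) \<le> 1" if "s \<in> X" for s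
    using norm_of_nat_powr_le[of n 0 s] assms that by (simp add: norm_power power_le_one)
  thus ?thesis by (auto simp: bounded_iff)
qed

lemma euler_prod_trigpoly:
  assumes "finite A" "\<And>p. p \<in> A \<Longrightarrow> prime p" and X: "\<And>s. s \<in> X \<Longrightarrow> Re s \<ge> 0"
    and "A \<subseteq> B"
  shows "\<exists>m. trigpoly X (log_span B) (\<lambda>s t. euler_prod A L s (\<lambda>p. - of_int c * (ln (real p) * t))) m"
  using assms(1,2,4)
proof (induction A rule: finite_induct)
  case empty
  show ?case using trigpoly.const[OF bounded_image_const[of 1 X]] by (auto simp: euler_prod_def)
next
  case (insert p A)
  have p: "p > 0" "prime p" using insert.prems prime_gt_0_nat by auto
  let ?l = "\<lambda>j. real_of_int (int j * (- c)) * ln (real p)"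
  have "ln (real p) \<in> log_span B" using log_span_ln[of p B] p insert.prems by (auto simp: prime_prime_factors)
  hence l: "?l j \<in> log_span B" for j by (rule log_span_int_mult)
  have "trigpoly X (log_span B) (\<lambda>s t. \<Sum>j\<le>L. (of_nat p powr (- s)) ^ j * cis (?l j * t))
     (\<lambda>s. \<Sum>j\<le>L. if ?l j = 0 then (of_nat p powr (- s)) ^ j else 0)"
    by (intro trigpoly_sum trigpoly_cis l bounded_of_nat_powr_power p X) auto
  moreover have "(of_nat p powr (- s)) ^ j * cis (?l j * t) = (of_nat p powr (- s) * cis (- of_int c * (ln (real p) * t))) ^ j" for s t j
    by (simp add: power_mult_distrib Complex.DeMoivre mult_ac)
  ultimately have 1: "trigpoly X (log_span B) (\<lambda>s t. \<Sum>j\<le>L. (of_nat p powr (- s) * cis (- of_int c * (ln (real p) * t))) ^ j)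
     (\<lambda>s. \<Sum>j\<le>L. if ?l j = 0 then (of_nat p powr (- s)) ^ j else 0)"
    by simp
  obtain m where 2: "trigpoly X (log_span B) (\<lambda>s t. euler_prod A L s (\<lambda>p. - of_int c * (ln (real p) * t))) m"
    using insert by auto
  from trigpoly_mult[OF 1 2 log_span_add] show ?case using insert(1,2) by (simp add: euler_prod_def)
qed

text \<open>Weight and product involve the same primes and are not independent, so the mean is
  asserted to exist without a formula.\<close>

lemma weighted_euler_prod_trigpoly:
  assumes w: "\<And>p. norm (w p) = 1" and "K > 0" and A: "finite A" "\<And>p. p \<in> A \<Longrightarrow> prime p" and X: "\<And>s. s \<in> X \<Longrightarrow> Re s \<ge> 0"
  shows "\<exists>m. trigpoly X (log_span A) (\<lambda>s t. of_real (fejer_weight K w A t *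
            (norm (euler_prod A L s (\<lambda>p. - of_int c * (ln (real p) * t))))\<^sup>2)) m"
proof -
  let ?E = "\<lambda>s t. euler_prod A L s (\<lambda>p. - of_int c * (ln (real p) * t))"
  obtain m where m: "trigpoly X (log_span A) ?E m" using euler_prod_trigpoly[OF A X order_refl] by blast
  obtain m' where m': "trigpoly X (log_span A) (\<lambda>s t. ?E s t * cnj (?E s t)) m'"
    using trigpoly_mult[OF m trigpoly_cnj[OF m log_span_uminus] log_span_add] by auto
  have W: "trigpoly X (log_span A) (\<lambda>s t. of_real (fejer_weight K w A t)) (\<lambda>x. 1)"
    by (rule fejer_weight_trigpoly[OF w \<open>K > 0\<close> A])
  from trigpoly_mult[OF W m' log_span_add] show ?thesis
    by (simp only: of_real_mult complex_norm_square)
qed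

text \<open>Since \<open>a\<close> and \<open>b\<close> agree modulo
  \<open>\<bar>a - b\<bar>\<close>, the powers with exponents \<open>- a\<close> and
  \<open>- b\<close> of a root of unity of that order coincide. Both Euler products therefore take
  one common value at the prescribed phases.\<close>

lemma cis_root_phase_eq:
  fixes a b :: int
  assumes "a \<noteq> b"
  shows "cis (- of_int a * (real k * (2 * pi / \<bar>of_int (a - b)\<bar>))) = cis (- of_int b * (real k * (2 * pi / \<bar>of_int (a - b)\<bar>)))"
proof -
  let ?v = "2 * pi / \<bar>of_int (a - b) :: real\<bar>"
  have "of_int (a - b) * ?v = of_int (sgn (a - b)) * (2 * pi)"
    using assms by (auto simp: sgn_if abs_if field_simps)
  hence *: "real k * (of_int (a - b) * ?v) = 2 * pi * of_int (int k * sgn (a - b))" by (simp add: mult_ac)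
  have "- of_int b * (real k * u) = - of_int a * (real k * u) + real k * (of_int (a - b) * u)" for u :: real
    by (simp add: algebra_simps)
  hence "- of_int b * (real k * ?v) = - of_int a * (real k * ?v) + real k * (of_int (a - b) * ?v)" .
  also have "cis \<dots> = cis (- of_int a * (real k * ?v)) * cis (2 * pi * of_int (int k * sgn (a - b)))"
    unfolding * by (simp only: cis_mult)
  also have "cis (2 * pi * of_int (int k * sgn (a - b))) = 1" by (rule cis_multiple_2pi) auto
  finally show ?thesis by simp
qed

text \<open>Otherwise \<open>a - b\<close> would divide \<open>a\<close>, hence also
  \<open>b\<close> and their gcd 1.\<close>

lemma cis_root_phase_ne_1:
  fixes a b :: int
  assumes "\<bar>a - b\<bar> \<ge> 2" "gcd a b = 1"
  shows "cis (- of_int a * (2 * pi / \<bar>of_int (a - b)\<bar>)) \<noteq> 1"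
proof
  assume "cis (- of_int a * (2 * pi / \<bar>of_int (a - b)\<bar>)) = 1"
  hence "cos (- of_int a * (2 * pi / \<bar>of_int (a - b)\<bar>)) = 1" by (simp add: complex_eq_iff)
  then obtain n :: int where n: "- of_int a * (2 * pi / \<bar>of_int (a - b)\<bar>) = of_int n * 2 * pi"
    using cos_one_2pi_int[THEN iffD1] by blast
  have "\<bar>real_of_int (a - b)\<bar> \<noteq> 0" using assms(1) by auto
  hence "2 * pi * (- real_of_int a) = 2 * pi * (of_int n * \<bar>of_int (a - b)\<bar>)" using n by (simp add: field_simps)
  hence "- real_of_int a = of_int n * \<bar>of_int (a - b)\<bar>" using pi_gt_zero by (simp only: mult_cancel_left) simp
  hence "real_of_int (- a) = real_of_int (n * \<bar>a - b\<bar>)" by simp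
  hence "- a = n * \<bar>a - b\<bar>" by (simp only: of_int_eq_iff)
  hence "\<bar>a - b\<bar> dvd a" by (metis dvd_minus_iff dvd_triv_right)
  hence 1: "(a - b) dvd a" by simp
  hence "(a - b) dvd a - (a - b)" by (rule dvd_diff) simp
  hence "(a - b) dvd b" by simp
  with 1 have "(a - b) dvd gcd a b" by simp
  thus False using assms by (simp add: zdvd1_eq)
qed

text \<open>An integer other than 1 with no prime factor up to \<open>y\<close> exceeds
  \<open>y\<close>, so the sum is part of the tail of a convergent series, whatever \<open>M\<close>
  is.\<close>

lemma rough_tail:
  assumes "r > 1 / 2" "e > 0"
  shows "\<exists>y. \<forall>M. (\<Sum>l\<in>{l\<in>{1..M}. \<forall>p\<in>{p. prime p \<and> p \<le> y}. \<not> p dvd l} - {1}. real l powr (- (2 * r))) \<le> e"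
proof -
  obtain y where y: "\<And>J. finite J \<Longrightarrow> (\<forall>n\<in>J. n > y) \<Longrightarrow> (\<Sum>n\<in>J. real n powr (- (2 * r))) \<le> e"
    using powr_tail_small[of "2 * r" e] assms by auto
  show ?thesis
  proof (rule exI[of _ y], intro allI y ballI)
    fix M l assume l: "l \<in> {l\<in>{1..M}. \<forall>p\<in>{p. prime p \<and> p \<le> y}. \<not> p dvd l} - {1}"
    hence "l \<noteq> 1" by blast
    then obtain q where q: "prime q" "q dvd l" using prime_factor_nat by blast
    hence "q \<le> l" using l by (intro dvd_imp_le) auto
    moreover have "\<not> q \<le> y" using l q by blast
    ultimately show "l > y" by simp
  qed auto
qed

text \<open>The Dirichlet polynomial over the support described above, at the point
  \<open>s + i c t\<close>. It is kept in factored form because the weight interacts with the first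
  factor only.\<close>

definition euler_rough :: "nat set \<Rightarrow> nat \<Rightarrow> nat \<Rightarrow> real \<Rightarrow> complex \<Rightarrow> real \<Rightarrow> complex" where
  "euler_rough A M L c s t = euler_prod A L s (\<lambda>p. - c * (ln (real p) * t)) *
     (\<Sum>l\<in>{l\<in>{1..M}. \<forall>p\<in>A. \<not> p dvd l}. of_nat l powr (- s) * cis (- c * (ln (real l) * t)))"

text \<open>Write \<open>E\<close> for the Euler products and \<open>1 + Q\<close> for the rough
  sums. The difference is \<open>(E a - E b) + E a * Q a - E b * Q b\<close>: concentration of the
  weight makes the first term small, independence and a short tail the other two.\<close>

lemma weighted_mean_square:
  fixes a b :: int
  assumes ab: "\<bar>a - b\<bar> \<ge> 2" "gcd a b = 1" "a \<noteq> 0" "b \<noteq> 0" and r: "r > 1 / 2" and \<eta>: "\<eta> > 0"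
  shows "\<exists>A K w. finite A \<and> (\<forall>p\<in>A. prime p) \<and> K > 0 \<and> (\<forall>p. norm (w p) = 1) \<and>
     (\<forall>M L. L \<ge> 1 \<longrightarrow> (\<forall>\<^sub>F T in at_top. \<forall>s\<in>{s. Re s \<ge> r \<and> norm s \<le> H}.
        integral {0..T} (\<lambda>t. fejer_weight K w A t *
          (norm (euler_rough A M L (of_int a) s t - euler_rough A M L (of_int b) s t))\<^sup>2)
        \<le> \<eta> * T))"
proof -
  define v where "v = 2 * pi / \<bar>of_int (a - b) :: real\<bar>"
  define \<phi> where "\<phi> = (\<lambda>p. real (prime_index p) * v)"
  define w where "w = (\<lambda>p. cis (\<phi> p))"
  define X where "X = {s. Re s \<ge> r \<and> norm s \<le> H}"
  have neq: "a \<noteq> b" using ab by auto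
  obtain C where C: "\<And>s (y::nat) (L::nat). Re s \<ge> r \<Longrightarrow> norm s \<le> H \<Longrightarrow> L \<ge> 1 \<Longrightarrow>
     norm (euler_prod {p. prime p \<and> p \<le> y} L s (\<lambda>p. real (prime_index p) * (- of_int a * v))) \<le> C"
    using euler_prod_bounded[OF cis_root_phase_ne_1[OF ab(1,2)] r, of H] unfolding v_def by blast
  \<comment> \<open>A bound for the mean square of \<open>Q\<close>. As 48 is \<open>4 * 12\<close>,
    the term \<open>12 * C^2 * \<tau>\<close> of the final mean is at most
    \<open>\<eta> / 4\<close>; the minimum with 1 allows \<open>D * V * \<tau>\<close> to be
    replaced by \<open>D * V\<close>.\<close>
  define \<tau> where "\<tau> = min 1 (\<eta> / (48 * (C\<^sup>2 + 1)))"
  have C1: "C\<^sup>2 + 1 > 0" by (simp add: add_nonneg_pos)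
  have \<tau>: "\<tau> > 0" "\<tau> \<le> 1" using \<eta> C1 by (auto simp: \<tau>_def)
  have "\<tau> \<le> \<eta> / (48 * (C\<^sup>2 + 1))" by (simp add: \<tau>_def)
  hence "\<tau> * (48 * (C\<^sup>2 + 1)) \<le> \<eta>" using C1 by (simp add: pos_le_divide_eq)
  hence C\<tau>: "12 * C\<^sup>2 * \<tau> \<le> \<eta> / 4" using \<tau> by (simp add: algebra_simps)
  obtain y where y: "\<And>M. (\<Sum>l\<in>{l\<in>{1..M}. \<forall>p\<in>{p. prime p \<and> p \<le> y}. \<not> p dvd l} - {1}. real l powr (- (2 * r))) \<le> \<tau>"
    using rough_tail[OF r \<tau>(1)] by blast
  define A where "A = {p. prime p \<and> p \<le> y}"
  have A: "finite A" "\<And>p. p \<in> A \<Longrightarrow> prime p"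
    unfolding A_def by (auto intro: finite_subset[of _ "{..y}"])
  define D where "D = (3 * 4 ^ card A)\<^sup>2 * real (card A) * ((of_int a)\<^sup>2 + (of_int b)\<^sup>2)"
  have D: "D \<ge> 0" by (simp add: D_def)
  \<comment> \<open>Chosen so that \<open>24 * D * V \<le> \<eta> / 4\<close>, where
    \<open>V\<close> is the weighted mean of the sum of squared distances to the prescribed
    phases.\<close>
  define K where "K = nat \<lceil>48 * D * (2 * real (card A)) * 2 / \<eta>\<rceil> + 1"
  have K: "K > 0" by (simp add: K_def)
  define V where "V = real (card A) * (2 / real K)"
  have V0: "V \<ge> 0" by (simp add: V_def)
  have "48 * D * (2 * real (card A)) * 2 / \<eta> \<le> real K" unfolding K_def by linarith
  hence "48 * D * (2 * real (card A)) * 2 \<le> real K * \<eta>" using \<eta> by (simp add: pos_divide_le_eq)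
  hence DV: "48 * D * V \<le> \<eta> / 2" using K unfolding V_def by (simp add: field_simps)
  let ?W = "fejer_weight K w A"
  have w: "norm (w p) = 1" for p by (simp add: w_def)
  have X: "Re s \<ge> 0" "Re s \<ge> 1 / 2" "Re s \<ge> r" if "s \<in> X" for s using that r by (auto simp: X_def)
  define S where "S = (\<lambda>t. \<Sum>p\<in>A. (norm (cis (ln (real p) * t) - w p))\<^sup>2)"
  have WS: "trigpoly X (log_span A) (\<lambda>x t. of_real (?W t * S t)) (\<lambda>x. of_real V)"
  proof -
    have "trigpoly X (log_span A) (\<lambda>x t. \<Sum>p\<in>A. of_real (?W t * (norm (cis (ln (real p) * t) - w p))\<^sup>2)) (\<lambda>x. \<Sum>p\<in>A. of_real (2 / real K))"
      by (intro trigpoly_sum fejer_weight_dist_trigpoly w K A)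
    thus ?thesis by (simp add: S_def V_def sum_distrib_left)
  qed
  have W1: "trigpoly X (log_span A) (\<lambda>x t. of_real (?W t)) (\<lambda>x. 1)"
    by (rule fejer_weight_trigpoly[OF w K A])
  have result: "\<forall>\<^sub>F T in at_top. \<forall>s\<in>X.
        integral {0..T} (\<lambda>t. ?W t *
          (norm (euler_rough A M L (of_int a) s t - euler_rough A M L (of_int b) s t))\<^sup>2)
        \<le> \<eta> * T" if L: "L \<ge> 1" for M L
  proof -
    define R where "R = {l\<in>{1..M}. \<forall>p\<in>A. \<not> p dvd l}"
    have finR: "finite R" by (simp add: R_def)
    define E where "E = (\<lambda>(c::int) s t. euler_prod A L s (\<lambda>p. - of_int c * (ln (real p) * t)))"
    define P where "P = (\<lambda>(c::int) s t. \<Sum>l\<in>R. complex_of_nat l powr (- s) * cis (- of_int c * (ln (real l) * t)))"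
    define Q where "Q = (\<lambda>(c::int) s t. \<Sum>l\<in>R - {1}. complex_of_nat l powr (- s) * cis (- of_int c * (ln (real l) * t)))"
    define E0 where "E0 = (\<lambda>s. euler_prod A L s (\<lambda>p. - of_int a * \<phi> p))"
    have E0_bound: "norm (E0 s) \<le> C" if "s \<in> X" for s
      using C[of s L y] that L unfolding E0_def A_def \<phi>_def X_def by (simp add: mult_ac)
    have E0_eq: "E0 s = euler_prod A L s (\<lambda>p. - of_int c * \<phi> p)" if "c = a \<or> c = b" for c s
      using that cis_root_phase_eq[OF neq] unfolding E0_def euler_prod_def \<phi>_def v_def by auto
    have E_lip: "(norm (E c s t - E0 s))\<^sup>2 \<le> D * S t" if c: "c = a \<or> c = b" and s: "s \<in> X" for c s t
    proof -
      have "(norm (E c s t - E0 s))\<^sup>2 \<le> (3 * 4 ^ card A)\<^sup>2 * real (card A) *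
         (\<Sum>p\<in>A. (norm (cis (- of_int c * (ln (real p) * t)) - cis (- of_int c * \<phi> p)))\<^sup>2)"
        unfolding E0_eq[OF c] E_def by (rule euler_prod_lipschitz_square[OF A X(2)[OF s]])
      also have "\<dots> \<le> (3 * 4 ^ card A)\<^sup>2 * real (card A) * (\<Sum>p\<in>A. ((of_int a)\<^sup>2 + (of_int b)\<^sup>2) * (norm (cis (ln (real p) * t) - w p))\<^sup>2)"
      proof (intro mult_left_mono sum_mono)
        fix p
        have "(norm (cis (- of_int c * (ln (real p) * t)) - cis (- of_int c * \<phi> p)))\<^sup>2 \<le>
           (\<bar>of_int (- c)\<bar> * norm (cis (ln (real p) * t) - w p))\<^sup>2"
          using norm_cis_int_mult_diff[of "- c" "ln (real p) * t" "\<phi> p"] unfolding w_def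
          by (intro power_mono) auto
        also have "\<dots> = (of_int c)\<^sup>2 * (norm (cis (ln (real p) * t) - w p))\<^sup>2" by (simp add: power_mult_distrib)
        also have "\<dots> \<le> ((of_int a)\<^sup>2 + (of_int b)\<^sup>2) * (norm (cis (ln (real p) * t) - w p))\<^sup>2"
          using c by (intro mult_right_mono) auto
        finally show "(norm (cis (- of_int c * (ln (real p) * t)) - cis (- of_int c * \<phi> p)))\<^sup>2 \<le>
          ((of_int a)\<^sup>2 + (of_int b)\<^sup>2) * (norm (cis (ln (real p) * t) - w p))\<^sup>2" .
      qed auto
      also have "\<dots> = D * S t" unfolding D_def S_def sum_distrib_left[symmetric] by (simp only: mult.assoc)
      finally show ?thesis .
    qed
    have E_bound: "(norm (E c s t))\<^sup>2 \<le> 2 * C\<^sup>2 + 2 * D * S t" if c: "c = a \<or> c = b" and s: "s \<in> X" for c s t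
    proof -
      have "(norm (E c s t))\<^sup>2 \<le> 2 * (norm (E0 s))\<^sup>2 + 2 * (norm (E c s t - E0 s))\<^sup>2"
        using power2_norm_add_le[of "E0 s" "E c s t - E0 s"] by simp
      moreover have "(norm (E0 s))\<^sup>2 \<le> C\<^sup>2" by (intro power_mono E0_bound s) auto
      ultimately show ?thesis using E_lip[OF c s, of t] by linarith
    qed
    have E_diff: "(norm (E a s t - E b s t))\<^sup>2 \<le> 4 * D * S t" if s: "s \<in> X" for s t
    proof -
      have "(norm (E a s t - E b s t))\<^sup>2 \<le> 2 * (norm (E a s t - E0 s))\<^sup>2 + 2 * (norm (- (E b s t - E0 s)))\<^sup>2"
        using power2_norm_add_le[of "E a s t - E0 s" "- (E b s t - E0 s)"] by (simp only: algebra_simps) simp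
      thus ?thesis unfolding norm_minus_cancel using E_lip[of a s t] E_lip[of b s t] s by linarith
    qed
    \<comment> \<open>The weighted square of \<open>E\<close> has its frequencies in
      \<open>log_span A\<close>, that of \<open>Q\<close> in \<open>log_span (- A)\<close>, so the
      mean factorises. The first mean is bounded by comparison with \<open>E_bound\<close>, the
      second is at most \<open>\<tau>\<close>.\<close>
    have EQ: "\<exists>m. trigpoly X UNIV (\<lambda>s t. of_real (?W t * (norm (E c s t))\<^sup>2 * (norm (Q c s t))\<^sup>2)) m \<and>
        (\<forall>s\<in>X. Re (m s) \<le> (2 * C\<^sup>2 + 2 * D * V) * \<tau>)" if c: "c = a \<or> c = b" for c
    proof -
      have c0: "c \<noteq> 0" using c ab by auto
      have "\<exists>m. trigpoly X (log_span A) (\<lambda>s t. of_real (?W t * (norm (E c s t))\<^sup>2)) m"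
        unfolding E_def by (rule weighted_euler_prod_trigpoly[OF w K A X(1)])
      then obtain m where m: "trigpoly X (log_span A) (\<lambda>s t. of_real (?W t * (norm (E c s t))\<^sup>2)) m" ..
      have "trigpoly X (log_span A) (\<lambda>s t. of_real (2 * C\<^sup>2) * of_real (?W t) + of_real (2 * D) * of_real (?W t * S t))
         (\<lambda>s. of_real (2 * C\<^sup>2) * 1 + of_real (2 * D) * of_real V)"
        by (rule trigpoly.add[OF trigpoly_scale[OF W1 bounded_image_const] trigpoly_scale[OF WS bounded_image_const]])
      hence "trigpoly X (log_span A) (\<lambda>s t. of_real (?W t * (2 * C\<^sup>2 + 2 * D * S t))) (\<lambda>s. of_real (2 * C\<^sup>2 + 2 * D * V))"
        by (simp add: algebra_simps)
      note mono = trigpoly_mean_mono[OF m this]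
      have mle: "Re (m s) \<le> 2 * C\<^sup>2 + 2 * D * V" if "s \<in> X" for s
        using mono[OF that mult_left_mono[OF E_bound[OF c that] fejer_weight_nonneg]] by simp
      have "trigpoly X (log_span A) (\<lambda>s t. of_real 0) (\<lambda>s. 0)"
        using trigpoly.const[OF bounded_image_const[of 0 X]] by simp
      from trigpoly_mean_mono[OF this m] have m0: "Re (m s) \<ge> 0" if "s \<in> X" for s
        using that fejer_weight_nonneg by simp
      define q where "q = (\<lambda>s. \<Sum>l\<in>R - {1}. (norm (complex_of_nat l powr (- s)))\<^sup>2)"
      have ln_R: "ln (real l) \<in> log_span (- A)" if "l \<in> R" for l
        by (rule log_span_ln) (use that in \<open>auto simp: R_def prime_factors_dvd\<close>)
      have "trigpoly X (log_span (- A))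
          (\<lambda>s t. of_real ((norm (\<Sum>l\<in>R - {1}. complex_of_nat l powr (- s) * cis ((- of_int c * ln (real l)) * t)))\<^sup>2))
          (\<lambda>s. of_real (\<Sum>l\<in>R - {1}. (norm (complex_of_nat l powr (- s)))\<^sup>2))"
      proof (rule trigpoly_norm_square)
        show "inj_on (\<lambda>l. - of_int c * ln (real l)) (R - {1})"
          using c0 by (auto simp: inj_on_def R_def)
        show "bounded ((\<lambda>s. complex_of_nat l powr (- s)) ` X)" if "l \<in> R - {1}" for l
          using bounded_of_nat_powr_power[of l X 1] X(1) that by (auto simp: R_def)
        show "- of_int c * ln (real j) - - of_int c * ln (real k) \<in> log_span (- A)" if "j \<in> R - {1}" "k \<in> R - {1}" for j k
          using log_span_diff[OF log_span_int_mult[OF ln_R, of j "- c"] log_span_int_mult[OF ln_R, of k "- c"]] that by simp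
      qed (use finR in auto)
      hence "trigpoly X (log_span (- A)) (\<lambda>s t. of_real ((norm (Q c s t))\<^sup>2)) (\<lambda>s. of_real (q s))"
        by (simp only: Q_def q_def mult.assoc)
      with m have "trigpoly X UNIV (\<lambda>s t. of_real (?W t * (norm (E c s t))\<^sup>2) * of_real ((norm (Q c s t))\<^sup>2)) (\<lambda>s. m s * of_real (q s))"
        by (rule trigpoly_mult_indep[OF _ _ log_span_disjoint _ _ _ log_span_uminus]) auto
      moreover have "Re (m s * of_real (q s)) \<le> (2 * C\<^sup>2 + 2 * D * V) * \<tau>" if s: "s \<in> X" for s
      proof -
        have "q s \<le> (\<Sum>l\<in>R - {1}. real l powr (- (2 * r)))"
          unfolding q_def
        proof (rule sum_mono)
          fix l assume "l \<in> R - {1}"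
          hence l: "l > 0" by (auto simp: R_def)
          have "(norm (complex_of_nat l powr (- s)))\<^sup>2 \<le> (real l powr (- r))\<^sup>2"
            by (intro power_mono norm_of_nat_powr_le l X s) auto
          also have "\<dots> = real l powr (- (2 * r))" using l by (simp add: powr_power)
          finally show "(norm (complex_of_nat l powr (- s)))\<^sup>2 \<le> real l powr (- (2 * r))" .
        qed
        also have "\<dots> \<le> \<tau>" using y[of M] unfolding R_def A_def .
        finally have "q s \<le> \<tau>" .
        moreover have "q s \<ge> 0" unfolding q_def by (intro sum_nonneg) auto
        ultimately have "Re (m s) * q s \<le> (2 * C\<^sup>2 + 2 * D * V) * \<tau>"
          using mle[OF s] m0[OF s] D V0 by (intro mult_mono) auto
        thus ?thesis by simp
      qed
      ultimately show ?thesis by (auto simp: mult.assoc)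
    qed
    obtain ma where ma: "trigpoly X UNIV (\<lambda>s t. of_real (?W t * (norm (E a s t))\<^sup>2 * (norm (Q a s t))\<^sup>2)) ma"
      "\<And>s. s \<in> X \<Longrightarrow> Re (ma s) \<le> (2 * C\<^sup>2 + 2 * D * V) * \<tau>" using EQ[of a] by auto
    obtain mb where mb: "trigpoly X UNIV (\<lambda>s t. of_real (?W t * (norm (E b s t))\<^sup>2 * (norm (Q b s t))\<^sup>2)) mb"
      "\<And>s. s \<in> X \<Longrightarrow> Re (mb s) \<le> (2 * C\<^sup>2 + 2 * D * V) * \<tau>" using EQ[of b] by auto
    define F where "F = (\<lambda>s t. 3 * (4 * D * (?W t * S t) + ?W t * (norm (E a s t))\<^sup>2 * (norm (Q a s t))\<^sup>2
        + ?W t * (norm (E b s t))\<^sup>2 * (norm (Q b s t))\<^sup>2))"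
    define mF where "mF = (\<lambda>s. 3 * (of_real (4 * D) * of_real V + ma s + mb s))"
    have "trigpoly X UNIV (\<lambda>s t. 3 * (of_real (4 * D) * of_real (?W t * S t) + of_real (?W t * (norm (E a s t))\<^sup>2 * (norm (Q a s t))\<^sup>2)
        + of_real (?W t * (norm (E b s t))\<^sup>2 * (norm (Q b s t))\<^sup>2))) mF"
      unfolding mF_def
      by (rule trigpoly_scale[OF trigpoly.add[OF trigpoly.add[OF trigpoly_scale[OF trigpoly_mono[OF WS subset_UNIV]
            bounded_image_const] ma(1)] mb(1)] bounded_image_const])
    hence tF: "trigpoly X UNIV (\<lambda>s t. of_real (F s t)) mF" by (simp add: F_def)
    have mF: "Re (mF s) \<le> \<eta> / 2" if "s \<in> X" for s
    proof -
      have "Re (mF s) \<le> 3 * (4 * D * V + (2 * C\<^sup>2 + 2 * D * V) * \<tau> + (2 * C\<^sup>2 + 2 * D * V) * \<tau>)"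
        using ma(2)[OF that] mb(2)[OF that] by (simp add: mF_def mult.commute)
      also have "\<dots> = 12 * (D * V) + 12 * C\<^sup>2 * \<tau> + 12 * (D * V) * \<tau>" by (simp add: algebra_simps)
      also have "12 * (D * V) * \<tau> \<le> 12 * (D * V) * 1" using \<tau> D V0 by (intro mult_left_mono) auto
      finally show ?thesis using C\<tau> DV by simp
    qed
    \<comment> \<open>The rough sum equals \<open>1 + Q\<close> unless \<open>M = 0\<close>, when it
      is empty.\<close>
    have PF: "?W t * (norm (E a s t * P a s t - E b s t * P b s t))\<^sup>2 \<le> F s t" if s: "s \<in> X" for s t
    proof (cases "M = 0")
      case True
      hence "P a s t = 0" "P b s t = 0" by (auto simp: P_def R_def)
      moreover have "F s t \<ge> 0" unfolding F_def S_def using D fejer_weight_nonneg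
        by (intro mult_nonneg_nonneg add_nonneg_nonneg sum_nonneg) auto
      ultimately show ?thesis by simp
    next
      case False
      have "1 \<in> R" using False A(2)[of 1] by (auto simp: R_def)
      hence P1: "P c s t = 1 + Q c s t" for c
        unfolding P_def Q_def by (subst sum.remove[OF finR, of 1]) auto
      have "(norm (E a s t * P a s t - E b s t * P b s t))\<^sup>2 =
          (norm ((E a s t - E b s t) + E a s t * Q a s t + - (E b s t * Q b s t)))\<^sup>2"
        unfolding P1 by (simp add: algebra_simps)
      also have "\<dots> \<le> 3 * ((norm (E a s t - E b s t))\<^sup>2 + (norm (E a s t * Q a s t))\<^sup>2 + (norm (- (E b s t * Q b s t)))\<^sup>2)"
        by (rule power2_norm_add3_le)
      also have "\<dots> \<le> 3 * (4 * D * S t + (norm (E a s t))\<^sup>2 * (norm (Q a s t))\<^sup>2 + (norm (E b s t))\<^sup>2 * (norm (Q b s t))\<^sup>2)"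
        using E_diff[OF s, of t] by (simp add: norm_mult power_mult_distrib)
      finally have "?W t * (norm (E a s t * P a s t - E b s t * P b s t))\<^sup>2 \<le> ?W t *
        (3 * (4 * D * S t + (norm (E a s t))\<^sup>2 * (norm (Q a s t))\<^sup>2 + (norm (E b s t))\<^sup>2 * (norm (Q b s t))\<^sup>2))"
        by (rule mult_left_mono) (rule fejer_weight_nonneg)
      thus ?thesis by (simp add: F_def algebra_simps)
    qed
    have contW: "continuous_on B ?W" for B
      unfolding fejer_weight_def fejer_factor_def using K by (intro continuous_intros) auto
    have contEP: "continuous_on B (\<lambda>t. E c s t)" "continuous_on B (\<lambda>t. P c s t)" "continuous_on B (\<lambda>t. Q c s t)" for B c s
      unfolding E_def P_def Q_def euler_prod_def by (intro continuous_intros)+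
    have contS: "continuous_on B S" for B unfolding S_def by (intro continuous_intros)
    \<comment> \<open>One half of \<open>\<eta>\<close> covers the mean itself, the other the
      deviation of the average over \<open>[0, T]\<close> from it.\<close>
    have "\<eta> / 2 > 0" using \<eta> by simp
    from trigpoly_mean_real[OF tF this] eventually_ge_at_top[of 0]
    have "\<forall>\<^sub>F T in at_top. \<forall>s\<in>X. integral {0..T} (\<lambda>t. ?W t * (norm (E a s t * P a s t - E b s t * P b s t))\<^sup>2) \<le> \<eta> * T"
    proof eventually_elim
      case (elim T)
      show ?case
      proof
        fix s assume s: "s \<in> X"
        have "integral {0..T} (\<lambda>t. ?W t * (norm (E a s t * P a s t - E b s t * P b s t))\<^sup>2) \<le> integral {0..T} (F s)"
          by (intro integral_le integrable_continuous_real PF s)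
             (unfold F_def, (intro continuous_intros contW contEP contS)+)
        also have "\<dots> \<le> T * Re (mF s) + \<eta> / 2 * T" using bspec[OF elim(1) s] by linarith
        also have "T * Re (mF s) \<le> T * (\<eta> / 2)" using mF[OF s] elim by (intro mult_left_mono) auto
        finally show "integral {0..T} (\<lambda>t. ?W t * (norm (E a s t * P a s t - E b s t * P b s t))\<^sup>2) \<le> \<eta> * T"
          by (simp add: algebra_simps)
      qed
    qed
    thus ?thesis unfolding E_def P_def R_def euler_rough_def .
  qed
  show ?thesis unfolding X_def[symmetric]
    using A K w result by (intro exI[of _ A] exI[of _ K] exI[of _ w]) auto
qed

section \<open>Approximation of zeta by Euler--Maclaurin summation\<close>

text \<open>After \<open>x powr (2 - r) \<le> N powr (2 - r)\<close> the remaining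
  \<open>1 / x^2\<close> is compared with the telescoping \<open>1 / x - 1 / (x + 1)\<close>; the
  factor 2 comes from \<open>x + 1 \<le> 2 * x\<close>.\<close>

lemma sum_powr_tail_le:
  assumes "r \<ge> 2" "N \<ge> 1"
  shows "summable (\<lambda>n. real (n + N) powr (- r))" "(\<Sum>n. real (n + N) powr (- r)) \<le> 2 * real N powr (1 - r)"
proof -
  have "(\<lambda>n. 2 * (1 / real (n + N) - 1 / real (Suc n + N))) sums (2 * (1 / real (0 + N) - 0))"
  proof (intro sums_mult telescope_sums')
    show "(\<lambda>n. 1 / real (n + N)) \<longlonglongrightarrow> 0"
      using LIMSEQ_ignore_initial_segment[OF lim_1_over_n, of N] by simp
  qed
  hence "(\<lambda>n. real N powr (2 - r) * (2 * (1 / real (n + N) - 1 / real (Suc n + N)))) sums (real N powr (2 - r) * (2 * (1 / real (0 + N) - 0)))"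
    by (rule sums_mult)
  moreover have "real N powr (2 - r) * (2 * (1 / real (0 + N) - 0)) = 2 * real N powr (1 - r)"
  proof -
    have "real N powr (2 - r) = real N powr (1 - r) * real N powr 1"
      by (simp only: powr_add[symmetric]) simp
    thus ?thesis using assms by simp
  qed
  ultimately have S: "(\<lambda>n. real N powr (2 - r) * (2 * (1 / real (n + N) - 1 / real (Suc n + N)))) sums (2 * real N powr (1 - r))"
    by simp
  have le: "real (n + N) powr (- r) \<le> real N powr (2 - r) * (2 * (1 / real (n + N) - 1 / real (Suc n + N)))" for n
  proof -
    define x where "x = real (n + N)"
    have x: "x \<ge> 1" "x \<ge> real N" using assms by (auto simp: x_def)
    have "x powr (- r) = x powr (2 - r) * x powr (- 2)" by (simp only: powr_add[symmetric]) simp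
    also have "x powr (- 2) = 1 / x\<^sup>2" using x by (simp add: powr_minus powr_numeral divide_inverse)
    also have "x powr (2 - r) * (1 / x\<^sup>2) \<le> real N powr (2 - r) * (2 * (1 / x - 1 / (x + 1)))"
    proof (rule mult_mono)
      show "x powr (2 - r) \<le> real N powr (2 - r)" using powr_mono2'[of "2 - r" "real N" x] assms x by auto
      have "2 * (1 / x - 1 / (x + 1)) = 2 / (x * (x + 1))" using x by (simp add: field_simps)
      moreover have "1 / x\<^sup>2 \<le> 2 / (x * (x + 1))"
      proof -
        have "x * (x + 1) \<le> 2 * x\<^sup>2" using x by (simp add: power2_eq_square algebra_simps)
        thus ?thesis using x by (simp add: divide_simps)
      qed
      ultimately show "1 / x\<^sup>2 \<le> 2 * (1 / x - 1 / (x + 1))" by simp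
    qed (use x in auto)
    finally show ?thesis by (simp add: x_def add_ac)
  qed
  show sm: "summable (\<lambda>n. real (n + N) powr (- r))"
    by (rule summable_comparison_test'[OF sums_summable[OF S], of 0]) (use le in auto)
  show "(\<Sum>n. real (n + N) powr (- r)) \<le> 2 * real N powr (1 - r)"
    using suminf_le[OF le sm sums_summable[OF S]] sums_unique[OF S] by simp
qed

text \<open>Since \<open>q\<close> has equal end values, the boundary terms of neighbouring unit
  intervals telescope and leave only the one at \<open>N + 1\<close>.\<close>

lemma em_tail_step:
  assumes p: "continuous_on {0..1} p"
    and q: "\<And>t. t \<in> {0..1} \<Longrightarrow> (q has_vector_derivative p t) (at t within {0..1})"
    and "q 1 = q 0" and s: "Re s > 0" and k: "k \<ge> 1"
  shows "(\<Sum>n. em_term p k (n + N) s) = - q 0 * of_nat (Suc N) powr (- s - of_nat k) + (s + of_nat k) * (\<Sum>n. em_term q (Suc k) (n + N) s)"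
proof -
  have cq: "continuous_on {0..1} q" by (rule continuous_on_vector_derivative) (rule q)
  have lim: "(\<lambda>n. complex_of_nat (Suc (n + N)) powr (- s - of_nat k)) \<longlonglongrightarrow> 0"
    using LIMSEQ_ignore_initial_segment[OF Suc_powr_tendsto_0[of "- s - of_nat k"], of N] s by simp
  have tel: "(\<lambda>n. complex_of_nat (Suc (Suc n + N)) powr (- s - of_nat k) - of_nat (Suc (n + N)) powr (- s - of_nat k))
      sums (0 - of_nat (Suc (0 + N)) powr (- s - of_nat k))"
    by (rule telescope_sums[OF lim])
  have "summable (\<lambda>n. em_term q (Suc k) (n + N) s)"
    by (rule summable_ignore_initial_segment[OF em_summable[OF cq]]) (use s k in auto)
  hence "(\<lambda>n. q 0 * (complex_of_nat (Suc (Suc n + N)) powr (- s - of_nat k) - of_nat (Suc (n + N)) powr (- s - of_nat k))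
      + (s + of_nat k) * em_term q (Suc k) (n + N) s) sums
      (q 0 * (0 - of_nat (Suc (0 + N)) powr (- s - of_nat k)) + (s + of_nat k) * (\<Sum>n. em_term q (Suc k) (n + N) s))"
    by (intro sums_add sums_mult tel summable_sums)
  moreover have "em_term p k (n + N) s = q 0 * (complex_of_nat (Suc (Suc n + N)) powr (- s - of_nat k) - of_nat (Suc (n + N)) powr (- s - of_nat k))
      + (s + of_nat k) * em_term q (Suc k) (n + N) s" for n
    by (subst em_by_parts[OF p q]) (use assms(3) in \<open>auto simp: algebra_simps\<close>)
  ultimately show ?thesis by (simp add: sums_iff)
qed

text \<open>\<open>i\<close> integrations by parts, each costing a factor
  \<open>norm (s + k) \<le> U\<close> and gaining a power of \<open>N\<close>. Mean zero of
  \<open>p\<close> gives its primitive equal end values, and subtracting the mean of the primitive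
  lets the step be repeated. As \<open>U \<le> N + 1\<close>, all boundary terms are of the size of
  the first. The condition on \<open>U\<close> is unchanged when \<open>k\<close> grows and
  \<open>i\<close> drops by one.\<close>

lemma em_tail_bound:
  assumes p: "continuous_on {0..1::real} p" "integral {0..1} p = (0::complex)" and "k \<ge> 1" "k + i \<ge> 2"
  shows "\<exists>C\<ge>0. \<forall>s N U. Re s > 0 \<longrightarrow> norm s + real k + real i \<le> U \<longrightarrow> U \<le> real (Suc N) \<longrightarrow>
     norm (\<Sum>n. em_term p k (n + N) s) \<le> C * (real (Suc N) powr (- Re s - real k) + U ^ i * real (Suc N) powr (1 - Re s - real k - real i))"
  using assms
proof (induction i arbitrary: p k)
  case 0
  obtain B where B: "\<And>t. t \<in> {0..1} \<Longrightarrow> norm (p t) \<le> B" using em_bounded[OF 0(1)] by metis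
  have B0: "B \<ge> 0" using B[of 0] norm_ge_zero[of "p 0"] by (simp del: norm_ge_zero)
  show ?case
  proof (intro exI[of _ "2 * B"] conjI allI impI)
    fix s N and U :: real assume s: "Re s > 0"
    let ?r = "Re s + real k"
    have r: "?r \<ge> 2" using s 0 by simp
    have b: "norm (em_term p k (n + N) s) \<le> B * real (n + Suc N) powr (- ?r)" for n
      using em_term_bound[OF 0(1) B, of ?r s k "n + N"] r by simp
    have "norm (\<Sum>n. em_term p k (n + N) s) \<le> (\<Sum>n. B * real (n + Suc N) powr (- ?r))"
      by (rule norm_suminf_le[OF b]) (intro summable_mult sum_powr_tail_le r, simp)
    also have "\<dots> = B * (\<Sum>n. real (n + Suc N) powr (- ?r))"
      by (rule suminf_mult) (intro sum_powr_tail_le r, simp)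
    also have "\<dots> \<le> B * (2 * real (Suc N) powr (1 - ?r))"
      by (intro mult_left_mono sum_powr_tail_le r B0) simp
    also have "\<dots> \<le> 2 * B * (real (Suc N) powr (- Re s - real k) + U ^ 0 * real (Suc N) powr (1 - Re s - real k - real 0))"
      using B0 by (simp add: algebra_simps)
    finally show "norm (\<Sum>n. em_term p k (n + N) s) \<le> \<dots>" .
  qed (use B0 in auto)
next
  case (Suc i)
  define h where "h = (\<lambda>t. integral {0..t} p)"
  define q where "q = (\<lambda>t. h t - integral {0..1} h)"
  have h: "(h has_vector_derivative p t) (at t within {0..1})" if "t \<in> {0..1}" for t
    unfolding h_def using Suc.prems that by (intro integral_has_vector_derivative)
  hence q: "(q has_vector_derivative p t) (at t within {0..1})" if "t \<in> {0..1}" for t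
    unfolding q_def using that by (auto intro!: derivative_eq_intros)
  have ch: "continuous_on {0..1} h" by (rule continuous_on_vector_derivative) (rule h)
  have cq: "continuous_on {0..1} q" unfolding q_def by (intro continuous_intros ch)
  have iq: "integral {0..1} q = 0"
    unfolding q_def by (subst integral_diff) (auto intro!: integrable_continuous_real ch)
  have q01: "q 1 = q 0" using Suc.prems by (simp add: q_def h_def)
  obtain C where C: "C \<ge> 0" "\<And>s N U. Re s > 0 \<Longrightarrow> norm s + real (Suc k) + real i \<le> U \<Longrightarrow> U \<le> real (Suc N) \<Longrightarrow>
     norm (\<Sum>n. em_term q (Suc k) (n + N) s) \<le> C * (real (Suc N) powr (- Re s - real (Suc k)) + U ^ i * real (Suc N) powr (1 - Re s - real (Suc k) - real i))"
    using Suc.IH[OF cq iq, of "Suc k"] Suc.prems by auto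
  show ?case
  proof (intro exI[of _ "norm (q 0) + C"] conjI allI impI)
    fix s N U assume s: "Re s > 0" and U: "norm s + real k + real (Suc i) \<le> U" "U \<le> real (Suc N)"
    define n where "n = real (Suc N)"
    have n: "n \<ge> 1" by (simp add: n_def)
    have U0: "U \<ge> 0" using U(1) norm_ge_zero[of s] by linarith
    let ?E = "n powr (- Re s - real k)"
    let ?F = "U ^ Suc i * n powr (1 - Re s - real k - real (Suc i))"
    have sk: "norm (s + of_nat k) \<le> U"
      using norm_triangle_ineq[of s "of_nat k"] U(1) by simp
    have "norm (\<Sum>n. em_term p k (n + N) s) = norm (- q 0 * of_nat (Suc N) powr (- s - of_nat k) + (s + of_nat k) * (\<Sum>n. em_term q (Suc k) (n + N) s))"
      by (subst em_tail_step[OF Suc.prems(1) q q01 s Suc.prems(3)]) auto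
    also have "\<dots> \<le> norm (q 0) * norm (complex_of_nat (Suc N) powr (- s - of_nat k)) + norm (s + of_nat k) * norm (\<Sum>n. em_term q (Suc k) (n + N) s)"
      by (rule order_trans[OF norm_triangle_ineq]) (simp only: norm_mult norm_minus_cancel order_refl)
    also have "norm (complex_of_nat (Suc N) powr (- s - of_nat k)) = ?E"
      unfolding n_def by (subst norm_powr_real_powr) (auto simp del: of_nat_Suc)
    also have "norm (s + of_nat k) * norm (\<Sum>n. em_term q (Suc k) (n + N) s) \<le>
        U * (C * (n powr (- Re s - real (Suc k)) + U ^ i * n powr (1 - Re s - real (Suc k) - real i)))"
      unfolding n_def using sk U0 U by (intro mult_mono C s) auto
    also have "\<dots> = C * (U * n powr (- Re s - real (Suc k)) + ?F)"
      by (simp add: algebra_simps)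
    also have "U * n powr (- Re s - real (Suc k)) \<le> n * n powr (- Re s - real (Suc k))"
      using U n_def by (intro mult_right_mono) auto
    also have "\<dots> = n powr (1 + (- Re s - real (Suc k)))" using n by (simp only: powr_add) simp
    also have "\<dots> = ?E" by simp
    finally have "norm (\<Sum>n. em_term p k (n + N) s) \<le> norm (q 0) * ?E + C * (?E + ?F)"
      using C(1) by (simp add: mult_left_mono)
    also have "\<dots> \<le> (norm (q 0) + C) * (?E + ?F)"
      using U0 by (simp add: algebra_simps)
    finally show "norm (\<Sum>n. em_term p k (n + N) s) \<le> (norm (q 0) + C) * (real (Suc N) powr (- Re s - real k)
       + U ^ Suc i * real (Suc N) powr (1 - Re s - real k - real (Suc i)))" unfolding n_def .
  qed (use C in auto)
qed

text \<open>Both sides are holomorphic on the right half-plane without the pole and agree where the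
  Dirichlet series converges.\<close>

lemma riemann_zeta_em:
  assumes "Re s > 0" "s \<noteq> 1"
  shows "riemann_zeta s = 1 / (s - 1) + 1 / 2 - s * (\<Sum>n. em_term (\<lambda>t. of_real t - 1 / 2) 1 n s)"
proof -
  let ?H = "{s. Re s > 0} - {1::complex}"
  let ?g = "\<lambda>s. 1 / (s - 1) + 1 / 2 - s * (\<Sum>n. em_term (\<lambda>t. of_real t - 1 / 2) 1 n s)"
  have "{s. Re s > 1 - real 1} = {s. Re s > 0}" by simp
  hence em: "(\<lambda>s. \<Sum>n. em_term (\<lambda>t. of_real t - 1 / 2) 1 n s) holomorphic_on {s. Re s > 0}"
    using em_holomorphic[of "\<lambda>t. of_real t - 1 / 2" 1] by (simp add: continuous_intros)
  show ?thesis
  proof (rule analytic_continuation_open[where s = "{s. Re s > 1}" and s' = ?H and f = riemann_zeta and g = ?g])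
    show "{s. Re s > 1} \<noteq> {}" by (auto intro!: exI[of _ 2])
    show "connected ?H"
      by (intro connected_open_delete) (auto intro: convex_connected convex_halfspace_Re_gt open_halfspace_Re_gt)
    show "open ?H" by (intro open_Diff open_halfspace_Re_gt) auto
    show "riemann_zeta holomorphic_on ?H" by (rule holomorphic_on_subset[OF riemann_zeta_holomorphic]) auto
    show "?g holomorphic_on ?H" by (intro holomorphic_intros holomorphic_on_subset[OF em]) auto
    show "riemann_zeta z = ?g z" if "z \<in> {s. Re s > 1}" for z
      using sums_unique2[OF riemann_zeta_sums[of z] em_base[of z]] that by simp
  qed (use assms open_halfspace_Re_gt in auto)
qed

text \<open>Two evaluations of one integral over a unit interval, by the primitive and by the
  trapezoidal rule with remainder.\<close>

lemma em_term_linear: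
  assumes "s \<noteq> 1"
  shows "s * em_term (\<lambda>t. of_real t - 1 / 2) 1 n s = (of_nat (Suc (Suc n)) powr (1 - s) - of_nat (Suc n) powr (1 - s)) / (1 - s)
     - 1 / 2 * (of_nat (Suc (Suc n)) powr (- s) + of_nat (Suc n) powr (- s))"
proof -
  have "((\<lambda>t. complex_of_real t - 1 / 2) has_vector_derivative 1) (at t within {0..1})" for t
    by (auto intro!: derivative_eq_intros)
  from em_by_parts[of "\<lambda>_. 1" "\<lambda>t. complex_of_real t - 1 / 2" 0 n s, OF _ this]
  have 1: "em_term (\<lambda>_. 1) 0 n s = 1 / 2 * (of_nat (Suc (Suc n)) powr (- s) + of_nat (Suc n) powr (- s))
     + s * em_term (\<lambda>t. of_real t - 1 / 2) 1 n s" by (simp add: algebra_simps)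
  have "em_term (\<lambda>_. 0) 0 n (s - 1) = of_nat (Suc (Suc n)) powr (1 - s) - of_nat (Suc n) powr (1 - s) + (s - 1) * em_term (\<lambda>_. 1) 1 n (s - 1)"
    using em_by_parts[of "\<lambda>_. 0" "\<lambda>_. 1" 0 n "s - 1"] by simp
  moreover have "em_term (\<lambda>_. 0) 0 n (s - 1) = 0" "em_term (\<lambda>_. 1) 1 n (s - 1) = em_term (\<lambda>_. 1) 0 n s"
    by (simp_all add: em_term_def)
  ultimately have "(1 - s) * em_term (\<lambda>_. 1) 0 n s = of_nat (Suc (Suc n)) powr (1 - s) - of_nat (Suc n) powr (1 - s)"
    by (simp add: algebra_simps)
  hence "em_term (\<lambda>_. 1) 0 n s = (of_nat (Suc (Suc n)) powr (1 - s) - of_nat (Suc n) powr (1 - s)) / (1 - s)"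
    using assms by (simp add: field_simps)
  thus ?thesis unfolding 1 by (simp add: algebra_simps)
qed

lemma riemann_zeta_em_tail:
  assumes "Re s > 0" "s \<noteq> 1"
  shows "riemann_zeta s = (\<Sum>n<N. of_nat (Suc n) powr (- s)) + of_nat (Suc N) powr (1 - s) / (s - 1)
     + of_nat (Suc N) powr (- s) / 2 - s * (\<Sum>n. em_term (\<lambda>t. of_real t - 1 / 2) 1 (n + N) s)"
proof -
  let ?e = "\<lambda>n. em_term (\<lambda>t. of_real t - 1 / 2) 1 n s"
  have sm: "summable ?e" by (rule em_summable) (use assms in \<open>auto intro!: continuous_intros\<close>)
  have "s * (\<Sum>n<N. ?e n) = (of_nat (Suc N) powr (1 - s) - 1) / (1 - s) - (\<Sum>n<N. of_nat (Suc n) powr (- s)) + 1 / 2 - of_nat (Suc N) powr (- s) / 2"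
  proof (induction N)
    case (Suc N)
    have "s * (\<Sum>n<Suc N. ?e n) = s * (\<Sum>n<N. ?e n) + s * ?e N" by (simp add: ring_distribs)
    thus ?case unfolding Suc em_term_linear[OF assms(2)]
      by (simp add: diff_divide_distrib add_divide_distrib ring_distribs)
  qed simp
  moreover have "(\<Sum>n. ?e n) = (\<Sum>n. ?e (n + N)) + (\<Sum>n<N. ?e n)"
    by (rule suminf_split_initial_segment[OF sm])
  moreover have "1 / (s - 1) = - 1 / (1 - s)" "x / (s - 1) = - x / (1 - s)" for x
    using assms by (simp_all add: divide_simps) (simp add: algebra_simps)
  ultimately show ?thesis unfolding riemann_zeta_em[OF assms]
    by (simp add: ring_distribs diff_divide_distrib)
qed

text \<open>The last condition says that \<open>N\<close> may be as short as \<open>U\<close> to the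
  power \<open>1 + 1 / i\<close>. It makes the final remainder of the repeated integration by parts,
  multiplied by \<open>s\<close>, of order \<open>(N + 1) powr (- Re s)\<close>, like the boundary
  terms. The exponent can be brought as close to 1 as desired.\<close>

lemma riemann_zeta_approx:
  assumes "i \<ge> 1"
  shows "\<exists>C\<ge>0. \<forall>s N U. Re s > 0 \<longrightarrow> s \<noteq> 1 \<longrightarrow> norm s + 1 + real i \<le> U \<longrightarrow> U ^ Suc i \<le> real (Suc N) ^ i \<longrightarrow>
     norm (riemann_zeta s - (\<Sum>n=1..N. of_nat n powr (- s))) \<le> real (Suc N) powr (1 - Re s) / norm (s - 1) + C * real (Suc N) powr (- Re s)"
proof -
  let ?q = "\<lambda>t::real. complex_of_real t - 1 / 2"
  have cq: "continuous_on {0..1} ?q" by (intro continuous_intros)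
  have "(?q has_integral
      ((\<lambda>t. (complex_of_real t)\<^sup>2 / 2 - complex_of_real t / 2) 1 - (\<lambda>t. (complex_of_real t)\<^sup>2 / 2 - complex_of_real t / 2) 0)) {0..1::real}"
    by (rule fundamental_theorem_of_calculus)
       (auto intro!: derivative_eq_intros has_vector_derivative_real_field)
  hence iq: "integral {0..1} ?q = 0" by (simp add: integral_unique)
  obtain C where C: "C \<ge> 0" "\<And>s N U. Re s > 0 \<Longrightarrow> norm s + real 1 + real i \<le> U \<Longrightarrow> U \<le> real (Suc N) \<Longrightarrow>
     norm (\<Sum>n. em_term ?q 1 (n + N) s) \<le> C * (real (Suc N) powr (- Re s - real 1) + U ^ i * real (Suc N) powr (1 - Re s - real 1 - real i))"
    using em_tail_bound[OF cq iq, of 1 i] assms by auto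
  show ?thesis
  proof (intro exI[of _ "2 * C + 1 / 2"] conjI allI impI)
    fix s N U assume s: "Re s > 0" "s \<noteq> 1" and U: "norm s + 1 + real i \<le> U" "U ^ Suc i \<le> real (Suc N) ^ i"
    define n where "n = real (Suc N)"
    have n: "n \<ge> 1" by (simp add: n_def)
    have U1: "U \<ge> 1" using U(1) norm_ge_zero[of s] by linarith
    have Un: "U \<le> n"
    proof (rule ccontr)
      assume "\<not> U \<le> n"
      hence "n ^ i \<le> U ^ i" "U > 1" using n by (auto intro!: power_mono)
      moreover have "U ^ i > 0" using U1 by simp
      ultimately have "n ^ i < U * U ^ i" by (smt (verit) mult_less_cancel_right1)
      thus False using U(2) by (simp add: n_def)
    qed
    have sU: "norm s \<le> U" using U(1) by simp
    let ?T = "\<Sum>n. em_term ?q 1 (n + N) s"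
    have "norm (s * ?T) \<le> U * (C * (n powr (- Re s - 1) + U ^ i * n powr (- Re s - real i)))"
      unfolding norm_mult using C(2)[OF s(1), of U N] U Un sU U1 unfolding n_def[symmetric]
      by (intro mult_mono) auto
    also have "\<dots> = C * (U * n powr (- Re s - 1) + U ^ Suc i * n powr (- Re s - real i))" by (simp add: algebra_simps)
    also have "\<dots> \<le> C * (n * n powr (- Re s - 1) + n ^ i * n powr (- Re s - real i))"
      using U Un C(1) n_def by (intro mult_left_mono add_mono mult_right_mono) auto
    also have "n * n powr (- Re s - 1) = n powr (1 + (- Re s - 1))" using n by (simp only: powr_add) simp
    also have "n ^ i * n powr (- Re s - real i) = n powr (real i + (- Re s - real i))"
      using n by (simp only: powr_add powr_realpow)
    finally have T: "norm (s * ?T) \<le> 2 * C * n powr (- Re s)" by simp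
    have "(\<Sum>n<N. complex_of_nat (Suc n) powr (- s)) = (\<Sum>n=1..N. of_nat n powr (- s))"
      by (rule sum.reindex_bij_witness[of _ "\<lambda>n. n - 1" Suc]) auto
    hence "riemann_zeta s - (\<Sum>n=1..N. of_nat n powr (- s)) = of_nat (Suc N) powr (1 - s) / (s - 1) + of_nat (Suc N) powr (- s) / 2 - s * ?T"
      unfolding riemann_zeta_em_tail[OF s, of N] by simp
    also have "norm \<dots> \<le> norm (of_nat (Suc N) powr (1 - s) / (s - 1)) + norm (of_nat (Suc N) powr (- s) / 2) + norm (s * ?T)"
      by (meson norm_triangle_ineq4 norm_triangle_ineq order_trans add_right_mono)
    also have "norm (of_nat (Suc N) powr (1 - s) / (s - 1)) = n powr (1 - Re s) / norm (s - 1)"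
      unfolding norm_divide n_def by (subst norm_powr_real_powr) (auto simp del: of_nat_Suc)
    also have "norm (of_nat (Suc N) powr (- s) / 2) = n powr (- Re s) / 2"
      unfolding norm_divide n_def by (subst norm_powr_real_powr) (auto simp del: of_nat_Suc)
    finally show "norm (riemann_zeta s - (\<Sum>n=1..N. of_nat n powr (- s))) \<le>
        real (Suc N) powr (1 - Re s) / norm (s - 1) + (2 * C + 1 / 2) * real (Suc N) powr (- Re s)"
      using T unfolding n_def by (simp add: algebra_simps)
  qed (use C in auto)
qed

section \<open>Mean squares of Dirichlet polynomials and of zeta\<close>

lemma ln_diff_ge:
  fixes x y :: real
  assumes "0 < x" "0 < y"
  shows "(y - x) / y \<le> ln y - ln x"
proof -
  have "ln (x / y) \<le> x / y - 1" using assms by (intro ln_le_minus_one) auto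
  thus ?thesis using assms by (simp add: ln_div diff_divide_distrib)
qed

lemma harmonic_le:
  assumes "N \<ge> 1"
  shows "(\<Sum>k=1..N. 1 / real k) \<le> 1 + ln (real N)"
  using assms
proof (induction N rule: dec_induct)
  case (step N)
  have "1 / real (Suc N) \<le> ln (real (Suc N)) - ln (real N)"
    using ln_diff_ge[of "real N" "real (Suc N)"] step by simp
  with step show ?case by simp
qed simp

lemma sum_powr_le_harmonic:
  assumes "\<alpha> \<le> 1"
  shows "(\<Sum>n=1..N. real n powr (- \<alpha>)) \<le> real N powr (1 - \<alpha>) * (\<Sum>n=1..N. 1 / real n)"
  unfolding sum_distrib_left
proof (rule sum_mono)
  fix n assume n: "n \<in> {1..N}"
  have "real n powr (- \<alpha>) = real n powr ((1 - \<alpha>) + (- 1))" by simp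
  also have "\<dots> = real n powr (1 - \<alpha>) * (1 / real n)"
    using n by (simp only: powr_add) (simp add: powr_minus divide_inverse)
  also have "\<dots> \<le> real N powr (1 - \<alpha>) * (1 / real n)"
    using n assms by (intro mult_right_mono powr_mono2) auto
  finally show "real n powr (- \<alpha>) \<le> real N powr (1 - \<alpha>) * (1 / real n)" .
qed

text \<open>The reciprocal of \<open>ln n - ln m\<close> is at most
  \<open>n / (n - m) = 1 + m / (n - m)\<close>. The first part gives the square of a single sum; in
  the second, \<open>n powr (- r) \<le> m powr (- r)\<close> leaves a sum over \<open>m\<close>
  times a harmonic sum over \<open>n - m\<close>. The squared logarithm is absorbed later by a saved
  power of \<open>T\<close>.\<close>

lemma offdiagonal_sum_le:
  assumes "1 / 2 \<le> r" "r \<le> 1" "N \<ge> 1"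
  shows "(\<Sum>(m,n)\<in>{(m,n). m \<in> {1..N} \<and> n \<in> {1..N} \<and> m < n}. real m powr (- r) * real n powr (- r) / (ln (real n) - ln (real m)))
     \<le> 2 * real N powr (2 - 2 * r) * (1 + ln (real N))\<^sup>2"
proof -
  define h where "h = (\<Sum>n=1..N. 1 / real n)"
  have h1: "h \<le> 1 + ln (real N)" unfolding h_def by (rule harmonic_le[OF assms(3)])
  have "h \<ge> (\<Sum>n\<in>{1}. 1 / real n)" unfolding h_def using assms by (intro sum_mono2) auto
  hence h: "h \<ge> 1" by simp
  let ?D = "{(m,n). m \<in> {1..N} \<and> n \<in> {1..N} \<and> m < n}"
  let ?f = "\<lambda>(m, n). real m powr (- r) * real n powr (- r)"
  let ?g = "\<lambda>(m, n). real m powr (- (2 * r - 1)) * (1 / real (n - m))"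
  have "(\<Sum>(m,n)\<in>?D. real m powr (- r) * real n powr (- r) / (ln (real n) - ln (real m))) \<le>
      (\<Sum>(m,n)\<in>?D. real m powr (- r) * real n powr (- r) + real m powr (- (2 * r - 1)) * (1 / real (n - m)))"
  proof (rule sum_mono, clarify)
    fix m n assume mn: "m \<in> {1..N}" "n \<in> {1..N}" "m < n"
    define x where "x = real m"
    define y where "y = real n"
    have xy: "0 < x" "x < y" using mn by (auto simp: x_def y_def)
    have "(y - x) / y \<le> ln y - ln x" by (rule ln_diff_ge) (use xy in auto)
    moreover have "(y - x) / y > 0" using xy by simp
    ultimately have "1 / (ln y - ln x) \<le> 1 / ((y - x) / y)" by (intro divide_left_mono mult_pos_pos) linarith+
    also have "\<dots> = 1 + x / (y - x)" using xy by (simp add: field_simps)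
    finally have "x powr (- r) * y powr (- r) * (1 / (ln y - ln x)) \<le> x powr (- r) * y powr (- r) * (1 + x / (y - x))"
      by (intro mult_left_mono) auto
    also have "\<dots> = x powr (- r) * y powr (- r) + x powr (- r) * y powr (- r) * x / (y - x)" by (simp add: algebra_simps)
    also have "x powr (- r) * y powr (- r) * x / (y - x) \<le> x powr (- r) * x powr (- r) * x / (y - x)"
      using xy assms by (intro divide_right_mono mult_right_mono mult_left_mono powr_mono2') auto
    also have "x powr (- r) * x powr (- r) * x = x powr (- (2 * r - 1))"
    proof -
      have "x powr (- r) * x powr (- r) * x = x powr (- r) * x powr (- r) * x powr 1" using xy by simp
      also have "\<dots> = x powr (- r + - r + 1)" by (simp only: powr_add)
      finally show ?thesis by simp
    qed
    finally show "real m powr (- r) * real n powr (- r) / (ln (real n) - ln (real m)) \<le>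
       real m powr (- r) * real n powr (- r) + real m powr (- (2 * r - 1)) * (1 / real (n - m))"
      using mn by (simp add: x_def y_def of_nat_diff)
  qed
  also have "\<dots> = sum ?f ?D + sum ?g ?D" by (simp only: sum.distrib case_prod_unfold)
  also have "sum ?f ?D \<le> sum ?f ({1..N} \<times> {1..N})" by (intro sum_mono2) auto
  also have "\<dots> = (\<Sum>n=1..N. real n powr (- r)) * (\<Sum>n=1..N. real n powr (- r))"
    by (simp add: sum_product sum.cartesian_product)
  also have "\<dots> \<le> (real N powr (1 - r) * h) * (real N powr (1 - r) * h)"
    unfolding h_def by (intro mult_mono sum_powr_le_harmonic mult_nonneg_nonneg sum_nonneg) (use assms in auto)
  also have "\<dots> = (real N powr (1 - r) * real N powr (1 - r)) * h\<^sup>2" by (simp add: power2_eq_square mult_ac)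
  also have "real N powr (1 - r) * real N powr (1 - r) = real N powr (2 - 2 * r)" by (simp only: powr_add[symmetric]) simp
  also have "sum ?g ?D = (\<Sum>(m,k)\<in>(\<lambda>(m,n). (m, n - m)) ` ?D. real m powr (- (2 * r - 1)) * (1 / real k))"
    by (subst sum.reindex) (auto simp: inj_on_def case_prod_unfold)
  also have "\<dots> \<le> (\<Sum>(m,k)\<in>{1..N} \<times> {1..N}. real m powr (- (2 * r - 1)) * (1 / real k))"
    by (intro sum_mono2) auto
  also have "\<dots> = (\<Sum>m=1..N. real m powr (- (2 * r - 1))) * h"
    by (simp only: h_def sum_product sum.cartesian_product)
  also have "\<dots> \<le> (real N powr (1 - (2 * r - 1)) * h) * h"
    unfolding h_def by (intro mult_right_mono sum_powr_le_harmonic sum_nonneg) (use assms in auto)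
  also have "\<dots> = real N powr (2 - 2 * r) * h\<^sup>2" by (simp add: power2_eq_square mult_ac)
  finally have "(\<Sum>(m,n)\<in>?D. real m powr (- r) * real n powr (- r) / (ln (real n) - ln (real m))) \<le> 2 * real N powr (2 - 2 * r) * h\<^sup>2"
    by (simp add: mult_ac)
  also have "\<dots> \<le> 2 * real N powr (2 - 2 * r) * (1 + ln (real N))\<^sup>2"
    using h h1 by (intro mult_left_mono power_mono) auto
  finally show ?thesis .
qed

text \<open>Off the diagonal each integral is at most \<open>2 / \<bar>ln n - ln m\<bar>\<close>,
  and both orders of \<open>m\<close> and \<open>n\<close> occur, whence 8 from
  \<open>2 * 2 * 2\<close>. The set \<open>J\<close> is arbitrary because it will be the complement
  of a support that is not an interval.\<close>

lemma dirichlet_poly_mean_square: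
  fixes c :: "nat \<Rightarrow> complex"
  assumes J: "J \<subseteq> {1..N}" and c: "\<And>n. n \<in> J \<Longrightarrow> norm (c n) \<le> real n powr (- r)"
    and r: "1 / 2 \<le> r" "r \<le> 1" and "N \<ge> 1" "T \<ge> 0"
  shows "integral {-T..T} (\<lambda>t. (norm (\<Sum>n\<in>J. c n * cis (- ln (real n) * t)))\<^sup>2)
     \<le> 2 * T * (\<Sum>n\<in>J. real n powr (- (2 * r))) + 8 * real N powr (2 - 2 * r) * (1 + ln (real N))\<^sup>2"
proof -
  have finJ: "finite J" using J finite_subset by blast
  let ?F = "\<lambda>t. \<Sum>n\<in>J. c n * cis (- ln (real n) * t)"
  let ?l = "\<lambda>m n. ln (real n) - ln (real m)"
  have sq: "complex_of_real ((norm (?F t))\<^sup>2) = (\<Sum>(m,n)\<in>J \<times> J. (c m * cnj (c n)) * cis (?l m n * t))" for t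
  proof -
    have "complex_of_real ((norm (?F t))\<^sup>2) = ?F t * cnj (?F t)" by (rule complex_norm_square)
    also have "\<dots> = (\<Sum>(m,n)\<in>J \<times> J. (c m * cis (- ln (real m) * t)) * cnj (c n * cis (- ln (real n) * t)))"
      by (simp add: sum_product sum.cartesian_product)
    also have "\<dots> = (\<Sum>(m,n)\<in>J \<times> J. (c m * cnj (c n)) * cis (?l m n * t))"
    proof (intro sum.cong refl, clarify)
      fix m n
      have "?l m n * t = - ln (real m) * t + ln (real n) * t" by (simp add: algebra_simps)
      hence "cis (?l m n * t) = cis (- ln (real m) * t) * cis (ln (real n) * t)" by (simp only: cis_mult)
      thus "(c m * cis (- ln (real m) * t)) * cnj (c n * cis (- ln (real n) * t)) = (c m * cnj (c n)) * cis (?l m n * t)"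
        by (simp add: cis_cnj mult_ac)
    qed
    finally show ?thesis .
  qed
  have "complex_of_real (integral {-T..T} (\<lambda>t. (norm (?F t))\<^sup>2)) = integral {-T..T} (\<lambda>t. complex_of_real ((norm (?F t))\<^sup>2))"
    by (rule integral_of_real_continuous[symmetric]) (intro continuous_intros)
  also have "\<dots> = integral {-T..T} (\<lambda>t. \<Sum>x\<in>J \<times> J. case x of (m, n) \<Rightarrow> (c m * cnj (c n)) * cis (?l m n * t))"
    by (simp only: sq)
  also have "\<dots> = (\<Sum>x\<in>J \<times> J. integral {-T..T} (\<lambda>t. case x of (m, n) \<Rightarrow> (c m * cnj (c n)) * cis (?l m n * t)))"
    by (rule integral_sum) (use finJ in \<open>auto intro!: integrable_continuous_real continuous_intros\<close>)
  also have "\<dots> = (\<Sum>(m,n)\<in>J \<times> J. (c m * cnj (c n)) * integral {-T..T} (\<lambda>t. cis (?l m n * t)))"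
    by (intro sum.cong) auto
  finally have eqI: "complex_of_real (integral {-T..T} (\<lambda>t. (norm (?F t))\<^sup>2)) =
    (\<Sum>(m,n)\<in>J \<times> J. (c m * cnj (c n)) * integral {-T..T} (\<lambda>t. cis (?l m n * t)))" .
  have "integral {-T..T} (\<lambda>t. (norm (?F t))\<^sup>2) \<le> norm (complex_of_real (integral {-T..T} (\<lambda>t. (norm (?F t))\<^sup>2)))"
    unfolding norm_of_real by (rule abs_ge_self)
  also have "\<dots> = norm (\<Sum>(m,n)\<in>J \<times> J. (c m * cnj (c n)) * integral {-T..T} (\<lambda>t. cis (?l m n * t)))"
    by (simp only: eqI)
  also have "\<dots> \<le> (\<Sum>(m,n)\<in>J \<times> J. real m powr (- r) * real n powr (- r) * norm (integral {-T..T} (\<lambda>t. cis (?l m n * t))))"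
    unfolding case_prod_unfold
  proof (rule sum_norm_le)
    fix x :: "nat \<times> nat" assume "x \<in> J \<times> J"
    hence "norm (c (fst x)) \<le> real (fst x) powr (- r)" "norm (c (snd x)) \<le> real (snd x) powr (- r)" using c by auto
    thus "norm (c (fst x) * cnj (c (snd x)) * integral {-T..T} (\<lambda>t. cis (?l (fst x) (snd x) * t))) \<le>
      real (fst x) powr (- r) * real (snd x) powr (- r) * norm (integral {-T..T} (\<lambda>t. cis (?l (fst x) (snd x) * t)))"
      unfolding norm_mult complex_mod_cnj by (intro mult_mono mult_nonneg_nonneg) auto
  qed
  also have "\<dots> \<le> (\<Sum>(m,n)\<in>J \<times> J. (if m = n then 2 * T * real n powr (- (2 * r)) else 0)
      + (if m < n then 2 * (real m powr (- r) * real n powr (- r) / ?l m n) else 0)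
      + (if n < m then 2 * (real n powr (- r) * real m powr (- r) / ?l n m) else 0))"
  proof (rule sum_mono, clarify)
    fix m n assume mn: "m \<in> J" "n \<in> J"
    hence mn0: "m > 0" "n > 0" using J by (auto simp: subset_iff)
    have int: "real m powr (- r) * real n powr (- r) * norm (integral {-T..T} (\<lambda>t. cis (?l m n * t))) \<le>
        real m powr (- r) * real n powr (- r) * (2 / \<bar>?l m n\<bar>)" if "m \<noteq> n"
      by (intro mult_left_mono integral_cis_bound) (use mn0 that \<open>T \<ge> 0\<close> in auto)
    consider "m = n" | "m < n" | "n < m" by linarith
    thus "real m powr (- r) * real n powr (- r) * norm (integral {-T..T} (\<lambda>t. cis (?l m n * t))) \<le>
      (if m = n then 2 * T * real n powr (- (2 * r)) else 0)
      + (if m < n then 2 * (real m powr (- r) * real n powr (- r) / ?l m n) else 0)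
      + (if n < m then 2 * (real n powr (- r) * real m powr (- r) / ?l n m) else 0)"
    proof cases
      case 1
      have "real n powr (- r) * real n powr (- r) = real n powr (- (2 * r))" by (simp only: powr_add[symmetric]) simp
      thus ?thesis using 1 \<open>T \<ge> 0\<close> by simp
    next
      case 2
      hence "\<bar>?l m n\<bar> = ?l m n" using mn0 by simp
      thus ?thesis using int 2 by (simp add: mult_ac)
    next
      case 3
      hence "\<bar>?l m n\<bar> = ?l n m" using mn0 by simp
      thus ?thesis using int 3 by (simp add: mult_ac)
    qed
  qed
  also have "\<dots> = (\<Sum>(m,n)\<in>J \<times> J. (if m = n then 2 * T * real n powr (- (2 * r)) else 0))
      + (\<Sum>(m,n)\<in>J \<times> J. (if m < n then 2 * (real m powr (- r) * real n powr (- r) / ?l m n) else 0))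
      + (\<Sum>(m,n)\<in>J \<times> J. (if n < m then 2 * (real n powr (- r) * real m powr (- r) / ?l n m) else 0))"
    by (simp only: sum.distrib case_prod_unfold)
  also have "(\<Sum>(m,n)\<in>J \<times> J. (if n < m then 2 * (real n powr (- r) * real m powr (- r) / ?l n m) else 0)) =
     (\<Sum>(m,n)\<in>J \<times> J. (if m < n then 2 * (real m powr (- r) * real n powr (- r) / ?l m n) else 0))"
    by (rule sum.reindex_bij_witness[of _ prod.swap prod.swap]) auto
  also have "(\<Sum>(m,n)\<in>J \<times> J. (if m = n then 2 * T * real n powr (- (2 * r)) else 0)) = 2 * T * (\<Sum>n\<in>J. real n powr (- (2 * r)))"
  proof -
    have "(\<Sum>(m,n)\<in>J \<times> J. (if m = n then 2 * T * real n powr (- (2 * r)) else 0)) = (\<Sum>m\<in>J. \<Sum>n\<in>J. if m = n then 2 * T * real n powr (- (2 * r)) else 0)"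
      by (simp only: sum.cartesian_product)
    also have "\<dots> = (\<Sum>m\<in>J. 2 * T * real m powr (- (2 * r)))" using finJ by simp
    finally show ?thesis by (simp add: sum_distrib_left)
  qed
  also have "(\<Sum>(m,n)\<in>J \<times> J. (if m < n then 2 * (real m powr (- r) * real n powr (- r) / ?l m n) else 0)) \<le>
      (\<Sum>(m,n)\<in>{(m,n). m \<in> {1..N} \<and> n \<in> {1..N} \<and> m < n}. 2 * (real m powr (- r) * real n powr (- r) / ?l m n))"
  proof -
    let ?D = "{(m,n). m \<in> {1..N} \<and> n \<in> {1..N} \<and> m < n}"
    have finD: "finite ?D" by (rule finite_subset[of _ "{1..N} \<times> {1..N}"]) auto
    have "(\<Sum>(m,n)\<in>J \<times> J. (if m < n then 2 * (real m powr (- r) * real n powr (- r) / ?l m n) else 0)) =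
        (\<Sum>(m,n)\<in>?D \<inter> J \<times> J. 2 * (real m powr (- r) * real n powr (- r) / ?l m n))"
      using finJ J by (intro sum.mono_neutral_cong_right) (auto split: if_splits)
    also have "\<dots> \<le> (\<Sum>(m,n)\<in>?D. 2 * (real m powr (- r) * real n powr (- r) / ?l m n))"
      using finD by (intro sum_mono2) auto
    finally show ?thesis .
  qed
  also have "(\<Sum>(m,n)\<in>{(m,n). m \<in> {1..N} \<and> n \<in> {1..N} \<and> m < n}. 2 * (real m powr (- r) * real n powr (- r) / ?l m n)) =
     2 * (\<Sum>(m,n)\<in>{(m,n). m \<in> {1..N} \<and> n \<in> {1..N} \<and> m < n}. real m powr (- r) * real n powr (- r) / ?l m n)"
    by (simp only: sum_distrib_left case_prod_unfold)
  finally have "integral {-T..T} (\<lambda>t. (norm (?F t))\<^sup>2) \<le> 2 * T * (\<Sum>n\<in>J. real n powr (- (2 * r))) + 4 *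
      (\<Sum>(m,n)\<in>{(m,n). m \<in> {1..N} \<and> n \<in> {1..N} \<and> m < n}. real m powr (- r) * real n powr (- r) / ?l m n)" by simp
  thus ?thesis using offdiagonal_sum_le[OF r assms(5)] by simp
qed

section \<open>The mean square of zeta minus a Dirichlet polynomial\<close>

lemma integral_pole_le:
  assumes "Re s \<le> \<rho>" "\<rho> < 1" "T \<ge> 0"
  shows "integral {-T..T} (\<lambda>t. 1 / (norm (s + \<i> * of_real t - 1))\<^sup>2) \<le> pi / (1 - \<rho>)"
proof -
  \<comment> \<open>The distance of the vertical line from the pole. The integral is a difference of
    arctangents over \<open>u\<close>, so it is bounded independently of \<open>T\<close>.\<close>
  define u where "u = 1 - Re s"
  have u: "u > 0" "u \<ge> 1 - \<rho>" using assms by (auto simp: u_def)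
  have eq: "(norm (s + \<i> * of_real t - 1))\<^sup>2 = u\<^sup>2 + (Im s + t)\<^sup>2" for t
    by (simp add: cmod_power2 u_def power2_commute)
  have "((\<lambda>t. 1 / (u\<^sup>2 + (Im s + t)\<^sup>2)) has_integral (arctan ((Im s + T) / u) / u - arctan ((Im s + - T) / u) / u)) {-T..T}"
  proof (rule fundamental_theorem_of_calculus)
    fix t assume "t \<in> {-T..T}"
    have "((\<lambda>t. arctan ((Im s + t) / u) / u) has_real_derivative (1 / (1 + ((Im s + t) / u)\<^sup>2) * (1 / u)) / u) (at t within {-T..T})"
      using u by (auto intro!: derivative_eq_intros simp: divide_inverse)
    moreover have "(1 / (1 + ((Im s + t) / u)\<^sup>2) * (1 / u)) / u = 1 / (u\<^sup>2 + (Im s + t)\<^sup>2)"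
    proof -
      have "u\<^sup>2 * (1 + ((Im s + t) / u)\<^sup>2) = u\<^sup>2 + (Im s + t)\<^sup>2" using u by (simp add: field_simps)
      thus ?thesis by (simp add: power2_eq_square mult_ac)
    qed
    ultimately show "((\<lambda>t. arctan ((Im s + t) / u) / u) has_vector_derivative 1 / (u\<^sup>2 + (Im s + t)\<^sup>2)) (at t within {-T..T})"
      by (simp add: has_real_derivative_iff_has_vector_derivative)
  qed (use assms in auto)
  hence "integral {-T..T} (\<lambda>t. 1 / (norm (s + \<i> * of_real t - 1))\<^sup>2) = (arctan ((Im s + T) / u) - arctan ((Im s + - T) / u)) / u"
    unfolding eq by (simp add: integral_unique diff_divide_distrib)
  also have "\<dots> \<le> pi / u"
    using arctan_bounded[of "(Im s + T) / u"] arctan_bounded[of "(Im s + - T) / u"] u by (intro divide_right_mono) auto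
  also have "\<dots> \<le> pi / (1 - \<rho>)" using u assms by (intro divide_left_mono) auto
  finally show ?thesis .
qed

lemma riemann_zeta_line_continuous:
  assumes "Re s < 1"
  shows "continuous_on A (\<lambda>t. riemann_zeta (s + \<i> * of_real (c * t)))"
proof -
  have "s + \<i> * of_real (c * t) \<noteq> 1" for t
    using assms by (metis Re_complex_of_real Re_i_times Im_complex_of_real add.right_neutral less_irrefl minus_zero one_complex.simps(1) plus_complex.simps(1))
  thus ?thesis
    by (intro continuous_on_compose2[OF holomorphic_on_imp_continuous_on[OF riemann_zeta_holomorphic]] continuous_intros) auto
qed

lemma dirichlet_poly_line_continuous:
  assumes "finite S" "0 \<notin> S"
  shows "continuous_on A (\<lambda>t. \<Sum>n\<in>S. complex_of_nat n powr (- (s + \<i> * of_real (c * t))))"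
proof (intro continuous_on_sum)
  fix n assume "n \<in> S"
  hence "n \<noteq> 0" using assms by metis
  thus "continuous_on A (\<lambda>t. complex_of_nat n powr (- (s + \<i> * of_real (c * t))))"
    by (simp add: powr_def) (intro continuous_intros)
qed

text \<open>Up to squared logarithms everything is of order
  \<open>T powr (\<kappa> * \<beta>)\<close>, hence small compared with \<open>T\<close>. The
  expression \<open>3 * (2 * T) powr \<kappa>\<close> is the bound for the length of the Dirichlet
  polynomial.\<close>

lemma mean_square_error_asymp:
  fixes \<kappa> \<beta> p q \<eta> :: real
  assumes "\<kappa> * \<beta> < 1" "\<kappa> > 0" "\<beta> > 0" "\<eta> > 0"
  shows "\<forall>\<^sub>F T in at_top. (3 * (2 * T) powr \<kappa>) powr \<beta> * p + q + 8 * ((3 * (2 * T) powr \<kappa>) powr \<beta> * (1 + ln (3 * (2 * T) powr \<kappa>))\<^sup>2) \<le> \<eta> * T"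
proof -
  define \<gamma> where "\<gamma> = \<kappa> * \<beta> - 1"
  have g: "\<gamma> < 0" using assms by (simp add: \<gamma>_def)
  define A where "A = 3 powr \<beta> * 2 powr (\<kappa> * \<beta>)"
  define B where "B = 1 + ln 3 + \<kappa> * ln 2"
  have "((\<lambda>T::real. A * T powr \<gamma> * p + q / T + 8 * (A * T powr \<gamma> * (B + \<kappa> * ln T)\<^sup>2)) \<longlongrightarrow> 0) at_top"
  proof -
    have t: "((\<lambda>T::real. T powr \<gamma>) \<longlongrightarrow> 0) at_top" "((\<lambda>T::real. T powr \<gamma> * ln T) \<longlongrightarrow> 0) at_top"
       "((\<lambda>T::real. T powr \<gamma> * (ln T)\<^sup>2) \<longlongrightarrow> 0) at_top" "((\<lambda>T::real. 1 / T) \<longlongrightarrow> 0) at_top"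
      using g by real_asymp+
    have "((\<lambda>T::real. (A * p + 8 * A * B\<^sup>2) * (T powr \<gamma>) + q * (1 / T) + (16 * A * B * \<kappa>) * (T powr \<gamma> * ln T)
        + (8 * A * \<kappa>\<^sup>2) * (T powr \<gamma> * (ln T)\<^sup>2)) \<longlongrightarrow>
        (A * p + 8 * A * B\<^sup>2) * 0 + q * 0 + (16 * A * B * \<kappa>) * 0 + (8 * A * \<kappa>\<^sup>2) * 0) at_top"
      by (intro tendsto_intros t)
    thus ?thesis by (simp add: power2_eq_square algebra_simps)
  qed
  hence "\<forall>\<^sub>F T in at_top. A * T powr \<gamma> * p + q / T + 8 * (A * T powr \<gamma> * (B + \<kappa> * ln T)\<^sup>2) < \<eta>"
    using assms by (intro order_tendstoD) auto
  thus ?thesis using eventually_gt_at_top[of 0]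
  proof eventually_elim
    case (elim T)
    have 1: "(3 * (2 * T) powr \<kappa>) powr \<beta> = A * T powr \<gamma> * T"
    proof -
      have "(3 * (2 * T) powr \<kappa>) powr \<beta> = 3 powr \<beta> * (2 powr (\<kappa> * \<beta>) * T powr (\<kappa> * \<beta>))"
        using elim by (simp add: powr_mult powr_powr)
      also have "T powr (\<kappa> * \<beta>) = T powr (\<gamma> + 1)" by (simp add: \<gamma>_def)
      also have "\<dots> = T powr \<gamma> * T" using elim by (simp add: powr_add)
      finally show ?thesis by (simp add: A_def)
    qed
    have 2: "1 + ln (3 * (2 * T) powr \<kappa>) = B + \<kappa> * ln T"
      using elim by (simp add: B_def ln_mult ln_powr algebra_simps)
    have "T * (A * T powr \<gamma> * p + q / T + 8 * (A * T powr \<gamma> * (B + \<kappa> * ln T)\<^sup>2)) \<le> T * \<eta>"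
      using elim by (intro mult_left_mono) auto
    thus ?case unfolding 1 2 using elim by (simp add: algebra_simps)
  qed
qed

text \<open>The difference splits into the error of a partial sum up to some
  \<open>N \<ge> Max S\<close> and a Dirichlet polynomial over \<open>{1..N} - S\<close>. The latter
  starts beyond \<open>M\<close>, so its diagonal is a small tail, while off the diagonal only
  \<open>o(T)\<close> arises. \<open>M\<close> is chosen before \<open>S\<close>. The symmetric
  interval prepares for scaling by numbers of either sign.\<close>

lemma riemann_zeta_mean_square:
  assumes r: "1 / 2 < r" "r < 1" and \<rho>: "\<rho> < 1" and \<eta>: "\<eta> > 0"
  shows "\<exists>M. \<forall>S. finite S \<longrightarrow> 0 \<notin> S \<longrightarrow> {1..M} \<subseteq> S \<longrightarrow>
     (\<forall>\<^sub>F T in at_top. \<forall>s\<in>{s. r \<le> Re s \<and> Re s \<le> \<rho> \<and> norm s \<le> H}.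
        integral {-T..T} (\<lambda>t. (norm (riemann_zeta (s + \<i> * of_real t) - (\<Sum>n\<in>S. of_nat n powr (- (s + \<i> * of_real t)))))\<^sup>2) \<le> \<eta> * T)"
proof -
  define \<beta> where "\<beta> = 2 - 2 * r"
  have \<beta>: "0 < \<beta>" "\<beta> < 1" using r by (auto simp: \<beta>_def)
  have "1 / \<beta> - 1 > 0" using \<beta> by simp
  \<comment> \<open>This yields \<open>\<kappa> * \<beta> < 1\<close> for the exponent
    \<open>\<kappa> = 1 + 1 / i\<close> of the length.\<close>
  then obtain i0 where i0: "1 / real (Suc i0) < 1 / \<beta> - 1" using nat_approx_posE by blast
  define i where "i = Suc i0"
  define \<kappa> where "\<kappa> = 1 + 1 / real i"
  have i: "i \<ge> 1" by (simp add: i_def)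
  have \<kappa>: "\<kappa> \<ge> 1" by (simp add: \<kappa>_def)
  have "\<kappa> < 1 / \<beta>" using i0 unfolding \<kappa>_def i_def by linarith
  hence \<kappa>\<beta>: "\<kappa> * \<beta> < 1" using \<beta> by (simp add: field_simps)
  obtain C where C: "C \<ge> 0" "\<And>s N U. Re s > 0 \<Longrightarrow> s \<noteq> 1 \<Longrightarrow> norm s + 1 + real i \<le> U \<Longrightarrow> U ^ Suc i \<le> real (Suc N) ^ i \<Longrightarrow>
     norm (riemann_zeta s - (\<Sum>n=1..N. of_nat n powr (- s))) \<le> real (Suc N) powr (1 - Re s) / norm (s - 1) + C * real (Suc N) powr (- Re s)"
    using riemann_zeta_approx[OF i] by auto
  \<comment> \<open>Squaring a sum of three terms brings a factor 3. Over an interval of length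
    \<open>2 * T\<close> the number \<open>\<eta> / 12\<close> then contributes
    \<open>\<eta> * T / 2\<close>, and \<open>\<eta> / 6\<close> below contributes the other
    half.\<close>
  have \<eta>12: "\<eta> / 12 > 0" using \<eta> by simp
  obtain M where M: "\<And>J. finite J \<Longrightarrow> (\<forall>n\<in>J. n > M) \<Longrightarrow> (\<Sum>n\<in>J. real n powr (- (2 * r))) \<le> \<eta> / 12"
    using powr_tail_small[OF _ \<eta>12, of "2 * r"] r by auto
  have \<eta>6: "\<eta> / 6 > 0" using \<eta> by simp
  have \<kappa>0: "\<kappa> > 0" using \<kappa> by simp
  show ?thesis
  proof (rule exI[of _ M], intro allI impI)
    fix S assume S: "finite S" "0 \<notin> S" "{1..M} \<subseteq> S"
    \<comment> \<open>Once \<open>T\<close> exceeds all elements of \<open>S\<close>, the partial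
      sum up to \<open>N \<ge> T\<close> covers \<open>S\<close>. Inserting 0 keeps the maximum
      defined for empty \<open>S\<close>.\<close>
    have "\<forall>\<^sub>F T in at_top. T \<ge> max (\<bar>H\<bar> + 1 + real i) (real (Max (insert 0 S)))" by (rule eventually_ge_at_top)
    thus "\<forall>\<^sub>F T in at_top. \<forall>s\<in>{s. r \<le> Re s \<and> Re s \<le> \<rho> \<and> norm s \<le> H}.
        integral {-T..T} (\<lambda>t. (norm (riemann_zeta (s + \<i> * of_real t) - (\<Sum>n\<in>S. of_nat n powr (- (s + \<i> * of_real t)))))\<^sup>2) \<le> \<eta> * T"
      using mean_square_error_asymp[OF \<kappa>\<beta> \<kappa>0 \<beta>(1) \<eta>6, of "pi / (1 - \<rho>)" "2 * C\<^sup>2"]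
    proof eventually_elim
      case (elim T)
      have T: "T \<ge> \<bar>H\<bar> + 1 + real i" "T \<ge> real (Max (insert 0 S))" using elim(1) by auto
      have T1: "T \<ge> 1" using T(1) by linarith
      define U where "U = \<bar>H\<bar> + 1 + real i + T"
      have U: "U \<ge> T" "U \<le> 2 * T" "U \<ge> 1" using T T1 by (auto simp: U_def)
      define N where "N = nat \<lceil>U powr \<kappa>\<rceil>"
      have N1: "real N \<ge> U powr \<kappa>" unfolding N_def by linarith
      have "U powr 1 \<le> U powr \<kappa>" using U \<kappa> by (intro powr_mono) auto
      hence N2: "real N \<ge> U" using N1 U by simp
      hence N3: "N \<ge> 1" "real N \<ge> T" using U by linarith+
      define Y where "Y = 3 * (2 * T) powr \<kappa>"
      have "real (Suc N) \<le> U powr \<kappa> + 2"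
        unfolding N_def using powr_ge_zero[of U \<kappa>] by linarith
      also have "\<dots> \<le> (2 * T) powr \<kappa> + 2" using U \<kappa> by (intro add_mono powr_mono2) auto
      also have "(2 * T) powr 1 \<le> (2 * T) powr \<kappa>" using T1 \<kappa> by (intro powr_mono) auto
      hence "(2 * T) powr \<kappa> + 2 \<le> Y" using T1 unfolding Y_def by simp
      finally have NY: "real (Suc N) \<le> Y" .
      have Ui: "U ^ Suc i \<le> real (Suc N) ^ i"
      proof -
        have "U ^ Suc i = U powr (real (Suc i))" using U by (intro powr_realpow[symmetric]) auto
        also have "real (Suc i) = \<kappa> * real i" using i by (simp add: \<kappa>_def field_simps)
        also have "U powr (\<kappa> * real i) = (U powr \<kappa>) powr real i" by (simp add: powr_powr)
        also have "\<dots> = (U powr \<kappa>) ^ i" using U by (intro powr_realpow) auto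
        also have "\<dots> \<le> real (Suc N) ^ i" using N1 by (intro power_mono) auto
        finally show ?thesis .
      qed
      have SN: "S \<subseteq> {1..N}"
      proof
        fix n assume n: "n \<in> S"
        hence "n \<le> Max (insert 0 S)" using S by (intro Max_ge) auto
        hence "real n \<le> T" using T(2) by linarith
        hence "n \<le> N" using N3 by linarith
        moreover have "n \<noteq> 0" using n S by metis
        ultimately show "n \<in> {1..N}" by auto
      qed
      define J where "J = {1..N} - S"
      have J: "J \<subseteq> {1..N}" "finite J" "\<forall>n\<in>J. n > M" using S(3) by (auto simp: J_def subset_iff not_le[symmetric])
      show ?case
      proof
        fix s assume "s \<in> {s. r \<le> Re s \<and> Re s \<le> \<rho> \<and> norm s \<le> H}"
        hence s: "r \<le> Re s" "Re s \<le> \<rho>" "norm s \<le> H" by auto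
        let ?z = "\<lambda>t. s + \<i> * of_real t"
        let ?Q = "\<lambda>t. \<Sum>n\<in>J. complex_of_nat n powr (- s) * cis (- ln (real n) * t)"
        let ?d = "\<lambda>t. norm (riemann_zeta (?z t) - (\<Sum>n\<in>S. of_nat n powr (- ?z t)))"
        let ?n = "real (Suc N)"
        have z1: "?z t \<noteq> 1" for t using s \<rho> by (auto simp: complex_eq_iff)
        have d: "(?d t)\<^sup>2 \<le> 3 * (?n powr \<beta> * (1 / (norm (?z t - 1))\<^sup>2) + C\<^sup>2 / T + (norm (?Q t))\<^sup>2)" if t: "t \<in> {-T..T}" for t
        proof -
          have "norm (?z t) \<le> norm s + \<bar>t\<bar>" using norm_triangle_ineq[of s "\<i> * of_real t"] by (simp add: norm_mult)
          hence zU: "norm (?z t) + 1 + real i \<le> U" using s t unfolding U_def by auto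
          have "(\<Sum>n=1..N. complex_of_nat n powr (- ?z t)) = (\<Sum>n\<in>S. of_nat n powr (- ?z t)) + (\<Sum>n\<in>J. of_nat n powr (- ?z t))"
            unfolding J_def using SN by (subst sum.subset_diff[OF SN]) auto
          also have "(\<Sum>n\<in>J. complex_of_nat n powr (- ?z t)) = ?Q t"
          proof (rule sum.cong)
            fix n assume "n \<in> J"
            hence "n > 0" using J by auto
            thus "complex_of_nat n powr (- ?z t) = complex_of_nat n powr (- s) * cis (- ln (real n) * t)"
              using of_nat_powr_shift[of n s 1 t] by simp
          qed simp
          finally have "riemann_zeta (?z t) - (\<Sum>n\<in>S. of_nat n powr (- ?z t)) = (riemann_zeta (?z t) - (\<Sum>n=1..N. of_nat n powr (- ?z t))) + ?Q t"
            by simp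
          hence "?d t \<le> norm (riemann_zeta (?z t) - (\<Sum>n=1..N. of_nat n powr (- ?z t))) + norm (?Q t)"
            by (simp only: norm_triangle_ineq)
          also have "norm (riemann_zeta (?z t) - (\<Sum>n=1..N. of_nat n powr (- ?z t))) \<le>
             ?n powr (1 - Re (?z t)) / norm (?z t - 1) + C * ?n powr (- Re (?z t))"
            by (rule C(2)[OF _ z1 zU Ui]) (use s r in simp)
          also have "\<dots> \<le> ?n powr (1 - r) / norm (?z t - 1) + C * ?n powr (- r)"
            using s C(1) by (intro add_mono divide_right_mono mult_left_mono powr_mono) auto
          finally have "(?d t)\<^sup>2 \<le> (?n powr (1 - r) / norm (?z t - 1) + C * ?n powr (- r) + norm (?Q t))\<^sup>2"
            by (intro power_mono) auto
          also have "\<dots> \<le> 3 * ((?n powr (1 - r) / norm (?z t - 1))\<^sup>2 + (C * ?n powr (- r))\<^sup>2 + (norm (?Q t))\<^sup>2)"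
            by (rule power2_add3_le)
          also have "(?n powr (1 - r) / norm (?z t - 1))\<^sup>2 = ?n powr \<beta> * (1 / (norm (?z t - 1))\<^sup>2)"
          proof -
            have "(?n powr (1 - r))\<^sup>2 = ?n powr \<beta>" by (simp add: \<beta>_def power2_eq_square powr_add[symmetric])
            thus ?thesis by (simp add: power_divide)
          qed
          also have "(C * ?n powr (- r))\<^sup>2 \<le> C\<^sup>2 / T"
          proof -
            have "(?n powr (- r))\<^sup>2 = ?n powr (- (2 * r))" by (simp add: power2_eq_square powr_add[symmetric])
            also have "\<dots> \<le> ?n powr (- 1)" using r by (intro powr_mono) auto
            also have "\<dots> = 1 / ?n" by (simp add: powr_minus divide_inverse del: of_nat_Suc)
            also have "\<dots> \<le> 1 / T" using N3 T1 by (intro divide_left_mono) auto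
            finally have "C\<^sup>2 * (?n powr (- r))\<^sup>2 \<le> C\<^sup>2 * (1 / T)" by (intro mult_left_mono) auto
            thus ?thesis by (simp add: power_mult_distrib)
          qed
          finally show ?thesis by simp
        qed
        have cz: "continuous_on {-T..T} (\<lambda>t. 1 / (norm (?z t - 1))\<^sup>2)"
          using z1 by (intro continuous_intros) auto
        have cQ: "continuous_on {-T..T} (\<lambda>t. (norm (?Q t))\<^sup>2)" by (intro continuous_intros)
        have cd: "continuous_on {-T..T} (\<lambda>t. (?d t)\<^sup>2)"
          using riemann_zeta_line_continuous[of s "{-T..T}" 1] dirichlet_poly_line_continuous[OF S(1,2), of "{-T..T}" s 1] s \<rho>
          by (intro continuous_on_power continuous_on_norm continuous_on_diff) simp_all
        have "integral {-T..T} (\<lambda>t. (?d t)\<^sup>2) \<le> integral {-T..T} (\<lambda>t. 3 * (?n powr \<beta> * (1 / (norm (?z t - 1))\<^sup>2) + C\<^sup>2 / T + (norm (?Q t))\<^sup>2))"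
          by (intro integral_le integrable_continuous_real d cd) (intro continuous_intros cz cQ)
        also have "\<dots> = 3 * (?n powr \<beta> * integral {-T..T} (\<lambda>t. 1 / (norm (?z t - 1))\<^sup>2) + 2 * T * (C\<^sup>2 / T) + integral {-T..T} (\<lambda>t. (norm (?Q t))\<^sup>2))"
        proof -
          have "((\<lambda>t. 3 * (?n powr \<beta> * (1 / (norm (?z t - 1))\<^sup>2) + C\<^sup>2 / T + (norm (?Q t))\<^sup>2)) has_integral
             3 * (?n powr \<beta> * integral {-T..T} (\<lambda>t. 1 / (norm (?z t - 1))\<^sup>2) + (T - (- T)) *\<^sub>R (C\<^sup>2 / T) + integral {-T..T} (\<lambda>t. (norm (?Q t))\<^sup>2))) {-T..T}"
            using has_integral_const_real[of "C\<^sup>2 / T" "- T" T] T1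
            by (intro has_integral_mult_right has_integral_add integrable_integral integrable_continuous_real cz cQ) auto
          thus ?thesis by (simp add: integral_unique)
        qed
        also have "2 * T * (C\<^sup>2 / T) = 2 * C\<^sup>2" using T1 by simp
        also have "integral {-T..T} (\<lambda>t. (norm (?Q t))\<^sup>2) \<le> 2 * T * (\<Sum>n\<in>J. real n powr (- (2 * r))) + 8 * real N powr (2 - 2 * r) * (1 + ln (real N))\<^sup>2"
          by (rule dirichlet_poly_mean_square[OF J(1)]) (use norm_of_nat_powr_le s r N3 T1 J in auto)
        also have "\<dots> \<le> 2 * T * (\<eta> / 12) + 8 * (Y powr \<beta> * (1 + ln Y)\<^sup>2)"
        proof (intro add_mono)
          show "2 * T * (\<Sum>n\<in>J. real n powr (- (2 * r))) \<le> 2 * T * (\<eta> / 12)"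
            using T1 by (intro mult_left_mono M J) auto
          have "real N powr (2 - 2 * r) * (1 + ln (real N))\<^sup>2 \<le> Y powr \<beta> * (1 + ln Y)\<^sup>2"
            unfolding \<beta>_def[symmetric] using NY N3 \<beta> by (intro mult_mono power_mono powr_mono2 add_left_mono) auto
          thus "8 * real N powr (2 - 2 * r) * (1 + ln (real N))\<^sup>2 \<le> 8 * (Y powr \<beta> * (1 + ln Y)\<^sup>2)" by simp
        qed
        also have "?n powr \<beta> * integral {-T..T} (\<lambda>t. 1 / (norm (?z t - 1))\<^sup>2) \<le> Y powr \<beta> * (pi / (1 - \<rho>))"
        proof (intro mult_mono powr_mono2 integral_pole_le)
          show "0 \<le> integral {-T..T} (\<lambda>t. 1 / (norm (?z t - 1))\<^sup>2)"
            by (intro integral_nonneg integrable_continuous_real cz) auto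
        qed (use NY \<beta> s \<rho> T1 in auto)
        finally have "integral {-T..T} (\<lambda>t. (?d t)\<^sup>2) \<le> 3 * (Y powr \<beta> * (pi / (1 - \<rho>)) + 2 * C\<^sup>2 + (2 * T * (\<eta> / 12) + 8 * (Y powr \<beta> * (1 + ln Y)\<^sup>2)))"
          by simp
        also have "\<dots> \<le> \<eta> * T" using elim(2) unfolding Y_def[symmetric] by argo
        finally show "integral {-T..T} (\<lambda>t. (?d t)\<^sup>2) \<le> \<eta> * T" .
      qed
    qed
  qed
qed

section \<open>The weighted mean square of zeta\<close>

text \<open>Enlarging \<open>[0, T]\<close> to a symmetric interval makes the scaled interval
  independent of the sign of \<open>c\<close>.\<close>

lemma integral_stretch_symmetric_le:
  fixes g :: "real \<Rightarrow> real"
  assumes g: "\<And>A. continuous_on A g" "\<And>t. g t \<ge> 0" and c: "c \<noteq> 0" and T: "T \<ge> 0"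
  shows "integral {0..T} (\<lambda>t. g (c * t)) \<le> integral {-(\<bar>c\<bar> * T)..\<bar>c\<bar> * T} g / \<bar>c\<bar>"
proof -
  have im: "(\<lambda>x. x / c) ` {-(\<bar>c\<bar> * T)..\<bar>c\<bar> * T} = {-T..T}"
  proof (intro equalityI subsetI)
    fix x assume "x \<in> {-T..T}"
    hence "\<bar>x\<bar> \<le> T" by auto
    hence "\<bar>c\<bar> * \<bar>x\<bar> \<le> \<bar>c\<bar> * T" by (intro mult_left_mono) auto
    hence "\<bar>c * x\<bar> \<le> \<bar>c\<bar> * T" by (simp add: abs_mult)
    hence "c * x \<in> {-(\<bar>c\<bar> * T)..\<bar>c\<bar> * T}" by (auto simp: abs_le_iff)
    moreover have "x = (c * x) / c" using c by simp
    ultimately show "x \<in> (\<lambda>x. x / c) ` {-(\<bar>c\<bar> * T)..\<bar>c\<bar> * T}" by blast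
  next
    fix x assume "x \<in> (\<lambda>x. x / c) ` {-(\<bar>c\<bar> * T)..\<bar>c\<bar> * T}"
    then obtain y where "x = y / c" "y \<in> {-(\<bar>c\<bar> * T)..\<bar>c\<bar> * T}" by blast
    hence y: "x = y / c" "\<bar>y\<bar> \<le> \<bar>c\<bar> * T" by auto
    hence "\<bar>x\<bar> \<le> T" using c by (simp add: divide_le_eq mult.commute)
    thus "x \<in> {-T..T}" by (auto simp: abs_le_iff)
  qed
  have "integral {0..T} (\<lambda>t. g (c * t)) \<le> integral {-T..T} (\<lambda>t. g (c * t))"
    using T g(2) by (intro integral_subset_le integrable_continuous_real continuous_on_compose2[OF g(1)[of UNIV]] continuous_intros) auto
  also have "\<dots> = integral {-(\<bar>c\<bar> * T)..\<bar>c\<bar> * T} g / \<bar>c\<bar>"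
    using integral_stretch_real[OF c, of "-(\<bar>c\<bar> * T)" "\<bar>c\<bar> * T" g] unfolding im by simp
  finally show ?thesis .
qed

lemma riemann_zeta_mean_square_scaled:
  assumes r: "1 / 2 < r" "r < 1" and \<rho>: "\<rho> < 1" and \<eta>: "\<eta> > 0"
  shows "\<exists>M. \<forall>S. finite S \<longrightarrow> 0 \<notin> S \<longrightarrow> {1..M} \<subseteq> S \<longrightarrow> (\<forall>c. \<bar>c\<bar> \<ge> 1 \<longrightarrow>
     (\<forall>\<^sub>F T in at_top. \<forall>s\<in>{s. r \<le> Re s \<and> Re s \<le> \<rho> \<and> norm s \<le> H}.
        integral {0..T} (\<lambda>t. (norm (riemann_zeta (s + \<i> * of_real (c * t)) - (\<Sum>n\<in>S. of_nat n powr (- (s + \<i> * of_real (c * t))))))\<^sup>2) \<le> \<eta> * T))"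
proof -
  let ?X = "{s. r \<le> Re s \<and> Re s \<le> \<rho> \<and> norm s \<le> H}"
  obtain M where M: "\<And>S. finite S \<Longrightarrow> 0 \<notin> S \<Longrightarrow> {1..M} \<subseteq> S \<Longrightarrow>
     (\<forall>\<^sub>F T in at_top. \<forall>s\<in>?X. integral {-T..T} (\<lambda>t. (norm (riemann_zeta (s + \<i> * of_real t) - (\<Sum>n\<in>S. of_nat n powr (- (s + \<i> * of_real t)))))\<^sup>2) \<le> \<eta> * T)"
    using riemann_zeta_mean_square[OF assms, of H] by blast
  show ?thesis
  proof (rule exI[of _ M], intro allI impI)
    fix S and c :: real assume S: "finite S" "0 \<notin> S" "{1..M} \<subseteq> S" and c: "\<bar>c\<bar> \<ge> 1"
    let ?g = "\<lambda>s t. (norm (riemann_zeta (s + \<i> * of_real t) - (\<Sum>n\<in>S. of_nat n powr (- (s + \<i> * of_real t)))))\<^sup>2"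
    obtain T0 where T0: "\<And>T s. T \<ge> T0 \<Longrightarrow> s \<in> ?X \<Longrightarrow> integral {-T..T} (?g s) \<le> \<eta> * T"
      using M[OF S] unfolding eventually_at_top_linorder by blast
    have "\<forall>\<^sub>F T in at_top. T \<ge> max 0 T0" by (rule eventually_ge_at_top)
    thus "\<forall>\<^sub>F T in at_top. \<forall>s\<in>?X. integral {0..T} (\<lambda>t. ?g s (c * t)) \<le> \<eta> * T"
    proof eventually_elim
      case (elim T)
      show ?case
      proof
        fix s assume s: "s \<in> ?X"
        have T: "T \<ge> 0" "T \<ge> T0" using elim by auto
        have "T * 1 \<le> T * \<bar>c\<bar>" using c T by (intro mult_left_mono) auto
        hence cT: "\<bar>c\<bar> * T \<ge> T0" using T by (simp add: mult.commute)
        have cont: "continuous_on A (?g s)" for A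
          using riemann_zeta_line_continuous[of s A 1] dirichlet_poly_line_continuous[OF S(1,2), of A s 1] s \<rho>
          by (intro continuous_on_power continuous_on_norm continuous_on_diff) simp_all
        have "integral {0..T} (\<lambda>t. ?g s (c * t)) \<le> integral {-(\<bar>c\<bar> * T)..\<bar>c\<bar> * T} (?g s) / \<bar>c\<bar>"
          by (rule integral_stretch_symmetric_le[OF cont]) (use c T in auto)
        also have "\<dots> \<le> (\<eta> * (\<bar>c\<bar> * T)) / \<bar>c\<bar>" by (intro divide_right_mono T0 cT s) auto
        also have "\<dots> = \<eta> * T" using c by auto
        finally show "integral {0..T} (\<lambda>t. ?g s (c * t)) \<le> \<eta> * T" .
      qed
    qed
  qed
qed

text \<open>The weight, and with it \<open>B\<close>, is fixed first; the approximation of zeta is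
  then requested with error \<open>\<eta> / (9 * B)\<close>. The 9 accounts for three differences
  and the factor 3 from squaring their sum.\<close>

lemma weighted_zeta_mean_square:
  fixes a b :: int
  assumes ab: "\<bar>a - b\<bar> \<ge> 2" "gcd a b = 1" "a \<noteq> 0" "b \<noteq> 0"
    and r: "1 / 2 < r" "r < 1" and \<rho>: "\<rho> < 1" and \<eta>: "\<eta> > 0"
  shows "\<exists>W B. (\<forall>A. continuous_on A W) \<and> (\<forall>t. 0 \<le> W t \<and> W t \<le> B) \<and>
     (\<forall>\<^sub>F T in at_top. T / 2 \<le> integral {0..T} W) \<and>
     (\<forall>\<^sub>F T in at_top. \<forall>s\<in>{s. r \<le> Re s \<and> Re s \<le> \<rho> \<and> norm s \<le> H}.
        integral {0..T} (\<lambda>t. W t * (norm (riemann_zeta (s + \<i> * of_real (of_int a * t)) - riemann_zeta (s + \<i> * of_real (of_int b * t))))\<^sup>2) \<le> \<eta> * T)"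
proof -
  let ?X = "{s. r \<le> Re s \<and> Re s \<le> \<rho> \<and> norm s \<le> H}"
  have \<eta>9: "\<eta> / 9 > 0" using \<eta> by simp
  from weighted_mean_square[OF ab r(1) \<eta>9, of H] obtain A K w where
    AKw: "finite A" "\<forall>p\<in>A. prime p" "K > 0" "\<forall>p. norm (w p) = 1" "\<forall>M L. L \<ge> 1 \<longrightarrow>
      (\<forall>\<^sub>F T in at_top. \<forall>s\<in>{s. Re s \<ge> r \<and> norm s \<le> H}. integral {0..T} (\<lambda>t. fejer_weight K w A t *
          (norm (euler_rough A M L (of_int a) s t - euler_rough A M L (of_int b) s t))\<^sup>2) \<le> \<eta> / 9 * T)"
    by (elim exE conjE) (rule that)
  have A: "finite A" "\<And>p. p \<in> A \<Longrightarrow> prime p" and K: "K > 0" and w: "\<And>p. norm (w p) = 1"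
    using AKw(1-4) by auto
  define W where "W = fejer_weight K w A"
  define B where "B = real K ^ card A"
  have B: "B > 0" using K by (simp add: B_def)
  have W: "0 \<le> W t" "W t \<le> B" for t
    unfolding W_def B_def by (rule fejer_weight_nonneg, rule fejer_weight_le[OF w])
  have contW: "continuous_on D W" for D
    unfolding W_def fejer_weight_def fejer_factor_def using K by (intro continuous_intros) auto
  have "\<eta> / (9 * B) > 0" using \<eta> B by simp
  from riemann_zeta_mean_square_scaled[OF r \<rho> this, of H] obtain M where
    M: "\<forall>S. finite S \<longrightarrow> 0 \<notin> S \<longrightarrow> {1..M} \<subseteq> S \<longrightarrow> (\<forall>c. \<bar>c\<bar> \<ge> 1 \<longrightarrow>
     (\<forall>\<^sub>F T in at_top. \<forall>s\<in>?X. integral {0..T} (\<lambda>t. (norm (riemann_zeta (s + \<i> * of_real (c * t)) - (\<Sum>n\<in>S. of_nat n powr (- (s + \<i> * of_real (c * t))))))\<^sup>2) \<le> \<eta> / (9 * B) * T))"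
    by (elim exE)
  \<comment> \<open>At least \<open>M\<close>, so that the expanded product covers
    \<open>{1..M}\<close>, and at least 1, as the bound on Euler products demands.\<close>
  define L where "L = max M 1"
  obtain S where S: "finite S" "0 \<notin> S" "{1..M} \<subseteq> S"
    and S_eq: "\<And>z. (\<Sum>n\<in>S. complex_of_nat n powr z) =
        (\<Prod>p\<in>A. \<Sum>j\<le>L. (of_nat p powr z) ^ j) * (\<Sum>l\<in>{l\<in>{1..M}. \<forall>p\<in>A. \<not> p dvd l}. of_nat l powr z)"
    using smooth_rough_sum[OF A, of M L] by (auto simp: L_def)
  define P where "P = (\<lambda>c s t. \<Sum>n\<in>S. complex_of_nat n powr (- (s + \<i> * of_real (c * t))))"
  define Z where "Z = (\<lambda>c s t. riemann_zeta (s + \<i> * of_real (c * t)))"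
  have P_eq: "P c s t = euler_rough A M L c s t" for c s t
    unfolding P_def S_eq euler_prod_def euler_rough_def
    by (intro arg_cong2[where f = "(*)"] prod.cong sum.cong arg_cong2[where f = power] of_nat_powr_shift refl)
       (auto dest: A(2) prime_gt_0_nat)
  have "L \<ge> 1" by (simp add: L_def)
  from AKw(5)[THEN spec[of _ M], THEN spec[of _ L], THEN mp, OF this] have PP: "\<forall>\<^sub>F T in at_top. \<forall>s\<in>{s. Re s \<ge> r \<and> norm s \<le> H}.
      integral {0..T} (\<lambda>t. W t * (norm (P (of_int a) s t - P (of_int b) s t))\<^sup>2) \<le> \<eta> / 9 * T"
    unfolding P_eq W_def .
  have c1: "\<bar>real_of_int a\<bar> \<ge> 1" "\<bar>real_of_int b\<bar> \<ge> 1" using ab by linarith+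
  have ZP: "\<forall>\<^sub>F T in at_top. \<forall>s\<in>?X. integral {0..T} (\<lambda>t. (norm (Z (of_int a) s t - P (of_int a) s t))\<^sup>2) \<le> \<eta> / (9 * B) * T"
     "\<forall>\<^sub>F T in at_top. \<forall>s\<in>?X. integral {0..T} (\<lambda>t. (norm (Z (of_int b) s t - P (of_int b) s t))\<^sup>2) \<le> \<eta> / (9 * B) * T"
    unfolding Z_def P_def
    by (rule M[THEN spec, THEN mp, THEN mp, THEN mp, THEN spec, THEN mp, OF S c1(1)],
        rule M[THEN spec, THEN mp, THEN mp, THEN mp, THEN spec, THEN mp, OF S c1(2)])
  have "\<forall>\<^sub>F T in at_top. \<forall>s\<in>?X. integral {0..T} (\<lambda>t. W t * (norm (Z (of_int a) s t - Z (of_int b) s t))\<^sup>2) \<le> \<eta> * T"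
    using PP ZP eventually_ge_at_top[of 0]
  proof eventually_elim
    case (elim T)
    show ?case
    proof
      fix s assume s: "s \<in> ?X"
      let ?a = "\<lambda>t. (norm (Z (of_int a) s t - P (of_int a) s t))\<^sup>2"
      let ?b = "\<lambda>t. (norm (Z (of_int b) s t - P (of_int b) s t))\<^sup>2"
      let ?p = "\<lambda>t. W t * (norm (P (of_int a) s t - P (of_int b) s t))\<^sup>2"
      have cZ: "continuous_on D (Z c s)" for c D
        unfolding Z_def by (rule riemann_zeta_line_continuous) (use s \<rho> in auto)
      have cP: "continuous_on D (P c s)" for c D
        unfolding P_def by (rule dirichlet_poly_line_continuous[OF S(1,2)])
      have le: "W t * (norm (Z (of_int a) s t - Z (of_int b) s t))\<^sup>2 \<le> 3 * B * ?a t + 3 * ?p t + 3 * B * ?b t" for t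
      proof -
        have "Z (of_int a) s t - Z (of_int b) s t = (Z (of_int a) s t - P (of_int a) s t) + (P (of_int a) s t - P (of_int b) s t) + - (Z (of_int b) s t - P (of_int b) s t)"
          by simp
        hence "(norm (Z (of_int a) s t - Z (of_int b) s t))\<^sup>2 \<le> 3 * (?a t + (norm (P (of_int a) s t - P (of_int b) s t))\<^sup>2 + ?b t)"
          using power2_norm_add3_le[of "Z (of_int a) s t - P (of_int a) s t" "P (of_int a) s t - P (of_int b) s t" "- (Z (of_int b) s t - P (of_int b) s t)"]
          unfolding norm_minus_cancel by simp
        hence "W t * (norm (Z (of_int a) s t - Z (of_int b) s t))\<^sup>2 \<le> W t * (3 * (?a t + (norm (P (of_int a) s t - P (of_int b) s t))\<^sup>2 + ?b t))"
          using W by (intro mult_left_mono)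
        also have "\<dots> = 3 * (W t * ?a t) + 3 * ?p t + 3 * (W t * ?b t)" by (simp add: algebra_simps)
        also have "W t * ?a t \<le> B * ?a t" using W by (intro mult_right_mono) auto
        also have "W t * ?b t \<le> B * ?b t" using W by (intro mult_right_mono) auto
        finally show ?thesis by simp
      qed
      have "integral {0..T} (\<lambda>t. W t * (norm (Z (of_int a) s t - Z (of_int b) s t))\<^sup>2) \<le> integral {0..T} (\<lambda>t. 3 * B * ?a t + 3 * ?p t + 3 * B * ?b t)"
        by (intro integral_le integrable_continuous_real le continuous_intros contW cZ cP)
      also have "\<dots> = 3 * B * integral {0..T} ?a + 3 * integral {0..T} ?p + 3 * B * integral {0..T} ?b"
        by (intro integral_unique has_integral_add has_integral_mult_right integrable_integral integrable_continuous_real continuous_intros contW cZ cP)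
      also have "\<dots> \<le> 3 * B * (\<eta> / (9 * B) * T) + 3 * (\<eta> / 9 * T) + 3 * B * (\<eta> / (9 * B) * T)"
        using elim s B by (intro add_mono mult_left_mono) auto
      also have "\<dots> = \<eta> * T" using B by (simp add: field_simps)
      finally show "integral {0..T} (\<lambda>t. W t * (norm (Z (of_int a) s t - Z (of_int b) s t))\<^sup>2) \<le> \<eta> * T" .
    qed
  qed
  moreover have "\<forall>\<^sub>F T in at_top. T / 2 \<le> integral {0..T} W"
  proof -
    have "trigpoly {()} (log_span A) (\<lambda>x t. of_real (W t)) (\<lambda>x. 1)"
      unfolding W_def by (rule fejer_weight_trigpoly[OF w K A])
    from trigpoly_mean_real[OF this, of "1 / 2"] show ?thesis
      by (auto elim!: eventually_mono simp: abs_if split: if_splits)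
  qed
  ultimately show ?thesis using W contW unfolding Z_def by (intro exI[of _ W] exI[of _ B]) blast
qed

text \<open>The substitution \<open>\<tau> = b * t\<close> turns the pair of speeds
  \<open>a\<close>, \<open>b\<close> into \<open>d\<close>, 1. The stretched weight keeps its bound
  and its mean.\<close>

lemma weighted_zeta_mean_square_ratio:
  fixes a b :: int
  assumes ab: "\<bar>a - b\<bar> \<ge> 2" "gcd a b = 1" "a \<noteq> 0" "b > 0" and d: "d = of_int a / of_int b"
    and r: "1 / 2 < r" "r < 1" and \<rho>: "\<rho> < 1" and \<eta>: "\<eta> > 0"
  shows "\<exists>W B. (\<forall>A. continuous_on A W) \<and> (\<forall>t. 0 \<le> W t \<and> W t \<le> B) \<and>
     (\<forall>\<^sub>F T in at_top. T / 2 \<le> integral {0..T} W) \<and>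
     (\<forall>\<^sub>F T in at_top. \<forall>s\<in>{s. r \<le> Re s \<and> Re s \<le> \<rho> \<and> norm s \<le> H}.
        integral {0..T} (\<lambda>t. W t * (norm (riemann_zeta (s + \<i> * of_real t) - riemann_zeta (s + \<i> * of_real (d * t))))\<^sup>2) \<le> \<eta> * T)"
proof -
  let ?X = "{s. r \<le> Re s \<and> Re s \<le> \<rho> \<and> norm s \<le> H}"
  define c where "c = real_of_int b"
  have c: "c > 0" using ab by (simp add: c_def)
  obtain W B where W: "\<And>A. continuous_on A W" "\<And>t. 0 \<le> W t \<and> W t \<le> B"
     "\<forall>\<^sub>F T in at_top. T / 2 \<le> integral {0..T} W"
     "\<forall>\<^sub>F T in at_top. \<forall>s\<in>?X. integral {0..T} (\<lambda>t. W t * (norm (riemann_zeta (s + \<i> * of_real (of_int a * t)) - riemann_zeta (s + \<i> * of_real (of_int b * t))))\<^sup>2) \<le> \<eta> * T"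
    using weighted_zeta_mean_square[OF ab(1-3) _ r \<rho> \<eta>, of H] ab(4) by auto
  have scale: "integral {0..T} (\<lambda>t. f (t / c)) = c * integral {0..T / c} f" for f :: "real \<Rightarrow> real" and T
  proof -
    have "(\<lambda>x. x * c) ` {0..T / c} = {0..T}" using image_mult_atLeastAtMost_if'[of c 0 "T / c"] c by auto
    thus ?thesis using integral_stretch_real[of "1 / c" 0 "T / c" f] c by simp
  qed
  have lim: "filterlim (\<lambda>T. T / c) at_top at_top" using c by real_asymp
  define V where "V = (\<lambda>t. W (t / c))"
  have "\<forall>\<^sub>F T in at_top. T / 2 \<le> integral {0..T} V"
    using filterlim_iff[THEN iffD1, OF lim, rule_format, OF W(3)]
    by eventually_elim (use c in \<open>simp add: V_def scale field_simps\<close>)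
  moreover have "\<forall>\<^sub>F T in at_top. \<forall>s\<in>?X. integral {0..T} (\<lambda>t. V t * (norm (riemann_zeta (s + \<i> * of_real t) - riemann_zeta (s + \<i> * of_real (d * t))))\<^sup>2) \<le> \<eta> * T"
    using filterlim_iff[THEN iffD1, OF lim, rule_format, OF W(4)]
  proof eventually_elim
    case (elim T)
    show ?case
    proof
      fix s assume s: "s \<in> ?X"
      let ?f = "\<lambda>t. W t * (norm (riemann_zeta (s + \<i> * of_real (of_int a * t)) - riemann_zeta (s + \<i> * of_real (of_int b * t))))\<^sup>2"
      have "(\<lambda>t. V t * (norm (riemann_zeta (s + \<i> * of_real t) - riemann_zeta (s + \<i> * of_real (d * t))))\<^sup>2) = (\<lambda>t. ?f (t / c))"
        using c unfolding V_def d c_def by (simp add: norm_minus_commute)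
      hence "integral {0..T} (\<lambda>t. V t * (norm (riemann_zeta (s + \<i> * of_real t) - riemann_zeta (s + \<i> * of_real (d * t))))\<^sup>2) = c * integral {0..T / c} ?f"
        using scale[of T ?f] by (simp only:)
      also have "\<dots> \<le> c * (\<eta> * (T / c))" using elim s c by (intro mult_left_mono) auto
      finally show "integral {0..T} (\<lambda>t. V t * (norm (riemann_zeta (s + \<i> * of_real t) - riemann_zeta (s + \<i> * of_real (d * t))))\<^sup>2) \<le> \<eta> * T"
        using c by simp
    qed
  qed
  moreover have "continuous_on A V" for A
    unfolding V_def by (rule continuous_on_compose2[OF W(1)[of UNIV]]) (use c in \<open>auto intro!: continuous_intros\<close>)
  moreover have "0 \<le> V t \<and> V t \<le> B" for t unfolding V_def by (rule W(2))
  ultimately show ?thesis by (intro exI[of _ V] exI[of _ B]) blast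
qed

section \<open>From mean squares to positive density\<close>

text \<open>Points of the circle have distance at least \<open>e / 2\<close> from \<open>s\<close>,
  so the Cauchy kernel costs at most a factor 2 against the mean over the circle.\<close>

lemma cauchy_mean_bound:
  assumes f: "f holomorphic_on cball z e" and e: "e > 0" and s: "norm (s - z) \<le> e / 2"
  shows "norm (f s) \<le> 2 * integral {0..1} (\<lambda>x. norm (f (circlepath z e x)))"
proof -
  let ?g = "circlepath z e"
  have on: "norm (?g x - z) = e" for x
    using e by (simp add: circlepath norm_mult)
  hence incb: "?g x \<in> cball z e" for x by (simp add: dist_norm norm_minus_commute)
  have "norm (s - z) < e" using s e by simp
  from Cauchy_integral_circlepath_simple[OF f this]
  have int: "((\<lambda>x. f (?g x) / (?g x - s) * vector_derivative ?g (at x)) has_integral (2 * of_real pi * \<i> * f s)) {0..1}"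
    unfolding has_contour_integral .
  have cg: "continuous_on {0..1} (\<lambda>x. norm (f (?g x)))"
    by (intro continuous_on_norm continuous_on_compose2[OF holomorphic_on_imp_continuous_on[OF f]])
       (use incb in \<open>auto simp: circlepath intro!: continuous_intros\<close>)
  have "norm (integral {0..1} (\<lambda>x. f (?g x) / (?g x - s) * vector_derivative ?g (at x))) \<le> integral {0..1} (\<lambda>x. 4 * pi * norm (f (?g x)))"
  proof (rule integral_norm_bound_integral)
    show "(\<lambda>x. f (?g x) / (?g x - s) * vector_derivative ?g (at x)) integrable_on {0..1}" using int by blast
    show "(\<lambda>x. 4 * pi * norm (f (?g x))) integrable_on {0..1}"
      by (intro integrable_continuous_real continuous_intros cg)
    fix x :: real
    have "norm (?g x - s) \<ge> norm (?g x - z) - norm (s - z)"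
      using norm_triangle_ineq2[of "?g x - z" "s - z"] by simp
    hence ge: "norm (?g x - s) \<ge> e / 2" using on[of x] s by linarith
    have "norm (vector_derivative ?g (at x)) = 2 * pi * e"
      using e by (simp add: vector_derivative_circlepath norm_mult)
    hence "norm (f (?g x) / (?g x - s) * vector_derivative ?g (at x)) = norm (f (?g x)) * (2 * pi * e) / norm (?g x - s)"
      by (simp add: norm_mult norm_divide)
    also have "\<dots> \<le> norm (f (?g x)) * (2 * pi * e) / (e / 2)"
      using ge e by (intro divide_left_mono) (auto intro!: mult_pos_pos)
    also have "\<dots> = 4 * pi * norm (f (?g x))" using e by simp
    finally show "norm (f (?g x) / (?g x - s) * vector_derivative ?g (at x)) \<le> 4 * pi * norm (f (?g x))" .
  qed
  also have "integral {0..1} (\<lambda>x. f (?g x) / (?g x - s) * vector_derivative ?g (at x)) = 2 * of_real pi * \<i> * f s"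
    by (rule integral_unique[OF int])
  finally have "2 * pi * norm (f s) \<le> 2 * pi * (2 * integral {0..1} (\<lambda>x. norm (f (?g x))))"
    by (simp add: norm_mult)
  thus ?thesis using pi_gt_zero by simp
qed

section \<open>Measurability of the set of shifts\<close>

lemma SUP_ereal_less_iff:
  fixes h :: "'a \<Rightarrow> real"
  shows "(SUP s\<in>K. ereal (h s)) < ereal \<epsilon> \<longleftrightarrow> (\<exists>n. \<forall>s\<in>K. h s \<le> \<epsilon> - 1 / real (Suc n))"
proof
  assume "(SUP s\<in>K. ereal (h s)) < ereal \<epsilon>"
  then obtain y where y: "(SUP s\<in>K. ereal (h s)) < ereal y" "ereal y < ereal \<epsilon>" using ereal_dense2 by blast
  obtain n where "1 / real (Suc n) < \<epsilon> - y" using nat_approx_posE[of "\<epsilon> - y"] y(2) by auto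
  moreover have "h s \<le> y" if "s \<in> K" for s
  proof -
    have "ereal (h s) \<le> (SUP s\<in>K. ereal (h s))" using that by (rule SUP_upper)
    hence "ereal (h s) \<le> ereal y" using y(1) by (meson less_imp_le order_trans)
    thus ?thesis by simp
  qed
  ultimately show "\<exists>n. \<forall>s\<in>K. h s \<le> \<epsilon> - 1 / real (Suc n)" by (smt (verit))
next
  assume "\<exists>n. \<forall>s\<in>K. h s \<le> \<epsilon> - 1 / real (Suc n)"
  then obtain n where n: "\<And>s. s \<in> K \<Longrightarrow> h s \<le> \<epsilon> - 1 / real (Suc n)" by blast
  have "(SUP s\<in>K. ereal (h s)) \<le> ereal (\<epsilon> - 1 / real (Suc n))" by (rule SUP_least) (use n in auto)
  also have "\<dots> < ereal \<epsilon>" by simp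
  finally show "(SUP s\<in>K. ereal (h s)) < ereal \<epsilon>" .
qed

text \<open>A strict bound on the supremum is a countable union of non-strict bounds valid for all
  \<open>s\<close> in \<open>K\<close>. Each of these defines a closed set by continuity, even if
  \<open>K\<close> is uncountable.\<close>

lemma SUP_less_lmeasurable:
  fixes h :: "'a \<Rightarrow> real \<Rightarrow> real"
  assumes "\<And>s. s \<in> K \<Longrightarrow> continuous_on UNIV (h s)"
  shows "{\<tau> \<in> {0..T}. (SUP s\<in>K. ereal (h s \<tau>)) < ereal \<epsilon>} \<in> lmeasurable"
proof -
  have "closed ({0..T} \<inter> (\<Inter>s\<in>K. {\<tau>. h s \<tau> \<le> c}))" for c
    by (intro closed_Int closed_INT ballI closed_Collect_le assms continuous_on_const) auto
  hence "(\<Union>n. {0..T} \<inter> (\<Inter>s\<in>K. {\<tau>. h s \<tau> \<le> \<epsilon> - 1 / real (Suc n)})) \<in> sets lebesgue"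
    by (intro sets.countable_UN image_subsetI borel_closed[THEN sets_completionI_sets[of _ lborel, simplified]]) auto
  moreover have "{\<tau> \<in> {0..T}. (SUP s\<in>K. ereal (h s \<tau>)) < ereal \<epsilon>} =
      (\<Union>n. {0..T} \<inter> (\<Inter>s\<in>K. {\<tau>. h s \<tau> \<le> \<epsilon> - 1 / real (Suc n)}))"
    unfolding SUP_ereal_less_iff by auto
  ultimately have "{\<tau> \<in> {0..T}. (SUP s\<in>K. ereal (h s \<tau>)) < ereal \<epsilon>} \<in> sets lebesgue" by simp
  moreover have "bounded {\<tau> \<in> {0..T}. (SUP s\<in>K. ereal (h s \<tau>)) < ereal \<epsilon>}"
    by (rule bounded_subset[of "{0..T}"]) auto
  ultimately show ?thesis by (rule bounded_set_imp_lmeasurable[rotated])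
qed

text \<open>Discs of half the radius cover \<open>K\<close>, which leaves room for Cauchy's estimate
  on the full circles. Finiteness provides common bounds that stay inside the open strip.\<close>

lemma compact_strip_circle_cover:
  assumes "compact K" "K \<subseteq> strip_D"
  obtains F e r \<rho> H where "finite F" "\<And>z. z \<in> F \<Longrightarrow> e z > 0"
    "\<And>z. z \<in> F \<Longrightarrow> cball z (e z) \<subseteq> {s. r \<le> Re s \<and> Re s \<le> \<rho> \<and> norm s \<le> H}"
    "K \<subseteq> (\<Union>z\<in>F. cball z (e z / 2))" "1 / 2 < r" "r < 1" "\<rho> < 1"
proof -
  have "open strip_D"
  proof -
    have "strip_D = {s. Re s > 1 / 2} \<inter> {s. Re s < 1}" by (auto simp: strip_D_def)
    thus ?thesis using open_Int[OF open_halfspace_Re_gt[of "1 / 2"] open_halfspace_Re_lt[of 1]] by (simp only:)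
  qed
  hence "\<forall>z\<in>K. \<exists>e>0. cball z e \<subseteq> strip_D" using assms(2) open_contains_cball by blast
  then obtain e where e: "\<And>z. z \<in> K \<Longrightarrow> e z > 0" "\<And>z. z \<in> K \<Longrightarrow> cball z (e z) \<subseteq> strip_D" by metis
  obtain F where F: "F \<subseteq> K" "finite F" "K \<subseteq> (\<Union>z\<in>F. ball z (e z / 2))"
  proof (rule compactE_image[OF assms(1), of K "\<lambda>z. ball z (e z / 2)"])
    show "K \<subseteq> (\<Union>z\<in>K. ball z (e z / 2))" using e(1) by force
  qed auto
  \<comment> \<open>The value \<open>3/4\<close> keeps this minimum and the maximum below defined
    for empty \<open>F\<close>, and it forces \<open>r < 1\<close>.\<close>
  define r where "r = Min (insert (3/4) ((\<lambda>z. Re z - e z) ` F))"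
  define \<rho> where "\<rho> = Max (insert (3/4) ((\<lambda>z. Re z + e z) ` F))"
  define H where "H = Max (insert 0 ((\<lambda>z. norm z + e z) ` F))"
  have edge: "Re z - e z > 1 / 2" "Re z + e z < 1" if "z \<in> F" for z
  proof -
    have z: "z \<in> K" using that F by auto
    have "z - of_real (e z) \<in> cball z (e z)" "z + of_real (e z) \<in> cball z (e z)"
      using e(1)[OF z] by (auto simp: dist_norm)
    hence "z - of_real (e z) \<in> strip_D" "z + of_real (e z) \<in> strip_D" using e(2)[OF z] by auto
    thus "Re z - e z > 1 / 2" "Re z + e z < 1" by (auto simp: strip_D_def)
  qed
  have r\<rho>: "1 / 2 < r" "r < 1" "\<rho> < 1"
  proof -
    show "1 / 2 < r" unfolding r_def using F edge by (subst Min_gr_iff) auto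
    have "r \<le> 3 / 4" unfolding r_def using F by (intro Min_le) auto
    thus "r < 1" by simp
    show "\<rho> < 1" unfolding \<rho>_def using F edge by (subst Max_less_iff) auto
  qed
  have sub: "cball z (e z) \<subseteq> {s. r \<le> Re s \<and> Re s \<le> \<rho> \<and> norm s \<le> H}" if z: "z \<in> F" for z
  proof
    fix s assume "s \<in> cball z (e z)"
    hence d: "norm (s - z) \<le> e z" by (simp add: dist_norm norm_minus_commute)
    have "\<bar>Re s - Re z\<bar> \<le> e z" using abs_Re_le_cmod[of "s - z"] d by simp
    moreover have "r \<le> Re z - e z" unfolding r_def using F z by (intro Min_le) auto
    moreover have "Re z + e z \<le> \<rho>" unfolding \<rho>_def using F z by (intro Max_ge) auto
    moreover have "norm z + e z \<le> H" unfolding H_def using F z by (intro Max_ge) auto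
    moreover have "norm s \<le> norm z + norm (s - z)" by (metis add.commute diff_add_cancel norm_triangle_ineq)
    ultimately show "s \<in> {s. r \<le> Re s \<and> Re s \<le> \<rho> \<and> norm s \<le> H}" using d by auto
  qed
  have "K \<subseteq> (\<Union>z\<in>F. cball z (e z / 2))" using F(3) by force
  moreover have "e z > 0" if "z \<in> F" for z using e(1) F(1) that by auto
  ultimately show thesis using that[OF F(2) _ sub _ r\<rho>] by blast
qed

lemma zeta_difference_continuous:
  assumes "e > 0" "cball z e \<subseteq> {s. Re s < 1}"
  shows "continuous_on (A \<times> B) (\<lambda>(t, x). riemann_zeta (circlepath z e x + \<i> * of_real t) - riemann_zeta (circlepath z e x + \<i> * of_real (d * t)))"
proof -
  have "norm (circlepath z e x - z) = e" for x using assms by (simp add: circlepath norm_mult)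
  hence "circlepath z e x \<in> cball z e" for x by (simp add: dist_norm norm_minus_commute)
  hence re: "Re (circlepath z e x) < 1" for x using assms(2) by blast
  have ne: "circlepath z e x + \<i> * of_real u \<in> - {1}" for x u using re[of x] by (auto simp: complex_eq_iff)
  have cp: "continuous_on C (\<lambda>p. circlepath z e (snd p))" for C :: "(real \<times> real) set"
    unfolding circlepath by (intro continuous_intros)
  have "continuous_on (A \<times> B) (\<lambda>p. riemann_zeta (circlepath z e (snd p) + \<i> * of_real (c * fst p)))" for c
    by (intro continuous_on_compose2[OF holomorphic_on_imp_continuous_on[OF riemann_zeta_holomorphic]] continuous_intros cp)
       (rule image_subsetI, rule ne)
  from continuous_on_diff[OF this[of 1] this[of d]] show ?thesis by (simp add: case_prod_unfold)
qed

text \<open>Chebyshev's inequality in pointwise form: \<open>W\<close> is at most \<open>B\<close>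
  on \<open>G\<close> and at most \<open>W * \<Phi> / \<delta>\<close> off \<open>G\<close>.\<close>

lemma weighted_measure_lower_bound:
  fixes W \<Phi> :: "real \<Rightarrow> real"
  assumes W: "\<And>A. continuous_on A W" "\<And>t. 0 \<le> W t" "\<And>t. W t \<le> B"
    and \<Phi>: "continuous_on {0..T} \<Phi>" "\<And>t. t \<in> {0..T} \<Longrightarrow> \<Phi> t \<ge> 0" and \<delta>: "\<delta> > 0"
    and G: "G \<in> lmeasurable" "G \<subseteq> {0..T}" "\<And>t. t \<in> {0..T} \<Longrightarrow> \<Phi> t < \<delta> \<Longrightarrow> t \<in> G"
  shows "integral {0..T} W \<le> B * measure lebesgue G + integral {0..T} (\<lambda>t. W t * \<Phi> t) / \<delta>"
proof -
  have "((\<lambda>x. 1) has_integral measure lebesgue G) G"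
    using G(1) lmeasure_integral[OF G(1)] lmeasurable_iff_integrable_on[THEN iffD1, OF G(1)]
    by (simp only: has_integral_iff)
  hence g: "((\<lambda>t. if t \<in> G then 1 else 0) has_integral measure lebesgue G) {0..T}"
    by (subst has_integral_restrict[OF G(2)])
  have "((\<lambda>t. B * (if t \<in> G then 1 else 0) + W t * \<Phi> t / \<delta>) has_integral (B * measure lebesgue G + integral {0..T} (\<lambda>t. W t * \<Phi> t) / \<delta>)) {0..T}"
    by (intro has_integral_add has_integral_mult_right g has_integral_divide integrable_integral
        integrable_continuous_real continuous_intros W \<Phi>)
  moreover have "W t \<le> B * (if t \<in> G then 1 else 0) + W t * \<Phi> t / \<delta>" if t: "t \<in> {0..T}" for t
  proof (cases "t \<in> G")
    case True
    thus ?thesis using W(2,3)[of t] \<Phi>(2)[OF t] \<delta> by (simp add: add_increasing2)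
  next
    case False
    hence "\<Phi> t \<ge> \<delta>" using G(3)[OF t] by force
    hence "W t * \<delta> \<le> W t * \<Phi> t" using W(2) by (intro mult_left_mono) auto
    thus ?thesis using False \<delta> by (simp add: field_simps)
  qed
  ultimately show ?thesis
    by (intro has_integral_le[OF integrable_integral[OF integrable_continuous_real[OF W(1)]]]) auto
qed

lemma self_approximation:
  fixes a b :: int
  assumes ab: "\<bar>a - b\<bar> \<ge> 2" "gcd a b = 1" "a \<noteq> 0" "b > 0" and d: "d = of_int a / of_int b"
    and K: "compact K" "K \<subseteq> strip_D" and \<epsilon>: "\<epsilon> > 0"
  shows "\<exists>c>0. \<forall>\<^sub>F T in at_top. c * T \<le> measure lebesgue
           {\<tau> \<in> {0..T}. (SUP s\<in>K. ereal (cmod (riemann_zeta (s + \<i> * of_real \<tau>)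
              - riemann_zeta (s + \<i> * of_real (d * \<tau>))))) < ereal \<epsilon>}"
proof -
  obtain F e r \<rho> H where F: "finite F" "\<And>z. z \<in> F \<Longrightarrow> e z > 0"
      "\<And>z. z \<in> F \<Longrightarrow> cball z (e z) \<subseteq> {s. r \<le> Re s \<and> Re s \<le> \<rho> \<and> norm s \<le> H}"
      "K \<subseteq> (\<Union>z\<in>F. cball z (e z / 2))" and r: "1 / 2 < r" "r < 1" and \<rho>: "\<rho> < 1"
    by (rule compact_strip_circle_cover[OF K]) (rule that)
  \<comment> \<open>Cauchy's estimate bounds the squared difference by \<open>2 * \<Phi>\<close>,
    and \<open>2 * \<delta> = (\<epsilon> / 2)^2\<close>. Aiming at \<open>\<epsilon> / 2\<close>
    leaves room for a strict bound on the supremum.\<close>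
  define \<delta> where "\<delta> = \<epsilon>\<^sup>2 / 8"
  have \<delta>: "\<delta> > 0" using \<epsilon> by (simp add: \<delta>_def)
  \<comment> \<open>All circles together then contribute at most \<open>\<delta> * T / 4\<close>, so
    at least \<open>T / 4\<close> of the weight \<open>T / 2\<close> remains. The summand 1 covers
    empty \<open>F\<close>.\<close>
  define \<eta> where "\<eta> = \<delta> / (4 * (real (card F) + 1))"
  have \<eta>: "\<eta> > 0" using \<delta> by (simp add: \<eta>_def add_nonneg_pos)
  have "\<eta> * (4 * (real (card F) + 1)) = \<delta>" unfolding \<eta>_def by simp
  hence F\<eta>: "real (card F) * \<eta> \<le> \<delta> / 4" using \<eta> by (simp add: algebra_simps)
  let ?D = "\<lambda>t s. riemann_zeta (s + \<i> * of_real t) - riemann_zeta (s + \<i> * of_real (d * t))"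
  let ?X = "{s. r \<le> Re s \<and> Re s \<le> \<rho> \<and> norm s \<le> H}"
  from weighted_zeta_mean_square_ratio[OF ab d r \<rho> \<eta>, of H] obtain W B where
    W: "\<forall>A. continuous_on A W" "\<forall>t. 0 \<le> W t \<and> W t \<le> B" "\<forall>\<^sub>F T in at_top. T / 2 \<le> integral {0..T} W"
     "\<forall>\<^sub>F T in at_top. \<forall>s\<in>?X. integral {0..T} (\<lambda>t. W t * (norm (?D t s))\<^sup>2) \<le> \<eta> * T"
    by (elim exE conjE) (rule that)
  define \<Phi> where "\<Phi> = (\<lambda>t. \<Sum>z\<in>F. integral {0..1} (\<lambda>x. (norm (?D t (circlepath z (e z) x)))\<^sup>2))"
  have circ: "circlepath z (e z) x \<in> cball z (e z)" if "z \<in> F" for z x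
  proof -
    have "norm (circlepath z (e z) x - z) = e z" using F(2)[OF that] by (simp add: circlepath norm_mult)
    thus ?thesis by (simp add: dist_norm norm_minus_commute)
  qed
  have contD: "continuous_on (A \<times> C) (\<lambda>(t, x). (norm (?D t (circlepath z (e z) x)))\<^sup>2)" if "z \<in> F" for z A C
  proof -
    have "cball z (e z) \<subseteq> {s. Re s < 1}" using F(3)[OF that] \<rho> by auto
    from zeta_difference_continuous[OF F(2)[OF that] this, of A C d] show ?thesis
      unfolding case_prod_unfold by (intro continuous_on_power continuous_on_norm)
  qed
  have cont_int: "continuous_on A (\<lambda>t. integral {0..1} (\<lambda>x. (norm (?D t (circlepath z (e z) x)))\<^sup>2))" if "z \<in> F" for z A
    using integral_continuous_on_param[OF contD[OF that, of A "cbox 0 1"]] by simp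
  have cont_x: "continuous_on C (\<lambda>x. (norm (?D t (circlepath z (e z) x)))\<^sup>2)" if "z \<in> F" for z C t
  proof -
    have "continuous_on C (\<lambda>x. (t, x))" by (intro continuous_intros)
    from continuous_on_compose2[OF contD[OF that, of UNIV UNIV] this] show ?thesis by simp
  qed
  have cont\<Phi>: "continuous_on A \<Phi>" for A
    unfolding \<Phi>_def by (intro continuous_on_sum cont_int)
  have int_nonneg: "integral {0..1} (\<lambda>x. (norm (?D t (circlepath z (e z) x)))\<^sup>2) \<ge> 0" if "z \<in> F" for z t
    by (intro integral_nonneg integrable_continuous_real cont_x that) auto
  have \<Phi>0: "\<Phi> t \<ge> 0" for t unfolding \<Phi>_def by (intro sum_nonneg int_nonneg)
  have sup: "norm (?D t s) \<le> \<epsilon> / 2" if t: "\<Phi> t < \<delta>" and s: "s \<in> K" for t s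
  proof -
    obtain z where z: "z \<in> F" "s \<in> cball z (e z / 2)" using s F(4) by auto
    have "(\<lambda>s. (?D t s)\<^sup>2) holomorphic_on cball z (e z)"
    proof -
      have "(\<lambda>s. riemann_zeta (s + \<i> * of_real u)) holomorphic_on cball z (e z)" for u
      proof (rule holomorphic_on_compose_gen[where g = riemann_zeta and f = "\<lambda>s. s + \<i> * of_real u", unfolded o_def])
        show "(\<lambda>s. s + \<i> * of_real u) holomorphic_on cball z (e z)" by (intro holomorphic_intros)
        show "riemann_zeta holomorphic_on - {1}" by (rule riemann_zeta_holomorphic)
        have "Re s < 1" if "s \<in> cball z (e z)" for s using F(3)[OF z(1)] that \<rho> by auto
        thus "(\<lambda>s. s + \<i> * of_real u) ` cball z (e z) \<subseteq> - {1}" by (force simp: complex_eq_iff)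
      qed
      thus ?thesis by (intro holomorphic_intros)
    qed
    \<comment> \<open>Applied to the square of the difference, which is again holomorphic, the
      estimate involves exactly the mean square over the circle.\<close>
    from cauchy_mean_bound[OF this F(2)[OF z(1)], of s]
    have "norm ((?D t s)\<^sup>2) \<le> 2 * integral {0..1} (\<lambda>x. norm ((?D t (circlepath z (e z) x))\<^sup>2))"
      using z(2) by (simp add: dist_norm norm_minus_commute)
    also have "\<dots> \<le> 2 * \<Phi> t"
      unfolding \<Phi>_def norm_power using F(1) z(1) int_nonneg by (intro mult_left_mono member_le_sum) auto
    also have "\<dots> \<le> (\<epsilon> / 2)\<^sup>2" using t unfolding \<delta>_def by (simp add: power2_eq_square)
    finally have "(norm (?D t s))\<^sup>2 \<le> (\<epsilon> / 2)\<^sup>2" by (simp only: norm_power)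
    thus ?thesis by (rule power2_le_imp_le) (use \<epsilon> in simp)
  qed
  have B0: "B \<ge> 0" using W(2) order_trans by blast
  show ?thesis
  proof (rule exI[of _ "1 / (4 * (B + 1))"], rule conjI)
    show "1 / (4 * (B + 1)) > 0" using B0 by simp
    show "\<forall>\<^sub>F T in at_top. 1 / (4 * (B + 1)) * T \<le> measure lebesgue
           {\<tau> \<in> {0..T}. (SUP s\<in>K. ereal (cmod (?D \<tau> s))) < ereal \<epsilon>}"
      using W(3,4) eventually_ge_at_top[of 0]
    proof eventually_elim
      case (elim T)
      let ?G = "{\<tau> \<in> {0..T}. (SUP s\<in>K. ereal (cmod (?D \<tau> s))) < ereal \<epsilon>}"
      have G: "?G \<in> lmeasurable"
      proof (rule SUP_less_lmeasurable)
        fix s assume "s \<in> K"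
        hence "Re s < 1" using K(2) by (auto simp: strip_D_def)
        from riemann_zeta_line_continuous[OF this, of UNIV 1] riemann_zeta_line_continuous[OF this, of UNIV d]
        show "continuous_on UNIV (\<lambda>\<tau>. cmod (?D \<tau> s))" by (intro continuous_on_norm continuous_on_diff) simp_all
      qed
      have sub: "t \<in> ?G" if "t \<in> {0..T}" "\<Phi> t < \<delta>" for t
      proof -
        have "(SUP s\<in>K. ereal (cmod (?D t s))) \<le> ereal (\<epsilon> / 2)" by (rule SUP_least) (use sup[OF that(2)] in simp)
        also have "\<dots> < ereal \<epsilon>" using \<epsilon> by simp
        finally show ?thesis using that(1) by simp
      qed
      have WD: "integral {0..T} (\<lambda>t. W t * integral {0..1} (\<lambda>x. (norm (?D t (circlepath z (e z) x)))\<^sup>2)) \<le> \<eta> * T" if z: "z \<in> F" for z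
      proof -
        let ?f = "\<lambda>t x. W t * (norm (?D t (circlepath z (e z) x)))\<^sup>2"
        have cf: "continuous_on (A \<times> C) (\<lambda>(t, x). ?f t x)" for A C
        proof -
          have "continuous_on (A \<times> C) (\<lambda>p. W (fst p))"
            by (rule continuous_on_compose2[OF W(1)[THEN spec, of UNIV] continuous_on_fst[OF continuous_on_id]]) auto
          from continuous_on_mult[OF this contD[OF z, of A C, unfolded case_prod_unfold]] show ?thesis
            unfolding case_prod_unfold .
        qed
        have "integral {0..T} (\<lambda>t. W t * integral {0..1} (\<lambda>x. (norm (?D t (circlepath z (e z) x)))\<^sup>2)) = integral (cbox 0 T) (\<lambda>t. integral (cbox 0 1) (?f t))"
          by simp
        \<comment> \<open>With the integral over \<open>t\<close> inside, the mean square bound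
          applies at every point of the circle with one and the same \<open>T\<close>.\<close>
        also have "\<dots> = integral (cbox 0 1) (\<lambda>x. integral (cbox 0 T) (\<lambda>t. ?f t x))"
          by (rule integral_swap_continuous) (use cf[of "cbox 0 T" "cbox 0 1"] in \<open>simp add: cbox_Pair_eq\<close>)
        also have "\<dots> \<le> integral (cbox 0 1) (\<lambda>x::real. \<eta> * T)"
        proof (rule integral_le)
          have "continuous_on (cbox 0 1) (\<lambda>x. integral (cbox 0 T) (\<lambda>t. ?f t x))"
          proof (rule integral_continuous_on_param)
            show "continuous_on (cbox 0 1 \<times> cbox 0 T) (\<lambda>(x, t). ?f t x)"
              using continuous_on_compose2[OF cf[of UNIV UNIV] continuous_on_swap, of "cbox 0 1 \<times> cbox 0 T"]
              by (simp add: case_prod_unfold)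
          qed
          thus "(\<lambda>x. integral (cbox 0 T) (\<lambda>t. ?f t x)) integrable_on cbox 0 1" by (rule integrable_continuous)
          fix x :: real
          have "circlepath z (e z) x \<in> ?X" using circ[OF z] F(3)[OF z] by blast
          from bspec[OF elim(2) this] show "integral (cbox 0 T) (\<lambda>t. ?f t x) \<le> \<eta> * T" by simp
        qed auto
        finally show ?thesis by simp
      qed
      have "integral {0..T} (\<lambda>t. W t * \<Phi> t) = integral {0..T} (\<lambda>t. \<Sum>z\<in>F. W t * integral {0..1} (\<lambda>x. (norm (?D t (circlepath z (e z) x)))\<^sup>2))"
        by (simp add: \<Phi>_def sum_distrib_left)
      also have "\<dots> = (\<Sum>z\<in>F. integral {0..T} (\<lambda>t. W t * integral {0..1} (\<lambda>x. (norm (?D t (circlepath z (e z) x)))\<^sup>2)))"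
        using F(1) W(1) by (intro integral_sum integrable_continuous_real continuous_on_mult cont_int) auto
      also have "\<dots> \<le> (\<Sum>z\<in>F. \<eta> * T)" by (intro sum_mono WD)
      also have "\<dots> = (real (card F) * \<eta>) * T" by simp
      also have "\<dots> \<le> (\<delta> / 4) * T" using F\<eta> elim(3) by (intro mult_right_mono)
      finally have I: "integral {0..T} (\<lambda>t. W t * \<Phi> t) / \<delta> \<le> T / 4" using \<delta> by (simp add: field_simps)
      have "integral {0..T} W \<le> B * measure lebesgue ?G + integral {0..T} (\<lambda>t. W t * \<Phi> t) / \<delta>"
        by (rule weighted_measure_lower_bound[OF _ _ _ cont\<Phi> _ \<delta> G _ sub]) (use W(1,2) \<Phi>0 in auto)
      hence "T / 4 \<le> B * measure lebesgue ?G" using I elim(1) by linarith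
      also have "\<dots> \<le> (B + 1) * measure lebesgue ?G" by (intro mult_right_mono) auto
      finally show ?case using B0 by (simp add: field_simps)
    qed
  qed
qed

lemma Liminf_mean_measure_pos:
  fixes m :: "real \<Rightarrow> real"
  assumes "c > 0" "\<forall>\<^sub>F T in at_top. c * T \<le> m T"
  shows "Liminf at_top (\<lambda>T::real. ereal (1 / T * m T)) > 0"
proof -
  have "\<forall>\<^sub>F T in at_top. ereal c \<le> ereal (1 / T * m T)"
    using assms(2) eventually_gt_at_top[of 0] by eventually_elim (simp add: field_simps)
  hence "ereal c \<le> Liminf at_top (\<lambda>T::real. ereal (1 / T * m T))" by (rule Liminf_bounded)
  thus ?thesis using assms(1) by (metis ereal_less(2) less_le_trans)
qed

theorem theorem3:
  fixes a b :: int and d :: real and K :: "complex set" and \<epsilon> :: real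
  assumes "b \<noteq> 0" and "d = real_of_int a / real_of_int b" and "d \<noteq> 0"
    and "\<bar>a - b\<bar> \<noteq> 1" and "gcd a b = 1"
    and "compact K" and "K \<subseteq> strip_D" and "\<epsilon> > 0"
  shows "Liminf at_top (\<lambda>T::real. ereal (1 / T * measure lebesgue
           {\<tau> \<in> {0..T}. (SUP s\<in>K. ereal (cmod (riemann_zeta (s + \<i> * of_real \<tau>)
              - riemann_zeta (s + \<i> * of_real (d * \<tau>))))) < ereal \<epsilon>})) > 0"
proof -
  have "\<exists>c>0. \<forall>\<^sub>F T in at_top. c * T \<le> measure lebesgue
           {\<tau> \<in> {0..T}. (SUP s\<in>K. ereal (cmod (riemann_zeta (s + \<i> * of_real \<tau>)
              - riemann_zeta (s + \<i> * of_real (d * \<tau>))))) < ereal \<epsilon>}"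
  proof (cases "a = b")
    case True
    hence d: "d = 1" using assms by simp
    \<comment> \<open>An upper bound instead of an evaluation, because for empty \<open>K\<close>
      this supremum is minus infinity.\<close>
    have "(SUP s\<in>K. ereal 0) < ereal \<epsilon>"
    proof -
      have "(SUP s\<in>K. ereal 0) \<le> ereal 0" by (rule SUP_least) simp
      also have "\<dots> < ereal \<epsilon>" using assms by simp
      finally show ?thesis .
    qed
    hence "{\<tau> \<in> {0..T}. (SUP s\<in>K. ereal (cmod (riemann_zeta (s + \<i> * of_real \<tau>)
              - riemann_zeta (s + \<i> * of_real (d * \<tau>))))) < ereal \<epsilon>} = {0..T}" for T
      unfolding d by auto
    thus ?thesis
      by (intro exI[of _ 1] conjI) (auto intro!: eventually_mono[OF eventually_ge_at_top[of 0]])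
  next
    case False
    \<comment> \<open>Multiplying both integers by the sign of \<open>b\<close> preserves their
      quotient, their gcd and \<open>\<bar>a - b\<bar>\<close>, and makes the denominator positive,
      as the substitution \<open>\<tau> = b * t\<close> on \<open>[0, T]\<close> requires.\<close>
    define a' where "a' = sgn b * a"
    define b' where "b' = \<bar>b\<bar>"
    have "b' = sgn b * b" by (simp add: b'_def abs_sgn)
    hence "\<bar>a' - b'\<bar> = \<bar>sgn b\<bar> * \<bar>a - b\<bar>" by (simp add: a'_def right_diff_distrib[symmetric] abs_mult)
    hence 1: "\<bar>a' - b'\<bar> \<ge> 2" using assms(1,4) False by (simp add: abs_sgn_eq)
    have 2: "gcd a' b' = 1" using assms(1,5) by (cases "b > 0") (auto simp: a'_def b'_def)
    have 3: "a' \<noteq> 0" "b' > 0" using assms(1-3) by (auto simp: a'_def b'_def sgn_if)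
    have 4: "d = of_int a' / of_int b'" using assms(1,2) by (cases "b > 0") (auto simp: a'_def b'_def)
    show ?thesis by (rule self_approximation[OF 1 2 3 4 assms(6-8)])
  qed
  then obtain c where "c > 0" "\<forall>\<^sub>F T in at_top. c * T \<le> measure lebesgue
           {\<tau> \<in> {0..T}. (SUP s\<in>K. ereal (cmod (riemann_zeta (s + \<i> * of_real \<tau>)
              - riemann_zeta (s + \<i> * of_real (d * \<tau>))))) < ereal \<epsilon>}" by blast
  thus ?thesis by (rule Liminf_mean_measure_pos)
qed

end
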